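(* Let $\mathcal{O}$ be a commutative algebra over $\mathbb{C}$ equipped with a Poisson structure $\{-,-\}:\mathcal{O}\otimes\mathcal{O}\to\mathcal{O}$. Let $\tilde{\mathcal{O}}$ be a resolution of $\mathcal{O}$, that is, a polynomial commutative dg-algebra $\tilde{\mathcal{O}}=\mathbb{C}[\tilde{u}_1,\ldots,\tilde{u}_r]$ on homogeneous generators of nonnegative lower degree such that $H_0(\tilde{\mathcal{O}})=\mathcal{O}$ and $H_*(\tilde{\mathcal{O}})=0$ for $*>0$, with augmentation quasi-isomorphism $\epsilon:\tilde{\mathcal{O}}\to\mathcal{O}$. Then there exists a homotopy Poisson structure $\tilde{\pi}_*=\sum_{s\ge 2}\tilde{\pi}_s$ on $\tilde{\mathcal{O}}$, with $\tilde{\pi}_s\in T^s(\tilde{\mathcal{O}})^2$, such that $$\epsilon(\tilde{\pi}_2(df,dg))=\{\epsilon(f),\epsilon(g)\}\qquad\text{for all } f,g\in\tilde{\mathcal{O}}.$$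
   Context: Poisson structure: a biderivation $\{-,-\}:\mathcal{O}\otimes\mathcal{O}\to\mathcal{O}$ over $\mathbb{C}$, antisymmetric, with $\{f,\{g,h\}\}+\{g,\{h,f\}\}+\{h,\{f,g\}\}=0$ for all $f,g,h\in\mathcal{O}$. Dg-modules: differential graded $\mathbb{C}$-modules; lower and upper gradings are related by $V^d=V_{-d}$, $|v|$ denotes the lower degree, and the differential $\delta$ lowers the lower degree by $1$. The Koszul sign rule is used: the symmetry isomorphism is $v\otimes w\mapsto(-1)^{|v||w|}w\otimes v$, and $\delta(v\otimes w)=\delta(v)\otimes w+(-1)^{|v|}v\otimes\delta(w)$. $\mathrm{Hom}^m(V,W)$ is the module of homogeneous maps lowering the lower degree by $m$ (so such a map $f$ has $|f|=-m$), with $\delta(f)=\delta\circ f-(-1)^{|f|}f\circ\delta$. A commutative dg-algebra is a dg-module with an associative, graded commutative product, for which $\delta$ is a derivation. Polynomial dg-algebra: $\tilde{\mathcal{O}}=\mathbb{C}[\tilde{u}_1,\ldots,\tilde{u}_r]$ denotes a commutative dg-algebra which, forgetting $\delta$, is the free graded commutative algebra on homogeneous elements $\tilde{u}_1,\ldots,\tilde{u}_r$. The algebra $\mathcal{O}$ is viewed as a dg-algebra concentrated in degree $0$. Kähler forms: $\Omega^*(\tilde{\mathcal{O}})$ is the commutative dg-algebra over $\tilde{\mathcal{O}}$ generated by elements $df$, $f\in\tilde{\mathcal{O}}$ ($d$ being $\mathbb{C}$-linear), subject to $d(fg)=df\cdot g+(-1)^{|f|}f\cdot dg$, with $|df|=|f|+1$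 and $\delta(df)=-d(\delta(f))$. $\Omega^s(\tilde{\mathcal{O}})$ is the dg-submodule spanned by the products $f_0\,df_1\cdots df_s$ with $s$ differentials. Multivectors: $T^s(\tilde{\mathcal{O}})^m=\mathrm{Hom}^m_{\tilde{\mathcal{O}}}(\Omega^s(\tilde{\mathcal{O}}),\tilde{\mathcal{O}})$ (graded $\tilde{\mathcal{O}}$-linear maps lowering the lower degree by $m$), with differential $\delta(P)=\delta\circ P-(-1)^{m}P\circ\delta$ for $P\in T^s(\tilde{\mathcal{O}})^m$ (composition of maps, where $\delta$ on the right-hand side denotes the differential of $\tilde{\mathcal{O}}$, respectively of $\Omega^s(\tilde{\mathcal{O}})$). One writes $P(df_1,\ldots,df_s)=P(df_1\cdots df_s)$. Schouten–Nijenhuis bracket: $[-,-]:T^s(\tilde{\mathcal{O}})^m\otimes T^t(\tilde{\mathcal{O}})^n\to T^{s+t-1}(\tilde{\mathcal{O}})^{m+n-1}$, $[P,Q]=P\circ Q\pm Q\circ P$, where $$P\circ Q(df_1,\ldots,df_{s+t-1})=\sum\pm P(df_{i_1},\ldots,df_{i_{s-1}},dQ(df_{j_1},\ldots,df_{j_t})),$$ the sum being over all decompositions $\{1,\ldots,s+t-1\}=\{i_1<\cdots<i_{s-1}\}\sqcup\{j_1<\cdots<j_t\}$. The sign in the sum is the Koszul sign of the permutation taking $P,d,Q,df_1,\ldots,df_{s+t-1}$ to $P,df_{i_1},\ldots,df_{i_{s-1}},d,Q,df_{j_1},\ldots,df_{j_t}$ (with $|d|=1$, $|Q|=-n$). The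 sign in $[P,Q]$ is $-(-1)^{(m-1)(n-1)}$; in particular $[P,Q]=P\circ Q+Q\circ P$ when $m=n=2$. Homotopy Poisson structure on $\tilde{\mathcal{O}}$: a sequence of multivectors $\tilde{\pi}_s\in T^s(\tilde{\mathcal{O}})^2$, $s\ge2$, whose formal sum $\tilde{\pi}_*=\sum_s\tilde{\pi}_s$ satisfies the Maurer–Cartan equation $\delta(\tilde{\pi}_* )+\frac12[\tilde{\pi}_*,\tilde{\pi}_*]=0$, i.e. for every $s\ge2$, $$\delta(\tilde{\pi}_s)+\frac12\sum_{p+q=s+1}[\tilde{\pi}_p,\tilde{\pi}_q]=0\qquad(p,q\ge2).$$ *)

theory Defs
  imports Complex_Main
begin

section \<open>Commutative dg-algebras over the complex numbers\<close>

definition (in uminus) ksign :: "int \<Rightarrow> 'a \<Rightarrow> 'a" where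
  "ksign k x = (if even k then x else - x)"

class dg_ops =
  fixes scaleC :: "complex \<Rightarrow> 'a \<Rightarrow> 'a"  (infixr "*\<^sub>C" 75)
    and hmg :: "int \<Rightarrow> 'a set"  \<comment> \<open>homogeneous elements, by lower degree\<close>
    and dlt :: "'a \<Rightarrow> 'a"  ("\<delta>")

class dg_module = dg_ops + ab_group_add +
  assumes scaleC_add_right: "c *\<^sub>C (x + y) = c *\<^sub>C x + c *\<^sub>C y"
    and scaleC_add_left: "(b + c) *\<^sub>C x = b *\<^sub>C x + c *\<^sub>C x"
    and scaleC_scaleC: "b *\<^sub>C (c *\<^sub>C x) = (b * c) *\<^sub>C x"
    and scaleC_one: "1 *\<^sub>C x = x"
    and hmg_zero: "0 \<in> hmg n"
    and hmg_add: "\<lbrakk>x \<in> hmg n; y \<in> hmg n\<rbrakk> \<Longrightarrow> x + y \<in> hmg n"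
    and hmg_scaleC: "x \<in> hmg n \<Longrightarrow> c *\<^sub>C x \<in> hmg n"
    and hmg_decomposition:
      "\<exists>!f :: int \<Rightarrow> 'a. (\<forall>n. f n \<in> hmg n) \<and> finite {n. f n \<noteq> 0} \<and> x = (\<Sum>n | f n \<noteq> 0. f n)"
    and dlt_add: "\<delta> (x + y) = \<delta> x + \<delta> y"
    and dlt_scaleC: "\<delta> (c *\<^sub>C x) = c *\<^sub>C \<delta> x"
    and dlt_hmg: "x \<in> hmg n \<Longrightarrow> \<delta> x \<in> hmg (n - 1)"
    and dlt_dlt: "\<delta> (\<delta> x) = 0"

text \<open>The sort constraint does not include \<open>zero_neq_one\<close>: the zero algebra is allowed.\<close>

class cdga = dg_module + ring + monoid_mult +
  assumes scaleC_mult_left: "(c *\<^sub>C x) * y = c *\<^sub>C (x * y)"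
    and scaleC_mult_right: "x * (c *\<^sub>C y) = c *\<^sub>C (x * y)"
    and hmg_one: "1 \<in> hmg 0"
    and hmg_mult: "\<lbrakk>x \<in> hmg m; y \<in> hmg n\<rbrakk> \<Longrightarrow> x * y \<in> hmg (m + n)"
    and graded_commute: "\<lbrakk>x \<in> hmg m; y \<in> hmg n\<rbrakk> \<Longrightarrow> x * y = ksign (m * n) (y * x)"
    and dlt_mult: "x \<in> hmg m \<Longrightarrow> \<delta> (x * y) = \<delta> x * y + ksign m (x * \<delta> y)"

global_interpretation complex_vector: vector_space "scaleC :: complex \<Rightarrow> 'a \<Rightarrow> 'a::dg_module"
  by unfold_locales (simp_all add: scaleC_add_right scaleC_add_left scaleC_scaleC scaleC_one)

lemma ksign_0 [simp]: "ksign k 0 = (0::'a::ab_group_add)"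
  by (simp add: ksign_def)

lemma ksign_conv_scaleC: "ksign k x = ((if even k then 1 else -1) :: complex) *\<^sub>C (x :: 'a::dg_module)"
  by (simp add: ksign_def)

definition homology_class :: "int \<Rightarrow> 'a::dg_module \<Rightarrow> 'a set" where
  "homology_class n x = {x + \<delta> y | y. y \<in> hmg (n + 1)}"

definition homology :: "'a itself \<Rightarrow> int \<Rightarrow> 'a::dg_module set set" where
  "homology _ n = homology_class n ` {x \<in> hmg n. \<delta> x = 0}"

definition dg_hom :: "('a::dg_module \<Rightarrow> 'b::dg_module) \<Rightarrow> bool" where
  "dg_hom f \<longleftrightarrow>
     (\<forall>x y. f (x + y) = f x + f y) \<and> (\<forall>c x. f (c *\<^sub>C x) = c *\<^sub>C f x) \<and>
     (\<forall>n. f ` hmg n \<subseteq> hmg n) \<and> (\<forall>x. f (\<delta> x) = \<delta> (f x))"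

definition cdga_hom :: "('a::cdga \<Rightarrow> 'b::cdga) \<Rightarrow> bool" where
  "cdga_hom f \<longleftrightarrow> dg_hom f \<and> f 1 = 1 \<and> (\<forall>x y. f (x * y) = f x * f y)"

text \<open>The map on homology sends the class of \<open>x\<close>, a set of cycles, to the union of the (equal)
  classes of their images.\<close>

definition quasi_iso :: "('a::dg_module \<Rightarrow> 'b::dg_module) \<Rightarrow> bool" where
  "quasi_iso f \<longleftrightarrow> dg_hom f \<and>
     (\<forall>n. bij_betw (\<lambda>X. \<Union>x\<in>X. homology_class n (f x)) (homology TYPE('a) n) (homology TYPE('b) n))"

lemma homology_map_class:
  assumes "dg_hom f"
  shows "(\<Union>x\<in>homology_class n x0. homology_class n (f x)) = homology_class n (f x0)"
proof -
  have z: "\<delta> (0::'a) = 0"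
    using dlt_add[of "0::'a" 0] by simp
  have f: "f (x + \<delta> y) = f x + \<delta> (f y)" "y \<in> hmg m \<Longrightarrow> f y \<in> hmg m" for x y m
    using assms by (auto simp: dg_hom_def image_subset_iff)
  have "f x0 + \<delta> (f y) + \<delta> w \<in> homology_class n (f x0)" if "y \<in> hmg (n + 1)" "w \<in> hmg (n + 1)" for y w
    unfolding homology_class_def using that hmg_add[OF f(2)[OF that(1)] that(2)]
    by (auto intro!: exI[of _ "f y + w"] simp: dlt_add add.assoc)
  moreover have "x0 \<in> homology_class n x0"
    unfolding homology_class_def using z hmg_zero[of "n+1"] by force
  ultimately show ?thesis
    by (fastforce simp: homology_class_def f)
qed

definition concentrated_in_degree_0 :: "'a::dg_module itself \<Rightarrow> bool" where
  "concentrated_in_degree_0 _ \<longleftrightarrow> (\<forall>n. n \<noteq> 0 \<longrightarrow> hmg n = {0 :: 'a})"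

lemma concentrated_in_degree_0D:
  assumes "concentrated_in_degree_0 TYPE('a::cdga)"
  shows "hmg 0 = (UNIV :: 'a set)" and "\<delta> (x::'a) = 0" and "(x::'a) * y = y * x"
proof -
  have *: "x \<in> hmg 0" for x :: 'a
  proof -
    obtain f where f: "\<forall>n. f n \<in> hmg n" "finite {n. f n \<noteq> 0}" "x = (\<Sum>n | f n \<noteq> 0. f n)"
      using hmg_decomposition[of x] by blast
    from f(1) assms have "{n. f n \<noteq> 0} \<subseteq> {0}"
      unfolding concentrated_in_degree_0_def by (metis (mono_tags) mem_Collect_eq singletonD singletonI subsetI)
    then have "x = (\<Sum>n\<in>{0}. f n)"
      unfolding f(3) by (intro sum.mono_neutral_left) auto
    with f(1) show ?thesis by simp
  qed
  then show "hmg 0 = (UNIV :: 'a set)" by auto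
  show "\<delta> x = 0"
    using dlt_hmg[OF *[of x]] assms unfolding concentrated_in_degree_0_def by auto
  show "x * y = y * x"
    using graded_commute[OF * *, of x y] by (simp add: ksign_def)
qed

section \<open>Poisson structures\<close>

definition poisson_structure :: "('a::cdga \<Rightarrow> 'a \<Rightarrow> 'a) \<Rightarrow> bool" where
  "poisson_structure br \<longleftrightarrow>
     (\<forall>f g h. br (f + g) h = br f h + br g h) \<and> (\<forall>c f g. br (c *\<^sub>C f) g = c *\<^sub>C br f g) \<and>
     (\<forall>f g h. br f (g + h) = br f g + br f h) \<and> (\<forall>c f g. br f (c *\<^sub>C g) = c *\<^sub>C br f g) \<and>
     (\<forall>f g h. br (f * g) h = f * br g h + br f h * g) \<and>
     (\<forall>f g h. br f (g * h) = br f g * h + g * br f h) \<and>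
     (\<forall>f g. br f g = - br g f) \<and>
     (\<forall>f g h. br f (br g h) + br g (br h f) + br h (br f g) = 0)"

section \<open>Polynomial dg-algebras\<close>

text \<open>The free graded commutative algebra on \<open>u\<^sub>0, \<dots>, u\<^sub>r\<^sub>-\<^sub>1\<close> of degrees \<open>e\<^sub>0, \<dots>, e\<^sub>r\<^sub>-\<^sub>1\<close> is the
  polynomial algebra on the even generators tensored with the exterior algebra on the odd ones:
  the ordered monomials in which odd generators have exponent at most 1 form a basis.\<close>

definition exponents :: "nat \<Rightarrow> (nat \<Rightarrow> int) \<Rightarrow> (nat \<Rightarrow> nat) set" where
  "exponents r e = {a. (\<forall>i\<ge>r. a i = 0) \<and> (\<forall>i<r. odd (e i) \<longrightarrow> a i \<le> 1)}"

definition monomial :: "nat \<Rightarrow> (nat \<Rightarrow> 'a::monoid_mult) \<Rightarrow> (nat \<Rightarrow> nat) \<Rightarrow> 'a" where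
  "monomial r u a = prod_list (map (\<lambda>i. u i ^ a i) [0..<r])"

definition polynomial_cdga :: "nat \<Rightarrow> (nat \<Rightarrow> 'a::cdga) \<Rightarrow> (nat \<Rightarrow> int) \<Rightarrow> bool" where
  "polynomial_cdga r u e \<longleftrightarrow>
     (\<forall>i<r. u i \<in> hmg (e i)) \<and>
     inj_on (monomial r u) (exponents r e) \<and>
     complex_vector.independent (monomial r u ` exponents r e) \<and>
     complex_vector.span (monomial r u ` exponents r e) = UNIV"

section \<open>Kaehler forms\<close>

text \<open>Formal expressions in the elements of the algebra and the symbols \<open>df\<close>, with a formal
  differential \<open>Delta\<close>; modulo the congruence below they form the commutative dg-algebra over \<open>'a\<close>
  generated by the \<open>df\<close>. The last axioms say that \<open>Inc\<close> is a morphism of dg-algebras, that \<open>d\<close> is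
  linear and satisfies the graded Leibniz rule, and \<open>\<delta>(df) = - d(\<delta> f)\<close>.\<close>

datatype 'a kterm =
    Inc 'a
  | Dif 'a
  | Plus "'a kterm" "'a kterm"
  | Times "'a kterm" "'a kterm"
  | Scale complex "'a kterm"
  | Delta "'a kterm"

inductive khom :: "'a::cdga kterm \<Rightarrow> int \<Rightarrow> bool" where
  "a \<in> hmg n \<Longrightarrow> khom (Inc a) n"
| "a \<in> hmg n \<Longrightarrow> khom (Dif a) (n + 1)"
| "\<lbrakk>khom s n; khom t n\<rbrakk> \<Longrightarrow> khom (Plus s t) n"
| "\<lbrakk>khom s m; khom t n\<rbrakk> \<Longrightarrow> khom (Times s t) (m + n)"
| "khom t n \<Longrightarrow> khom (Scale c t) n"
| "khom t n \<Longrightarrow> khom (Delta t) (n - 1)"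

definition tsign :: "int \<Rightarrow> 'a kterm \<Rightarrow> 'a kterm" where
  "tsign k t = Scale (if even k then 1 else -1) t"

inductive keq :: "'a::cdga kterm \<Rightarrow> 'a kterm \<Rightarrow> bool"  (infix "\<approx>" 50) where
  refl: "t \<approx> t"
| sym: "s \<approx> t \<Longrightarrow> t \<approx> s"
| trans: "\<lbrakk>s \<approx> t; t \<approx> w\<rbrakk> \<Longrightarrow> s \<approx> w"
| Plus: "\<lbrakk>s \<approx> s'; t \<approx> t'\<rbrakk> \<Longrightarrow> Plus s t \<approx> Plus s' t'"
| Times: "\<lbrakk>s \<approx> s'; t \<approx> t'\<rbrakk> \<Longrightarrow> Times s t \<approx> Times s' t'"
| Scale: "t \<approx> t' \<Longrightarrow> Scale c t \<approx> Scale c t'"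
| Delta: "t \<approx> t' \<Longrightarrow> Delta t \<approx> Delta t'"
| Plus_assoc: "Plus (Plus s t) w \<approx> Plus s (Plus t w)"
| Plus_comm: "Plus s t \<approx> Plus t s"
| Plus_zero: "Plus (Inc 0) t \<approx> t"
| Plus_inverse: "Plus (Scale (-1) t) t \<approx> Inc 0"
| Scale_Plus: "Scale c (Plus s t) \<approx> Plus (Scale c s) (Scale c t)"
| Scale_add: "Scale (b + c) t \<approx> Plus (Scale b t) (Scale c t)"
| Scale_Scale: "Scale b (Scale c t) \<approx> Scale (b * c) t"
| Scale_one: "Scale 1 t \<approx> t"
| Times_assoc: "Times (Times s t) w \<approx> Times s (Times t w)"
| Times_one_left: "Times (Inc 1) t \<approx> t"
| Times_one_right: "Times t (Inc 1) \<approx> t"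
| Times_Plus_left: "Times (Plus s t) w \<approx> Plus (Times s w) (Times t w)"
| Times_Plus_right: "Times s (Plus t w) \<approx> Plus (Times s t) (Times s w)"
| Times_Scale_left: "Times (Scale c s) t \<approx> Scale c (Times s t)"
| Times_Scale_right: "Times s (Scale c t) \<approx> Scale c (Times s t)"
| Times_comm: "\<lbrakk>khom s m; khom t n\<rbrakk> \<Longrightarrow> Times s t \<approx> tsign (m * n) (Times t s)"
| Delta_Plus: "Delta (Plus s t) \<approx> Plus (Delta s) (Delta t)"
| Delta_Scale: "Delta (Scale c t) \<approx> Scale c (Delta t)"
| Delta_Delta: "Delta (Delta t) \<approx> Inc 0"
| Delta_Times: "khom s m \<Longrightarrow> Delta (Times s t) \<approx> Plus (Times (Delta s) t) (tsign m (Times s (Delta t)))"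
| Inc_add: "Inc (a + b) \<approx> Plus (Inc a) (Inc b)"
| Inc_scaleC: "Inc (c *\<^sub>C a) \<approx> Scale c (Inc a)"
| Inc_mult: "Inc (a * b) \<approx> Times (Inc a) (Inc b)"
| Inc_dlt: "Inc (\<delta> a) \<approx> Delta (Inc a)"
| Dif_add: "Dif (a + b) \<approx> Plus (Dif a) (Dif b)"
| Dif_scaleC: "Dif (c *\<^sub>C a) \<approx> Scale c (Dif a)"
| Dif_mult: "a \<in> hmg m \<Longrightarrow> Dif (a * b) \<approx> Plus (Times (Dif a) (Inc b)) (tsign m (Times (Inc a) (Dif b)))"
| Dif_dlt: "Delta (Dif a) \<approx> Scale (-1) (Dif (\<delta> a))"

lemmas keq_axioms = keq.refl keq.intros(8-)

quotient_type (overloaded) 'a kaehler = "'a::cdga kterm" / keq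
  by (auto intro!: equivpI reflpI sympI transpI intro: keq.intros)

lift_definition inc :: "'a::cdga \<Rightarrow> 'a kaehler" is Inc .

lift_definition kd :: "'a::cdga \<Rightarrow> 'a kaehler"  ("\<d>") is Dif .

instantiation kaehler :: (cdga) "{dg_ops, ring, monoid_mult}"
begin

lift_definition zero_kaehler :: "'a kaehler" is "Inc 0" .
lift_definition one_kaehler :: "'a kaehler" is "Inc 1" .
lift_definition plus_kaehler :: "'a kaehler \<Rightarrow> 'a kaehler \<Rightarrow> 'a kaehler" is Plus by (rule keq.Plus)
lift_definition times_kaehler :: "'a kaehler \<Rightarrow> 'a kaehler \<Rightarrow> 'a kaehler" is Times by (rule keq.Times)
lift_definition uminus_kaehler :: "'a kaehler \<Rightarrow> 'a kaehler" is "Scale (-1)" by (rule keq.Scale)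
lift_definition scaleC_kaehler :: "complex \<Rightarrow> 'a kaehler \<Rightarrow> 'a kaehler" is Scale by (rule keq.Scale)
lift_definition dlt_kaehler :: "'a kaehler \<Rightarrow> 'a kaehler" is Delta by (rule keq.Delta)

definition minus_kaehler :: "'a kaehler \<Rightarrow> 'a kaehler \<Rightarrow> 'a kaehler" where
  "minus_kaehler x y = x + - y"

definition hmg_kaehler :: "int \<Rightarrow> 'a kaehler set" where
  "hmg_kaehler n = abs_kaehler ` {t. khom t n}"

instance
  by standard (transfer; (rule keq_axioms) | simp add: minus_kaehler_def)+

end

text \<open>Directness of the grading is seen from the operator acting by \<open>2\<^sup>n\<close> in degree \<open>n\<close>.\<close>

definition hcomp :: "'a::dg_module \<Rightarrow> int \<Rightarrow> 'a" where
  "hcomp x = (THE f. (\<forall>n. f n \<in> hmg n) \<and> finite {n. f n \<noteq> 0} \<and> x = (\<Sum>n | f n \<noteq> 0. f n))"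

lemma hcomp:
  shows "hcomp x n \<in> hmg n" and "finite {n. hcomp x n \<noteq> 0}" and "x = (\<Sum>n | hcomp x n \<noteq> 0. hcomp x n)"
  using theI'[OF hmg_decomposition[of x]] unfolding hcomp_def by auto

lemma hcomp_eqI:
  assumes "\<And>n. f n \<in> hmg n" "finite F" "\<And>n. n \<notin> F \<Longrightarrow> f n = 0" "x = (\<Sum>n\<in>F. f n)"
  shows "hcomp x = f"
proof -
  have s: "{n. f n \<noteq> 0} \<subseteq> F" using assms(3) by blast
  have "(\<Sum>n\<in>F. f n) = (\<Sum>n | f n \<noteq> 0. f n)"
    by (rule sum.mono_neutral_right[OF assms(2) s]) auto
  then have "(\<forall>n. f n \<in> hmg n) \<and> finite {n. f n \<noteq> 0} \<and> x = (\<Sum>n | f n \<noteq> 0. f n)"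
    using assms finite_subset[OF s] by auto
  then show ?thesis
    unfolding hcomp_def by (rule the1_equality[OF hmg_decomposition])
qed

lemma hcomp_homogeneous: "x \<in> hmg n \<Longrightarrow> hcomp x = (\<lambda>k. if k = n then x else 0)"
  by (rule hcomp_eqI[where F = "{n}"]) (auto simp: hmg_zero)

lemma hcomp_sum: "finite F \<Longrightarrow> {n. hcomp x n \<noteq> 0} \<subseteq> F \<Longrightarrow> x = (\<Sum>n\<in>F. hcomp x n)"
  by (subst hcomp(3)[of x], rule sum.mono_neutral_left) auto

lemma hcomp_add: "hcomp (x + y) = (\<lambda>n. hcomp x n + hcomp y n)"
proof (rule hcomp_eqI[where F = "{n. hcomp x n \<noteq> 0} \<union> {n. hcomp y n \<noteq> 0}"])
  let ?F = "{n. hcomp x n \<noteq> 0} \<union> {n. hcomp y n \<noteq> 0}"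
  show f: "finite ?F" by (simp add: hcomp(2))
  show "x + y = (\<Sum>n\<in>?F. hcomp x n + hcomp y n)"
    unfolding sum.distrib using hcomp_sum[OF f, of x] hcomp_sum[OF f, of y] by auto
qed (auto intro: hmg_add hcomp)

lemma hcomp_scaleC: "hcomp (c *\<^sub>C x) = (\<lambda>n. c *\<^sub>C hcomp x n)"
proof (rule hcomp_eqI[where F = "{n. hcomp x n \<noteq> 0}"])
  show "c *\<^sub>C x = (\<Sum>n | hcomp x n \<noteq> 0. c *\<^sub>C hcomp x n)"
    unfolding complex_vector.scale_sum_right[symmetric] by (simp flip: hcomp(3))
qed (auto intro: hmg_scaleC hcomp)

lemma hmg_induct [case_names homogeneous add]:
  assumes "\<And>n x. x \<in> hmg n \<Longrightarrow> Q x" and "\<And>x y. Q x \<Longrightarrow> Q y \<Longrightarrow> Q (x + y)"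
  shows "Q (x :: 'a::dg_module)"
proof -
  have "Q (\<Sum>n\<in>F. hcomp x n)" if "finite F" for F
    using that by induction (auto intro: assms hmg_zero hcomp)
  then show ?thesis using hcomp(2,3)[of x] by metis
qed

definition dilate :: "'a::dg_module \<Rightarrow> 'a" where
  "dilate x = (\<Sum>n | hcomp x n \<noteq> 0. (2 powi n) *\<^sub>C hcomp x n)"

lemma dilate_sum:
  assumes "finite F" "{n. hcomp x n \<noteq> 0} \<subseteq> F"
  shows "dilate x = (\<Sum>n\<in>F. (2 powi n) *\<^sub>C hcomp x n)"
  unfolding dilate_def by (rule sum.mono_neutral_left) (use assms in auto)

lemma dilate_homogeneous: "x \<in> hmg n \<Longrightarrow> dilate x = (2 powi n) *\<^sub>C x"
  by (subst dilate_sum[where F = "{n}"]) (auto simp: hcomp_homogeneous split: if_splits)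

lemma dilate_add: "dilate (x + y) = dilate x + dilate y"
proof -
  let ?F = "{n. hcomp x n \<noteq> 0} \<union> {n. hcomp y n \<noteq> 0}"
  have f: "finite ?F" by (simp add: hcomp(2))
  have s: "{n. hcomp (x + y) n \<noteq> 0} \<subseteq> ?F" by (auto simp: hcomp_add)
  show ?thesis
    unfolding dilate_sum[OF f s] dilate_sum[OF f Un_upper1] dilate_sum[OF f Un_upper2]
    by (simp add: hcomp_add scaleC_add_right sum.distrib)
qed

lemma dilate_scaleC: "dilate (c *\<^sub>C x) = c *\<^sub>C dilate x"
proof -
  have "dilate (c *\<^sub>C x) = (\<Sum>n | hcomp x n \<noteq> 0. (2 powi n) *\<^sub>C c *\<^sub>C hcomp x n)"
    by (subst dilate_sum[where F = "{n. hcomp x n \<noteq> 0}"]) (auto simp: hcomp_scaleC hcomp(2))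
  also have "\<dots> = c *\<^sub>C dilate x"
    by (simp add: dilate_def complex_vector.scale_sum_right mult.commute)
  finally show ?thesis .
qed

lemma dilate_hmg: "x \<in> hmg n \<Longrightarrow> dilate x \<in> hmg n"
  by (simp add: dilate_homogeneous hmg_scaleC)

lemma dilate_mult: "dilate (x * y) = dilate x * dilate (y :: 'a::cdga)"
proof (induction x rule: hmg_induct)
  case (homogeneous m x)
  then show ?case
  proof (induction y rule: hmg_induct)
    case (homogeneous n y)
    then show ?case
      by (simp add: dilate_homogeneous[OF hmg_mult] dilate_homogeneous scaleC_mult_left
          scaleC_mult_right scaleC_scaleC power_int_add)
  qed (simp add: dilate_add distrib_left)
qed (simp add: dilate_add distrib_right)

lemma dilate_dlt: "dilate (\<delta> x) = (1 / 2) *\<^sub>C \<delta> (dilate (x :: 'a::dg_module))"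
proof (induction x rule: hmg_induct)
  case (homogeneous n x)
  then show ?case
    by (simp add: dilate_homogeneous dilate_homogeneous[OF dlt_hmg] dlt_scaleC scaleC_scaleC
        power_int_diff)
qed (simp add: dilate_add dlt_add scaleC_add_right)

primrec kdilate :: "'a::cdga kterm \<Rightarrow> 'a kterm" where
  "kdilate (Inc a) = Inc (dilate a)"
| "kdilate (Dif a) = Scale 2 (Dif (dilate a))"
| "kdilate (Plus s t) = Plus (kdilate s) (kdilate t)"
| "kdilate (Times s t) = Times (kdilate s) (kdilate t)"
| "kdilate (Scale c t) = Scale c (kdilate t)"
| "kdilate (Delta t) = Scale (1 / 2) (Delta (kdilate t))"

lemma khom_kdilate: "khom t n \<Longrightarrow> khom (kdilate t) n"
  by (induction rule: khom.induct) (auto intro: khom.intros dilate_hmg)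

lemma kaehler_rules:
  fixes x y :: "'a::cdga kaehler"
  shows "c *\<^sub>C (x + y) = c *\<^sub>C x + c *\<^sub>C y" "(b + c) *\<^sub>C x = b *\<^sub>C x + c *\<^sub>C x"
    "b *\<^sub>C c *\<^sub>C x = (b * c) *\<^sub>C x" "1 *\<^sub>C x = x"
    "c *\<^sub>C x * y = c *\<^sub>C (x * y)" "x * c *\<^sub>C y = c *\<^sub>C (x * y)"
    "\<delta> (x + y) = \<delta> x + \<delta> y" "\<delta> (c *\<^sub>C x) = c *\<^sub>C \<delta> x" "\<delta> (\<delta> x) = 0"
  by (transfer; rule keq_axioms)+

lemma kaehler_vector_space: "vector_space (scaleC :: complex \<Rightarrow> 'a::cdga kaehler \<Rightarrow> 'a kaehler)"
  by unfold_locales (simp_all add: kaehler_rules)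

lemma scaleC_kaehler_zero: "c *\<^sub>C 0 = (0 :: 'a::cdga kaehler)" "0 *\<^sub>C x = (0 :: 'a kaehler)"
proof -
  interpret vector_space "scaleC :: complex \<Rightarrow> 'a kaehler \<Rightarrow> 'a kaehler"
    by (rule kaehler_vector_space)
  show "c *\<^sub>C 0 = (0 :: 'a kaehler)" "0 *\<^sub>C x = (0 :: 'a kaehler)" by simp_all
qed

lemma ksign_kaehler: "ksign k x = (if even k then 1 else -1 :: complex) *\<^sub>C (x :: 'a::cdga kaehler)"
proof -
  have "- x = (-1) *\<^sub>C x" by transfer (rule keq.refl)
  then show ?thesis by (simp add: ksign_def kaehler_rules)
qed

abbreviation kabs :: "'a::cdga kterm \<Rightarrow> 'a kaehler" where
  "kabs \<equiv> abs_kaehler"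

lemma kabs_simps:
  "kabs (Inc a) = inc a" "kabs (Dif a) = \<d> a" "kabs (Plus s t) = kabs s + kabs t"
  "kabs (Times s t) = kabs s * kabs t" "kabs (Scale c t) = c *\<^sub>C kabs t" "kabs (Delta t) = \<delta> (kabs t)"
  "kabs (tsign k t) = ksign k (kabs t)"
  by (simp_all add: inc.abs_eq kd.abs_eq plus_kaehler.abs_eq times_kaehler.abs_eq
      scaleC_kaehler.abs_eq dlt_kaehler.abs_eq tsign_def ksign_kaehler)

lemma kabs_eq_iff: "kabs s = kabs t \<longleftrightarrow> s \<approx> t"
  by (simp add: kaehler.abs_eq_iff)

lemma hmg_kaehler_iff: "x \<in> hmg n \<longleftrightarrow> (\<exists>t. khom t n \<and> x = kabs t)"
  by (auto simp: hmg_kaehler_def)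

lemma inc_kaehler:
  fixes a b :: "'a::cdga"
  shows "inc (a + b) = inc a + inc b" "inc (c *\<^sub>C a) = c *\<^sub>C inc a" "inc (a * b) = inc a * inc b"
    "inc (\<delta> a) = \<delta> (inc a)" "inc (0::'a) = 0" "inc (1::'a) = 1"
  by (transfer; rule keq_axioms)+

lemma kd_kaehler:
  fixes a b :: "'a::cdga"
  shows "\<d> (a + b) = \<d> a + \<d> b" "\<d> (c *\<^sub>C a) = c *\<^sub>C \<d> a"
    "a \<in> hmg m \<Longrightarrow> \<d> (a * b) = \<d> a * inc b + ksign m (inc a * \<d> b)"
    "\<delta> (\<d> a) = - \<d> (\<delta> a)"
  subgoal by transfer (rule keq_axioms)
  subgoal by transfer (rule keq_axioms)
  subgoal unfolding kabs_simps[symmetric] kabs_eq_iff by (rule keq_axioms)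
  subgoal by transfer (rule keq_axioms)
  done

lemma graded_commute_kaehler:
  "\<lbrakk>khom s m; khom t n\<rbrakk> \<Longrightarrow> kabs s * kabs t = ksign (m * n) (kabs t * kabs s)"
  unfolding kabs_simps[symmetric] kabs_eq_iff by (rule keq_axioms)

lemma dlt_mult_kaehler:
  "khom s m \<Longrightarrow> \<delta> (kabs s * kabs t) = \<delta> (kabs s) * kabs t + ksign m (kabs s * \<delta> (kabs t))"
  unfolding kabs_simps[symmetric] kabs_eq_iff by (rule keq_axioms)

lemma kdilate_keq: "s \<approx> t \<Longrightarrow> kabs (kdilate s) = kabs (kdilate t)"
proof (induction rule: keq.induct)
  case (Times_comm s m t n)
  then show ?case
    using graded_commute_kaehler[OF khom_kdilate khom_kdilate, of s m t n]
    by (simp add: kabs_simps tsign_def ksign_kaehler)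
next
  case (Delta_Times s m t)
  then show ?case
    using dlt_mult_kaehler[OF khom_kdilate, of s m "kdilate t"]
    by (simp add: kabs_simps tsign_def ksign_kaehler kaehler_rules mult.commute)
next
  case (Dif_mult a m b)
  then show ?case
    using kd_kaehler(3)[OF dilate_hmg, of a m "dilate b"]
    by (simp add: kabs_simps tsign_def ksign_kaehler kaehler_rules dilate_mult mult.commute)
next
  case (Dif_dlt a)
  have "(-1) *\<^sub>C x = - x" for x :: "'a kaehler" by transfer (rule keq.refl)
  then show ?case
    by (simp add: kabs_simps kaehler_rules dilate_dlt kd_kaehler)
next
  case (Plus_inverse t)
  have "(-1) *\<^sub>C x = - x" for x :: "'a kaehler" by transfer (rule keq.refl)
  then show ?case
    using dilate_homogeneous[OF hmg_zero, of 0, where 'a = 'a] by (simp add: kabs_simps inc_kaehler)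
qed (simp_all add: kabs_simps kaehler_rules inc_kaehler kd_kaehler dilate_add dilate_scaleC
      dilate_mult dilate_dlt dilate_homogeneous[OF hmg_zero, of 0, simplified]
      dilate_homogeneous[OF hmg_one, simplified] scaleC_one scaleC_kaehler_zero mult.commute distrib_left distrib_right mult.assoc add.assoc add.commute add.left_commute)

lift_definition kdil :: "'a::cdga kaehler \<Rightarrow> 'a kaehler" is kdilate
  by (drule kdilate_keq) (simp only: kabs_eq_iff)

lemma kdil_linear: "kdil (x + y) = kdil x + kdil y" "kdil (c *\<^sub>C x) = c *\<^sub>C kdil x"
  by (transfer; simp add: keq.refl)+

lemma kdil_homogeneous:
  assumes "x \<in> hmg n" shows "kdil x = (2 powi n) *\<^sub>C x"
proof -
  have "kabs (kdilate t) = (2 powi n) *\<^sub>C kabs t" if "khom t n" for t :: "'a kterm" and n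
    using that
    by (induction rule: khom.induct)
      (simp_all add: kabs_simps dilate_homogeneous inc_kaehler kd_kaehler kaehler_rules
        power_int_add power_int_diff mult.commute)
  then show ?thesis
    using assms by (auto simp: hmg_kaehler_iff kdil.abs_eq)
qed

lemma hmg_kaehler_closed:
  fixes x y :: "'a::cdga kaehler" and a :: 'a
  shows "0 \<in> (hmg n :: 'a kaehler set)" and "x \<in> hmg n \<Longrightarrow> y \<in> hmg n \<Longrightarrow> x + y \<in> hmg n"
    and "x \<in> hmg n \<Longrightarrow> c *\<^sub>C x \<in> hmg n" and "x \<in> hmg n \<Longrightarrow> \<delta> x \<in> hmg (n - 1)"
    and "1 \<in> (hmg 0 :: 'a kaehler set)" and "x \<in> hmg m \<Longrightarrow> y \<in> hmg n \<Longrightarrow> x * y \<in> hmg (m + n)"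
    and "a \<in> hmg n \<Longrightarrow> inc a \<in> hmg n" and "a \<in> hmg n \<Longrightarrow> \<d> a \<in> hmg (n + 1)"
proof -
  show "0 \<in> (hmg n :: 'a kaehler set)" "1 \<in> (hmg 0 :: 'a kaehler set)"
    unfolding zero_kaehler_def one_kaehler_def hmg_kaehler_def
    by (auto intro!: imageI khom.intros hmg_zero hmg_one)
  have k: "khom t n \<Longrightarrow> kabs t \<in> hmg n" for t :: "'a kterm" and n
    by (auto simp: hmg_kaehler_def)
  note k' = khom.intros[THEN k, unfolded kabs_simps]
  show "a \<in> hmg n \<Longrightarrow> inc a \<in> hmg n" "a \<in> hmg n \<Longrightarrow> \<d> a \<in> hmg (n + 1)"
    "x \<in> hmg n \<Longrightarrow> y \<in> hmg n \<Longrightarrow> x + y \<in> hmg n" "x \<in> hmg n \<Longrightarrow> c *\<^sub>C x \<in> hmg n"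
    "x \<in> hmg n \<Longrightarrow> \<delta> x \<in> hmg (n - 1)" "x \<in> hmg m \<Longrightarrow> y \<in> hmg n \<Longrightarrow> x * y \<in> hmg (m + n)"
    by (auto simp: hmg_kaehler_iff[of x] hmg_kaehler_iff[of y] intro: k')
qed

lemma kaehler_independent:
  fixes g :: "int \<Rightarrow> 'a::cdga kaehler"
  assumes "finite F" "\<And>n. n \<in> F \<Longrightarrow> g n \<in> hmg n" "(\<Sum>n\<in>F. g n) = 0" "n \<in> F"
  shows "g n = 0"
  using assms
proof (induction F arbitrary: g n rule: finite_induct)
  case (insert m F)
  interpret kaehler_vector: vector_space "scaleC :: complex \<Rightarrow> 'a kaehler \<Rightarrow> 'a kaehler"
    by (rule kaehler_vector_space)
  have z: "kdil 0 = (0 :: 'a kaehler)"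
    using kdil_linear(2)[of 0 0] by (simp add: scaleC_kaehler_zero)
  have s: "kdil (\<Sum>n\<in>G. g n) = (\<Sum>n\<in>G. (2 powi n) *\<^sub>C g n)" if "finite G" "G \<subseteq> insert m F" for G
    using that by induction (simp_all add: z kdil_linear kdil_homogeneous insert.prems(1))
  have "(\<Sum>n\<in>F. (2 powi n - 2 powi m) *\<^sub>C g n) =
      (\<Sum>n\<in>insert m F. (2 powi n) *\<^sub>C g n) - (2 powi m) *\<^sub>C (\<Sum>n\<in>insert m F. g n)"
    using insert.hyps
    by (simp add: kaehler_vector.scale_left_diff_distrib sum_subtractf
        kaehler_vector.scale_sum_right kaehler_vector.scale_right_distrib)
  also have "\<dots> = 0"
    using s[of "insert m F"] insert.hyps insert.prems(2) z by simp
  finally have "(2 powi n - 2 powi m :: complex) *\<^sub>C g n = 0" if "n \<in> F" for n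
    using insert.IH[of "\<lambda>n. (2 powi n - 2 powi m) *\<^sub>C g n" n] that insert.prems(1)
    by (simp add: hmg_kaehler_closed)
  note e = this
  have p: "(2 powi n :: complex) \<noteq> 2 powi m" if "n \<noteq> m" for n m :: int
  proof
    assume "(2 powi n :: complex) = 2 powi m"
    then have "norm (2 powi n :: complex) = norm (2 powi m :: complex)" by simp
    then have "(2::real) powi n = 2 powi m" by (simp add: norm_power_int)
    with that show False
      using power_int_strict_increasing[of n m "2::real"] power_int_strict_increasing[of m n "2::real"]
      by (cases n m rule: linorder_cases) auto
  qed
  have g: "g n = 0" if "n \<in> F" for n
  proof -
    have "n \<noteq> m" using that insert.hyps(2) by blast
    with e[OF that] p[of n m] show ?thesis
      by (simp add: kaehler_vector.scale_eq_0_iff)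
  qed
  with insert.prems insert.hyps show ?case by auto
qed simp

definition hdec :: "'a::cdga kaehler \<Rightarrow> bool" where
  "hdec x \<longleftrightarrow> (\<exists>F g. finite F \<and> (\<forall>n\<in>F. g n \<in> hmg n) \<and> x = (\<Sum>n\<in>(F::int set). g n))"

lemma hdec_hmg: "x \<in> hmg n \<Longrightarrow> hdec x"
  unfolding hdec_def by (rule exI[of _ "{n}"], rule exI[of _ "\<lambda>_. x"]) simp

lemma hdec_add:
  assumes "hdec x" "hdec y" shows "hdec (x + y)"
proof -
  from assms obtain F g G h where
    *: "finite F" "\<forall>n\<in>F. g n \<in> hmg n" "x = (\<Sum>n\<in>(F::int set). g n)"
      "finite G" "\<forall>n\<in>G. h n \<in> hmg n" "y = (\<Sum>n\<in>(G::int set). h n)"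
    unfolding hdec_def by blast
  let ?g = "\<lambda>n. if n \<in> F then g n else 0" and ?h = "\<lambda>n. if n \<in> G then h n else 0"
  have "x = (\<Sum>n\<in>F \<union> G. ?g n)" "y = (\<Sum>n\<in>F \<union> G. ?h n)"
    unfolding * using *(1,4) by (auto intro!: sum.mono_neutral_cong_left)
  then have "x + y = (\<Sum>n\<in>F \<union> G. ?g n + ?h n)"
    by (simp only: sum.distrib)
  moreover have "?g n + ?h n \<in> hmg n" for n
    using *(2,5) by (auto intro!: hmg_kaehler_closed)
  ultimately show ?thesis
    unfolding hdec_def using *(1,4) by (intro exI[of _ "F \<union> G"] exI[of _ "\<lambda>n. ?g n + ?h n"]) auto
qed

lemma hdec_sum: "finite F \<Longrightarrow> (\<And>i. i \<in> F \<Longrightarrow> hdec (f i)) \<Longrightarrow> hdec (\<Sum>i\<in>F. f i)"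
  by (induction rule: finite_induct) (auto intro: hdec_add hdec_hmg[OF hmg_kaehler_closed(1)])

lemma hdec_additive:
  assumes "hdec x" "\<And>x y. f (x + y) = f x + f y" "f 0 = 0" "\<And>n x. x \<in> hmg n \<Longrightarrow> hdec (f x)"
  shows "hdec (f x)"
proof -
  from assms(1) obtain F g where *: "finite F" "\<forall>n\<in>F. g n \<in> hmg n" "x = (\<Sum>n\<in>(F::int set). g n)"
    unfolding hdec_def by blast
  have "f (\<Sum>n\<in>F. g n) = (\<Sum>n\<in>F. f (g n))"
    using *(1) by induction (simp_all add: assms)
  with * show ?thesis by (auto intro!: hdec_sum intro: assms(4))
qed

lemma kd_zero [simp]: "\<d> 0 = 0"
  using kd_kaehler(1)[of 0 0] by simp

lemma kabs_hdec: "hdec (kabs t)"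
proof (induction t)
  case (Inc a)
  have "hdec (inc a)"
  proof (induction a rule: hmg_induct)
    case (homogeneous n x)
    then show ?case by (rule hdec_hmg[OF hmg_kaehler_closed(7)])
  qed (simp add: inc_kaehler hdec_add)
  then show ?case by (simp add: kabs_simps)
next
  case (Dif a)
  have "hdec (\<d> a)"
  proof (induction a rule: hmg_induct)
    case (homogeneous n x)
    then show ?case by (rule hdec_hmg[OF hmg_kaehler_closed(8)])
  qed (simp add: kd_kaehler hdec_add)
  then show ?case by (simp add: kabs_simps)
next
  case (Plus s t)
  then show ?case by (simp add: kabs_simps hdec_add)
next
  case (Times s t)
  have *: "hdec (x * kabs t)" if "x \<in> hmg m" for x m
    by (rule hdec_additive[OF Times(2), of "\<lambda>y. x * y"])
      (auto simp: distrib_left intro: hdec_hmg[OF hmg_kaehler_closed(6)[OF that]])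
  show ?case
    unfolding kabs_simps
    by (rule hdec_additive[OF Times(1), of "\<lambda>x. x * kabs t"]) (auto simp: distrib_right intro: *)
next
  case (Scale c t)
  show ?case
    unfolding kabs_simps
    by (rule hdec_additive[OF Scale, of "scaleC c"])
      (auto simp: kaehler_rules scaleC_kaehler_zero intro: hdec_hmg[OF hmg_kaehler_closed(3)])
next
  case (Delta t)
  have z: "\<delta> 0 = (0 :: 'a kaehler)"
    using kaehler_rules(7)[of "0 :: 'a kaehler" 0] by simp
  show ?case
    unfolding kabs_simps
    by (rule hdec_additive[OF Delta, of dlt])
      (auto simp: z kaehler_rules intro: hdec_hmg[OF hmg_kaehler_closed(4)])
qed

instance kaehler :: (cdga) cdga
proof
  interpret kaehler_vector: vector_space "scaleC :: complex \<Rightarrow> 'a kaehler \<Rightarrow> 'a kaehler"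
    by (rule kaehler_vector_space)
  fix x y :: "'a kaehler" and m n :: int
  show "x \<in> hmg m \<Longrightarrow> y \<in> hmg n \<Longrightarrow> x * y = ksign (m * n) (y * x)"
    by (auto simp: hmg_kaehler_iff intro: graded_commute_kaehler)
  show "x \<in> hmg m \<Longrightarrow> \<delta> (x * y) = \<delta> x * y + ksign m (x * \<delta> y)"
    by (induction y rule: kaehler.abs_induct) (auto simp: hmg_kaehler_iff intro: dlt_mult_kaehler)
  show "\<exists>!f. (\<forall>n. f n \<in> hmg n) \<and> finite {n. f n \<noteq> 0} \<and> x = (\<Sum>n | f n \<noteq> 0. f n)"
  proof (rule ex_ex1I)
    have "hdec x" by (induction x rule: kaehler.abs_induct) (rule kabs_hdec)
    then obtain F g where *: "finite F" "\<forall>n\<in>F. g n \<in> hmg n" "x = (\<Sum>n\<in>(F::int set). g n)"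
      unfolding hdec_def by blast
    let ?f = "\<lambda>n. if n \<in> F then g n else 0"
    have "x = (\<Sum>n | ?f n \<noteq> 0. ?f n)"
      unfolding *(3) using *(1) by (intro sum.mono_neutral_cong_right) (auto split: if_splits)
    moreover have "finite {n. ?f n \<noteq> 0}" using *(1) by (auto intro: rev_finite_subset)
    ultimately show "\<exists>f. (\<forall>n. f n \<in> hmg n) \<and> finite {n. f n \<noteq> 0} \<and> x = (\<Sum>n | f n \<noteq> 0. f n)"
      using *(2) hmg_kaehler_closed(1) by (intro exI[of _ ?f]) auto
  next
    fix f g :: "int \<Rightarrow> 'a kaehler"
    assume f: "(\<forall>n. f n \<in> hmg n) \<and> finite {n. f n \<noteq> 0} \<and> x = (\<Sum>n | f n \<noteq> 0. f n)"
      and g: "(\<forall>n. g n \<in> hmg n) \<and> finite {n. g n \<noteq> 0} \<and> x = (\<Sum>n | g n \<noteq> 0. g n)"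
    let ?F = "{n. f n \<noteq> 0} \<union> {n. g n \<noteq> 0}"
    have F: "finite ?F" using f g by simp
    have "(\<Sum>n | f n \<noteq> 0. f n) = (\<Sum>n\<in>?F. f n)" "(\<Sum>n | g n \<noteq> 0. g n) = (\<Sum>n\<in>?F. g n)"
      using F by (auto intro!: sum.mono_neutral_left)
    with f g have "x = (\<Sum>n\<in>?F. f n)" "x = (\<Sum>n\<in>?F. g n)"
      by simp_all
    then have "(\<Sum>n\<in>?F. f n - g n) = 0"
      unfolding sum_subtractf by simp
    moreover have "f n - g n \<in> hmg n" for n
      using f g hmg_kaehler_closed(2)[of "f n" n "(-1) *\<^sub>C g n"] hmg_kaehler_closed(3)[of "g n" n "-1"]
      by simp
    ultimately have "f n - g n = 0" if "n \<in> ?F" for n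
      using kaehler_independent[OF F, of "\<lambda>n. f n - g n" n] that by blast
    then have "f n = g n" for n by (cases "n \<in> ?F") auto
    then show "f = g" by blast
  qed
qed (simp_all add: kaehler_rules hmg_kaehler_closed)

section \<open>Multivectors and the Schouten--Nijenhuis bracket\<close>

definition forms :: "nat \<Rightarrow> 'a::cdga kaehler set"  ("\<Omega>") where
  "\<Omega> s = complex_vector.span {inc f * prod_list (map \<d> fs) | f fs. length fs = s}"

text \<open>Only the values on \<open>\<Omega> s\<close> are constrained; they are the only ones used below. The sign in the
  linearity condition is \<open>(-1)\<close> to the power \<open>\<bar>P\<bar> \<bar>f\<bar>\<close> with \<open>\<bar>P\<bar> = - m\<close>.\<close>

definition multivectors :: "nat \<Rightarrow> int \<Rightarrow> ('a::cdga kaehler \<Rightarrow> 'a) set" where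
  "multivectors s m = {P.
     (\<forall>x\<in>\<Omega> s. \<forall>y\<in>\<Omega> s. P (x + y) = P x + P y) \<and>
     (\<forall>n. \<forall>x\<in>\<Omega> s \<inter> hmg n. P x \<in> hmg (n - m)) \<and>
     (\<forall>k. \<forall>f\<in>hmg k. \<forall>x\<in>\<Omega> s. P (inc f * x) = ksign (- m * k) (f * P x))}"

definition mv_dlt :: "int \<Rightarrow> ('a::cdga kaehler \<Rightarrow> 'a) \<Rightarrow> 'a kaehler \<Rightarrow> 'a" where
  "mv_dlt m P x = \<delta> (P x) - ksign m (P (\<delta> x))"

text \<open>Exponent of the Koszul sign for rearranging a word whose letters have degrees \<open>ds\<close> into the
  word whose \<open>a\<close>-th letter is the \<open>\<sigma> ! a\<close>-th letter of the original one.\<close>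

definition koszul :: "int list \<Rightarrow> nat list \<Rightarrow> int" where
  "koszul ds \<sigma> = (\<Sum>(a, b) | a < b \<and> b < length \<sigma> \<and> \<sigma> ! b < \<sigma> ! a. ds ! (\<sigma> ! a) * ds ! (\<sigma> ! b))"

text \<open>\<open>circ t m n P Q fs ks\<close> is \<open>(P \<circ> Q)(df\<^sub>1, \<dots>, df\<^sub>N)\<close> for \<open>P\<close> of degree \<open>-m\<close>, and \<open>Q\<close> of
  degree \<open>-n\<close> with \<open>t\<close> arguments, where \<open>fs\<close> lists homogeneous elements of degrees \<open>ks\<close>. The
  original word is \<open>P, d, Q, df\<^sub>1, \<dots>, df\<^sub>N\<close>, so the differentials start at position 3.\<close>

definition circ ::
    "nat \<Rightarrow> int \<Rightarrow> int \<Rightarrow> ('a::cdga kaehler \<Rightarrow> 'a) \<Rightarrow> ('a kaehler \<Rightarrow> 'a) \<Rightarrow> 'a list \<Rightarrow> int list \<Rightarrow> 'a" where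
  "circ t m n P Q fs ks =
     (\<Sum>J | J \<subseteq> {..<length fs} \<and> card J = t.
        let is = sorted_list_of_set ({..<length fs} - J);
            js = sorted_list_of_set J;
            sgn_exp = koszul ([- m, 1, - n] @ map (\<lambda>k. k + 1) ks)
                             ([0] @ map (\<lambda>i. i + 3) is @ [1, 2] @ map (\<lambda>j. j + 3) js)
        in ksign sgn_exp
             (P (prod_list (map (\<lambda>i. \<d> (fs ! i)) is) * \<d> (Q (prod_list (map (\<lambda>j. \<d> (fs ! j)) js))))))"

text \<open>The value of \<open>[P, Q]\<close> on \<open>df\<^sub>1, \<dots>, df\<^sub>N\<close>, for \<open>P\<close> with \<open>s\<close> and \<open>Q\<close> with \<open>t\<close> arguments and
  \<open>N = s + t - 1\<close>. These values determine \<open>[P, Q]\<close>, as the products \<open>df\<^sub>1 \<cdots> df\<^sub>N\<close> with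
  homogeneous \<open>f\<^sub>i\<close> generate \<open>\<Omega> N\<close> over the algebra.\<close>

definition schouten ::
    "nat \<Rightarrow> nat \<Rightarrow> int \<Rightarrow> int \<Rightarrow> ('a::cdga kaehler \<Rightarrow> 'a) \<Rightarrow> ('a kaehler \<Rightarrow> 'a) \<Rightarrow> 'a list \<Rightarrow> int list \<Rightarrow> 'a" where
  "schouten s t m n P Q fs ks = circ t m n P Q fs ks - ksign ((m - 1) * (n - 1)) (circ s n m Q P fs ks)"

definition homotopy_poisson :: "(nat \<Rightarrow> 'a::cdga kaehler \<Rightarrow> 'a) \<Rightarrow> bool" where
  "homotopy_poisson \<pi> \<longleftrightarrow>
     (\<forall>s\<ge>2. \<pi> s \<in> multivectors s 2) \<and>
     (\<forall>s\<ge>2. \<forall>fs ks. length fs = s \<and> list_all2 (\<lambda>f k. f \<in> hmg k) fs ks \<longrightarrow>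
        mv_dlt 2 (\<pi> s) (prod_list (map \<d> fs)) +
        (1 / 2) *\<^sub>C (\<Sum>(p, q) | 2 \<le> p \<and> 2 \<le> q \<and> p + q = s + 1. schouten p q 2 2 (\<pi> p) (\<pi> q) fs ks) = 0)"

end

theory Submission
  imports Defs "HOL-Library.Function_Algebras" "HOL-Library.Multiset"
begin

text \<open>
  Forms of a polynomial dg-algebra are free over it, so a multivector amounts to an arbitrary graded
  symmetric family of values on the generators. Adding the vector field \<open>\<delta>\<close> as unary part to
  \<open>\<pi> = \<pi>\<^sub>2 + \<pi>\<^sub>3 + \<cdots>\<close>, the Maurer--Cartan equation becomes \<open>C = \<pi> \<circ> \<pi> = 0\<close> for the pre-Lie product
  \<open>\<circ>\<close> of odd cochains, and symmetry of the associator gives the Bianchi identity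
  \<open>C \<circ> \<pi> = \<pi> \<circ> C\<close>. The values of \<open>\<pi>\<close> are chosen by induction on the number of arguments and then on
  their total degree. If \<open>C\<close> vanishes on all smaller arguments, the Bianchi identity reduces to
  \<open>\<delta>(C(x)) = 0\<close> on the next tuple \<open>x\<close> of generators, so \<open>C(x)\<close> is a boundary as soon as
  \<open>\<epsilon>(C(x)) = 0\<close>, and subtracting a primitive from \<open>\<pi>(x)\<close> makes it vanish. The condition
  on \<open>\<epsilon>\<close> is not void only when \<open>C(x)\<close> has degree \<open>0\<close>, i.e. when \<open>x\<close> has total degree \<open>3\<close> and hence
  at most three entries; for three entries it is the Jacobi identity of the given bracket.
\<close>

section \<open>Signs and parity\<close>

text \<open>Kaehler forms are a quotient of formal terms without normal forms, so a functional with
  prescribed values on generators cannot be defined by recursion on forms. Instead every term acts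
  on families of coefficients indexed by lists of generators, and each relation of the quotient is
  checked for this action on graded symmetric families; evaluation at the empty list gives the
  functional. Functionals are kept right-linear, because scalars on the right pass nothing and cause
  no signs. One family carries all arities at once. The recurring constant -1 is the degree of d
  composed with a multivector of degree -2. Testing C on tuples of generators suffices because C is
  half of a bracket, which is a derivation in its arguments, whereas a single composition in general
  is not. For a fixed number of arguments the total degree of generators is bounded, so finitely
  many corrections are made there; the number of arguments is unbounded, so the solution is a limit
  of families in which each list is eventually left alone. Corrections have positive degree and are
  invisible to \<epsilon>.\<close>

lemma ksign_cong: "even k = even l \<Longrightarrow> x = y \<Longrightarrow> ksign k x = ksign l y"
  by (simp add: ksign_def)

lemma ksign_ksign [simp]: "ksign k (ksign l x) = ksign (k + l) (x :: 'a::group_add)"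
  by (simp add: ksign_def)

lemma ksign_even: "even k \<Longrightarrow> ksign k x = x" and ksign_odd: "odd k \<Longrightarrow> ksign k x = - x"
  by (simp_all add: ksign_def)

lemma ksign_zero_left [simp]: "ksign 0 x = x"
  by (simp add: ksign_def)

lemma ksign_add: "ksign k (x + y) = ksign k x + ksign k (y :: 'a::ab_group_add)"
  by (simp add: ksign_def)

lemma ksign_diff: "ksign k (x - y) = ksign k x - ksign k (y :: 'a::ab_group_add)"
  by (simp add: ksign_def)

lemma ksign_minus: "ksign k (- x) = - ksign k (x :: 'a::ab_group_add)"
  by (simp add: ksign_def)

lemma ksign_sum: "ksign k (\<Sum>i\<in>I. f i) = (\<Sum>i\<in>I. ksign k (f i :: 'a::ab_group_add))"
  by (simp add: ksign_def sum_negf)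

lemma ksign_mult [simp]:
  "ksign k x * y = ksign k (x * y)" "x * ksign k y = ksign k (x * (y :: 'a::ring))"
  by (simp_all add: ksign_def)

lemma ksign_eq_0_iff [simp]: "ksign k x = 0 \<longleftrightarrow> x = (0 :: 'a::ab_group_add)"
  by (simp add: ksign_def)

lemma dlt_zero [simp]: "\<delta> (0 :: 'a::dg_module) = 0"
  using dlt_add[of "0::'a" 0] by simp

lemma dlt_minus: "\<delta> (- x) = - \<delta> (x :: 'a::dg_module)"
  using dlt_scaleC[of "-1" x] by simp

lemma ksign_dlt [simp]: "\<delta> (ksign k x) = ksign k (\<delta> (x :: 'a::dg_module))"
  by (simp add: ksign_def dlt_minus)

lemma ksign_scaleC [simp]: "c *\<^sub>C ksign k x = ksign k (c *\<^sub>C (x :: 'a::dg_module))"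
  by (simp add: ksign_def)

lemma hmg_minus: "x \<in> hmg n \<Longrightarrow> - x \<in> hmg n" for x :: "'a::dg_module"
  using hmg_scaleC[of x n "-1"] by simp

lemma hmg_ksign: "x \<in> hmg n \<Longrightarrow> ksign k x \<in> hmg n" for x :: "'a::dg_module"
  by (simp add: ksign_def hmg_minus)

lemma hmg_sum: "(\<And>i. i \<in> I \<Longrightarrow> f i \<in> hmg n) \<Longrightarrow> (\<Sum>i\<in>I. f i) \<in> hmg n" for f :: "'b \<Rightarrow> 'a::dg_module"
  by (induction I rule: infinite_finite_induct) (auto intro: hmg_zero hmg_add)

lemma hmg_mult_eq: "\<lbrakk>x \<in> hmg m; y \<in> hmg n; k = m + n\<rbrakk> \<Longrightarrow> x * y \<in> hmg k" for x :: "'a::cdga"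
  by (simp add: hmg_mult)

lemma hcomp_zero [simp]: "hcomp (0 :: 'a::dg_module) = (\<lambda>_. 0)"
  using hcomp_homogeneous[OF hmg_zero, of 0, where 'a = 'a] by auto

section \<open>Koszul signs on inhomogeneous elements\<close>

definition par :: "'a::dg_module \<Rightarrow> 'a" where
  "par x = (\<Sum>n | hcomp x n \<noteq> 0. ksign n (hcomp x n))"

lemma par_sum:
  assumes "finite F" "{n. hcomp x n \<noteq> 0} \<subseteq> F"
  shows "par x = (\<Sum>n\<in>F. ksign n (hcomp x n))"
  unfolding par_def by (rule sum.mono_neutral_left) (use assms in auto)

lemma par_hmg: "x \<in> hmg n \<Longrightarrow> par x = ksign n x"
  by (subst par_sum[where F = "{n}"]) (auto simp: hcomp_homogeneous split: if_splits)

lemma par_zero [simp]: "par (0 :: 'a::dg_module) = 0"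
  by (simp add: par_def)

lemma par_one [simp]: "par (1 :: 'a::cdga) = 1"
  by (simp add: par_hmg[OF hmg_one])

lemma par_add: "par (x + y) = par x + par y"
proof -
  let ?F = "{n. hcomp x n \<noteq> 0} \<union> {n. hcomp y n \<noteq> 0}"
  have f: "finite ?F" by (simp add: hcomp(2))
  have s: "{n. hcomp (x + y) n \<noteq> 0} \<subseteq> ?F" by (auto simp: hcomp_add)
  show ?thesis
    unfolding par_sum[OF f s] par_sum[OF f Un_upper1] par_sum[OF f Un_upper2]
    by (simp add: hcomp_add ksign_add sum.distrib)
qed

lemma par_scaleC: "par (c *\<^sub>C x) = c *\<^sub>C par x"
proof (induction x rule: hmg_induct)
  case (homogeneous n x)
  then show ?case by (simp add: par_hmg[OF hmg_scaleC] par_hmg)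
qed (simp add: par_add scaleC_add_right)

lemma par_minus: "par (- x) = - par (x :: 'a::dg_module)"
  using par_scaleC[of "-1" x] by simp

lemma par_mult: "par (x * y) = par x * par (y :: 'a::cdga)"
proof (induction x rule: hmg_induct)
  case (homogeneous m x)
  then show ?case
  proof (induction y rule: hmg_induct)
    case (homogeneous n y)
    then show ?case by (simp add: par_hmg[OF hmg_mult] par_hmg add.commute)
  qed (simp add: par_add distrib_left)
qed (simp add: par_add distrib_right)

lemma par_dlt: "par (\<delta> x) = - \<delta> (par (x :: 'a::dg_module))"
proof (induction x rule: hmg_induct)
  case (homogeneous n x)
  then show ?case by (simp add: par_hmg[OF dlt_hmg] par_hmg) (simp add: ksign_def)
qed (simp add: par_add dlt_add)

lemma par_par [simp]: "par (par x) = (x :: 'a::dg_module)"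
proof (induction x rule: hmg_induct)
  case (homogeneous n x)
  then show ?case by (simp add: par_hmg[OF hmg_ksign] par_hmg) (simp add: ksign_even)
qed (simp add: par_add)

lemma par_in_hmg: "x \<in> hmg n \<Longrightarrow> par x \<in> hmg n"
  by (simp add: par_hmg hmg_ksign)

lemma par_ksign [simp]: "par (ksign k x) = ksign k (par x)"
  by (simp add: ksign_def par_minus)

lemma par_sum_distrib: "par (\<Sum>i\<in>I. f i) = (\<Sum>i\<in>I. par (f i))"
  by (induction I rule: infinite_finite_induct) (simp_all add: par_add)

text \<open>The sign caused by moving something of degree \<open>k\<close> past \<open>x\<close>,
  extended additively: commutation rules can then be stated without assuming \<open>x\<close>
  homogeneous.\<close>

definition tw :: "int \<Rightarrow> 'a::dg_module \<Rightarrow> 'a" where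
  "tw k x = (if even k then x else par x)"

lemma tw_hmg: "x \<in> hmg n \<Longrightarrow> tw k x = ksign (k * n) x"
  by (simp add: tw_def par_hmg ksign_def)

lemma tw_simps [simp]:
  "tw 0 x = x" "tw k 0 = (0 :: 'a::dg_module)" "tw k (1 :: 'b::cdga) = 1"
  by (simp_all add: tw_def)

lemma tw_add: "tw k (x + y) = tw k x + tw k y" and tw_scaleC: "tw k (c *\<^sub>C x) = c *\<^sub>C tw k x"
  by (simp_all add: tw_def par_add par_scaleC)

lemma tw_mult: "tw k (x * y) = tw k x * tw k (y :: 'a::cdga)"
  by (simp add: tw_def par_mult)

lemma tw_tw: "tw k (tw l x) = tw (k + l) x"
  by (simp add: tw_def)

lemma tw_cong: "even k = even l \<Longrightarrow> tw k x = tw l x"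
  by (simp add: tw_def)

lemma tw_par: "tw k (par x) = tw (k + 1) x" and par_tw: "par (tw k x) = tw (k + 1) x"
  by (simp_all add: tw_def)

lemma tw_ksign [simp]: "tw k (ksign l x) = ksign l (tw k x)"
  by (simp add: tw_def)

lemma tw_dlt: "tw k (\<delta> x) = ksign k (\<delta> (tw k x))"
  by (simp add: tw_def ksign_def par_dlt)

lemma tw_in_hmg: "x \<in> hmg n \<Longrightarrow> tw k x \<in> hmg n"
  by (simp add: tw_def par_in_hmg)

lemma commute_tw: "x \<in> hmg n \<Longrightarrow> y * x = x * tw n (y :: 'a::cdga)"
proof (induction y rule: hmg_induct)
  case (homogeneous m y)
  then show ?case by (simp add: graded_commute[of y m x n] tw_hmg mult.commute)
qed (simp add: distrib_left distrib_right tw_add)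

lemma dlt_mult_par: "\<delta> (x * y) = \<delta> x * y + par x * \<delta> (y :: 'a::cdga)"
proof (induction x rule: hmg_induct)
  case (homogeneous m x)
  then show ?case by (simp add: dlt_mult par_hmg)
qed (simp add: distrib_right dlt_add par_add)

lemma dlt_one [simp]: "\<delta> (1 :: 'a::cdga) = 0"
  using dlt_mult[OF hmg_one, of "1::'a"] by simp

section \<open>Partial derivatives on a polynomial dg-algebra\<close>

global_interpretation complex_pair:
  vector_space_pair "scaleC :: complex \<Rightarrow> 'a::dg_module \<Rightarrow> 'a" "scaleC :: complex \<Rightarrow> 'b::dg_module \<Rightarrow> 'b"
  by unfold_locales

locale polynomial =
  fixes r :: nat and u :: "nat \<Rightarrow> 'a::cdga" and e :: "nat \<Rightarrow> int"
  assumes pc: "polynomial_cdga r u e"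
    and e_nonneg: "\<And>i. i < r \<Longrightarrow> 0 \<le> e i"
begin

abbreviation "mon \<equiv> monomial r u"
abbreviation "expo \<equiv> exponents r e"

definition mdeg :: "(nat \<Rightarrow> nat) \<Rightarrow> int" where
  "mdeg a = (\<Sum>i<r. int (a i) * e i)"

lemma u_hmg: "i < r \<Longrightarrow> u i \<in> hmg (e i)"
  using pc by (simp add: polynomial_cdga_def)

lemma inj_mono: "inj_on mon expo"
  and indep_mono: "complex_vector.independent (mon ` expo)"
  and span_mono: "complex_vector.span (mon ` expo) = UNIV"
  using pc by (simp_all add: polynomial_cdga_def)

lemma power_hmg: "x \<in> hmg n \<Longrightarrow> x ^ k \<in> hmg (int k * n)" for x :: "'c::cdga"
  by (induction k) (auto simp: hmg_one algebra_simps intro: hmg_mult)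

lemma prod_hmg: "k \<le> r \<Longrightarrow> prod_list (map (\<lambda>i. u i ^ a i) [0..<k]) \<in> hmg (\<Sum>i<k. int (a i) * e i)"
  by (induction k) (auto simp: hmg_one intro!: hmg_mult power_hmg u_hmg)

lemma mono_hmg: "mon a \<in> hmg (mdeg a)"
  using prod_hmg[of r a] by (simp add: monomial_def mdeg_def)

lemma u_mult_mono:
  assumes "j < r"
  shows "u j * mon a = ksign (e j * (\<Sum>l<j. int (a l) * e l)) (mon (a(j := Suc (a j))))"
proof -
  have r: "[0..<r] = [0..<j] @ j # [Suc j..<r]"
    using assms upt_add_eq_append[of 0 j "r - j"] upt_conv_Cons[OF assms] by simp
  define X where "X = prod_list (map (\<lambda>i. u i ^ a i) [0..<j])"
  define Y where "Y = prod_list (map (\<lambda>i. u i ^ a i) [Suc j..<r])"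
  have X: "X \<in> hmg (\<Sum>l<j. int (a l) * e l)"
    unfolding X_def using assms by (intro prod_hmg) simp
  have 1: "mon a = X * (u j ^ a j * Y)"
    unfolding monomial_def r X_def Y_def by (simp add: mult.assoc)
  have 2: "mon (a(j := Suc (a j))) = X * (u j * u j ^ a j * Y)"
  proof -
    have "map (\<lambda>i. u i ^ (a(j := Suc (a j))) i) [0..<j] = map (\<lambda>i. u i ^ a i) [0..<j]"
      "map (\<lambda>i. u i ^ (a(j := Suc (a j))) i) [Suc j..<r] = map (\<lambda>i. u i ^ a i) [Suc j..<r]"
      by auto
    then show ?thesis
      unfolding monomial_def r X_def Y_def by (simp only: map_append prod_list.append list.map prod_list.Cons) (simp add: mult.assoc)
  qed
  have "u j * mon a = (u j * X) * (u j ^ a j * Y)"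
    unfolding 1 by (simp add: mult.assoc)
  also have "\<dots> = ksign (e j * (\<Sum>l<j. int (a l) * e l)) (X * u j * (u j ^ a j * Y))"
    by (simp add: graded_commute[OF u_hmg[OF assms] X])
  finally show ?thesis unfolding 2 by (simp add: mult.assoc)
qed

lemma odd_square: "x \<in> hmg n \<Longrightarrow> odd n \<Longrightarrow> x * x = 0" for x :: "'c::cdga"
proof -
  assume "x \<in> hmg n" "odd n"
  then have "x * x = - (x * x)"
    using graded_commute[of x n x n] by (simp add: ksign_def)
  then have "x * x + x * x = 0"
    by (metis add.left_inverse)
  then have "2 *\<^sub>C (x * x) = 0"
    using scaleC_add_left[of 1 1 "x * x"] by (simp add: scaleC_one)
  then show ?thesis
    using complex_vector.scale_eq_0_iff[of 2 "x * x"]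
    by (metis zero_neq_numeral)
qed

text \<open>Up to sign the monomial is \<open>u j\<close> times the monomial without
  \<open>u j\<close>, and an odd element squares to 0.\<close>

lemma u_mult_mono_zero:
  assumes "j < r" "odd (e j)" "a j = 1"
  shows "u j * mon a = 0"
proof -
  let ?b = "a(j := 0)"
  have "u j * mon ?b = ksign (e j * (\<Sum>l<j. int (?b l) * e l)) (mon a)"
    using u_mult_mono[OF assms(1), of ?b] assms(3) by simp (metis fun_upd_triv One_nat_def)
  then have "u j * ksign (e j * (\<Sum>l<j. int (?b l) * e l)) (mon a) = (u j * u j) * mon ?b"
    by (metis mult.assoc)
  also have "\<dots> = 0" using odd_square[OF u_hmg assms(2)] assms(1) by simp
  finally show ?thesis by simp
qed

lemma mono_induct [consumes 0, case_names monomial add scale zero]: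
  assumes "\<And>a. a \<in> expo \<Longrightarrow> Q (mon a)" "\<And>x y. Q x \<Longrightarrow> Q y \<Longrightarrow> Q (x + y)"
    "\<And>c x. Q x \<Longrightarrow> Q (c *\<^sub>C x)" "Q 0"
  shows "Q x"
proof -
  have "x \<in> complex_vector.span (mon ` expo)" by (simp add: span_mono)
  then show ?thesis
    by (induction rule: complex_vector.span_induct_alt) (auto intro: assms)
qed

lemma hom_span: "f \<in> hmg k \<Longrightarrow> f \<in> complex_vector.span (mon ` {a \<in> expo. mdeg a = k})"
proof -
  have "\<forall>k. hcomp x k \<in> complex_vector.span (mon ` {a \<in> expo. mdeg a = k})" for x
  proof (induction x rule: mono_induct)
    case (monomial a)
    then show ?case
      by (auto simp: hcomp_homogeneous[OF mono_hmg] complex_vector.span_zero intro: complex_vector.span_base)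
  qed (auto simp: hcomp_add hcomp_scaleC complex_vector.span_zero
      intro: complex_vector.span_add complex_vector.span_scale)
  then show "f \<in> hmg k \<Longrightarrow> ?thesis"
    by (metis (mono_tags) hcomp_homogeneous)
qed

lemma mdeg_nonneg: "0 \<le> mdeg a"
  unfolding mdeg_def by (intro sum_nonneg) (simp add: e_nonneg)

lemma hmg_negative: "k < 0 \<Longrightarrow> hmg k = {0 :: 'a}"
proof -
  assume "k < 0"
  then have "{a \<in> expo. mdeg a = k} = {}" using mdeg_nonneg by (auto simp: not_less[symmetric])
  then have "complex_vector.span (mon ` {a \<in> expo. mdeg a = k}) = {0}"
    by (simp only: image_empty complex_vector.span_empty)
  then show ?thesis using hom_span[of _ k] hmg_zero[of k] by blast
qed

text \<open>The degree bounds offered in the cases \<open>gen\<close> and \<open>mult\<close>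
  matter: a homogeneous element is built from factors of nonnegative degree not exceeding its own,
  so in degree 0 only generators and factors of degree 0 occur, and bounds on the total degree of
  several arguments survive the reduction to generators.\<close>

lemma poly_induct [consumes 1, case_names zero add scale one gen mult]:
  assumes f: "f \<in> hmg k"
    and zero: "\<And>n. Q 0 n"
    and add: "\<And>a b n. \<lbrakk>a \<in> hmg n; b \<in> hmg n; Q a n; Q b n\<rbrakk> \<Longrightarrow> Q (a + b) n"
    and scale: "\<And>a c n. \<lbrakk>a \<in> hmg n; Q a n\<rbrakk> \<Longrightarrow> Q (c *\<^sub>C a) n"
    and one: "Q 1 0"
    and gen: "\<And>i. \<lbrakk>i < r; e i \<le> k\<rbrakk> \<Longrightarrow> Q (u i) (e i)"
    and mult: "\<And>a b m n. \<lbrakk>a \<in> hmg m; b \<in> hmg n; 0 \<le> m; 0 \<le> n; m + n \<le> k; Q a m; Q b n\<rbrakk> \<Longrightarrow> Q (a * b) (m + n)"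
  shows "Q f k"
proof -
  have pow: "int p * e i \<le> k \<Longrightarrow> Q (u i ^ p) (int p * e i)" if i: "i < r" for i p
  proof (induction p)
    case 0
    then show ?case using one by simp
  next
    case (Suc p)
    have "0 \<le> int p * e i" using e_nonneg[OF i] by simp
    moreover have *: "int (Suc p) * e i = e i + int p * e i" by (simp add: algebra_simps)
    ultimately show ?case
      using Suc mult[OF u_hmg[OF i] power_hmg[OF u_hmg[OF i], of p]] e_nonneg[OF i] gen[OF i]
      unfolding * by (smt (verit) power_Suc)
  qed
  have pr: "p \<le> r \<Longrightarrow> (\<Sum>i<p. int (a i) * e i) \<le> k \<Longrightarrow>
      Q (prod_list (map (\<lambda>i. u i ^ a i) [0..<p])) (\<Sum>i<p. int (a i) * e i)" for p a
  proof (induction p)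
    case 0
    then show ?case using one by simp
  next
    case (Suc p)
    have 1: "0 \<le> int (a p) * e p" "0 \<le> (\<Sum>i<p. int (a i) * e i)"
      using Suc.prems(1) by (auto intro!: sum_nonneg simp: e_nonneg)
    then have 2: "int (a p) * e p \<le> k" "(\<Sum>i<p. int (a i) * e i) \<le> k"
      using Suc.prems(2) by simp_all
    show ?case
      using mult[OF prod_hmg[of p a] power_hmg[OF u_hmg[of p], of "a p"]] 1 Suc.prems Suc.IH[OF _ 2(2)] pow[OF _ 2(1)]
      by simp
  qed
  have m: "Q (mon a) (mdeg a)" if "mdeg a = k" for a
    using pr[of r a] that by (simp add: monomial_def mdeg_def)
  have "f \<in> complex_vector.span (mon ` {a \<in> expo. mdeg a = k})"
    by (rule hom_span[OF f])
  then have "f \<in> hmg k \<and> Q f k"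
  proof (induction rule: complex_vector.span_induct_alt)
    case base
    then show ?case by (simp add: zero hmg_zero)
  next
    case (step c x y)
    then have "x \<in> hmg k" "Q x k" using m mono_hmg by auto
    then show ?case using step by (auto intro!: add scale hmg_add hmg_scaleC)
  qed
  then show ?thesis ..
qed

text \<open>The left partial derivative of an ordered monomial; the sign comes from moving the
  derivation past the generators in front of \<open>u i\<close>. For \<open>a i = 0\<close> the
  truncated exponent is harmless because the coefficient is 0.\<close>

definition pd_mono :: "nat \<Rightarrow> (nat \<Rightarrow> nat) \<Rightarrow> 'a" where
  "pd_mono i a = of_nat (a i) *\<^sub>C ksign (e i * (\<Sum>l<i. int (a l) * e l)) (mon (a(i := a i - 1)))"

definition pd :: "nat \<Rightarrow> 'a \<Rightarrow> 'a" where
  "pd i = complex_pair.construct (mon ` expo) (\<lambda>b. pd_mono i (the_inv_into expo mon b))"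

lemma pd_monomial: "a \<in> expo \<Longrightarrow> pd i (mon a) = pd_mono i a"
  unfolding pd_def
  by (subst complex_pair.construct_basis[OF indep_mono]) (auto simp: the_inv_into_f_f[OF inj_mono])

lemma pd_linear: "pd i (x + y) = pd i x + pd i y" "pd i (c *\<^sub>C x) = c *\<^sub>C pd i x" "pd i 0 = 0"
proof -
  have l: "Vector_Spaces.linear scaleC scaleC (pd i)"
    unfolding pd_def by (rule complex_pair.linear_construct[OF indep_mono])
  show "pd i (x + y) = pd i x + pd i y" "pd i (c *\<^sub>C x) = c *\<^sub>C pd i x" "pd i 0 = 0"
    using complex_pair.linear_add[OF l] complex_pair.linear_scale[OF l] complex_pair.linear_0[OF l] by auto
qed

text \<open>\<open>pd\<close> is defined on a basis, so its Leibniz rule has to be earned: this is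
  the case of a single generator on the left, a comparison of exponents and signs of ordered
  monomials. The rule for all products follows by induction on the left factor.\<close>

lemma pd_u_mult:
  assumes i: "i < r" and j: "j < r"
  shows "pd i (u j * f) = (if i = j then f else 0) + ksign (e i * e j) (u j * pd i f)"
proof (induction f rule: mono_induct)
  case (monomial a)
  let ?s = "\<lambda>i a. e i * (\<Sum>l<i. int (a l) * e l)"
  have upd: "(\<Sum>l<k. int (if l = m then v else a l) * e l) = (\<Sum>l<k. int (a l) * e l)
      + (if m < k then (int v - int (a m)) * e m else 0)" for k m v a
  proof (cases "m < k")
    case True
    then show ?thesis
      by (simp add: sum.remove[of "{..<k}" m] algebra_simps)
  next
    case False
    then show ?thesis by (auto intro: sum.cong)
  qed
  show ?case
  proof (cases "odd (e j) \<and> a j = 1")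
    \<comment> \<open>An odd generator is repeated, so the product is 0 and the right-hand side must
      vanish as well: for equal indices its two terms cancel, for different ones \<open>u j\<close>
      annihilates the derivative.\<close>
    case odd: True
    then have 0: "u j * mon a = 0" using u_mult_mono_zero j by blast
    show ?thesis
    proof (cases "i = j")
      case True
      have "u j * mon (a(j := 0)) = ksign (?s j a) (mon a)"
        using u_mult_mono[OF j, of "a(j := 0)"] odd upd[where k = j and m = j and a = a and v = 0] by (simp add: fun_upd_idem)
      then show ?thesis
        using odd by (simp add: 0 True pd_linear pd_monomial[OF monomial] pd_mono_def scaleC_one scaleC_mult_right)
          (simp add: ksign_def)
    next
      case False
      have "u j * mon (a(i := a i - Suc 0)) = 0"
        using u_mult_mono_zero[OF j, of "a(i := a i - Suc 0)"] odd False by simp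
      then show ?thesis
        using False by (simp add: 0 pd_linear pd_monomial[OF monomial] pd_mono_def scaleC_mult_right)
    qed
  next
    case False
    then have a': "a(j := Suc (a j)) \<in> expo"
      using monomial j by (auto simp: exponents_def)
    have l: "pd i (u j * mon a) = ksign (?s j a) (pd_mono i (a(j := Suc (a j))))"
      unfolding u_mult_mono[OF j] using pd_monomial[OF a', of i] pd_linear
      by (simp add: ksign_conv_scaleC)
    show ?thesis
    proof (cases "i = j")
      case True
      have z: "u j * mon (a(j := a j - Suc 0)) = ksign (?s j a) (mon a)" if "a j > 0"
        using u_mult_mono[OF j, of "a(j := a j - Suc 0)"] that upd[where k = j and m = j and a = a and v = "a j - Suc 0"] by (simp add: fun_upd_idem)
      show ?thesis
      proof (cases "a j = 0")
        case True
        then show ?thesis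
          unfolding l using \<open>i = j\<close> upd[where k = j and m = j and a = a and v = "Suc (a j)"]
          by (simp add: pd_monomial[OF monomial] pd_mono_def scaleC_one fun_upd_idem) (simp add: ksign_def)
      next
        case nz: False
        \<comment> \<open>A positive exponent of an odd generator would be 1, which is the case
          already treated.\<close>
        then have ev: "even (e j)"
          using monomial j False by (auto simp: exponents_def le_Suc_eq)
        show ?thesis
          unfolding l using \<open>i = j\<close> upd[where k = j and m = j and a = a and v = "Suc (a j)"] ev z nz
          by (simp add: pd_monomial[OF monomial] pd_mono_def fun_upd_idem scaleC_mult_right ksign_even
              scaleC_add_left scaleC_one)
      qed
    next
      case ne: False
      have z: "u j * mon (a(i := a i - Suc 0)) =
          ksign (?s j (a(i := a i - Suc 0))) (mon (a(j := Suc (a j), i := a i - Suc 0)))"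
        using u_mult_mono[OF j, of "a(i := a i - Suc 0)"] ne by (simp add: fun_upd_twist)
      show ?thesis
      proof (cases "a i = 0")
        case True
        then show ?thesis unfolding l using ne by (simp add: pd_monomial[OF monomial] pd_mono_def)
      next
        case nz: False
        show ?thesis
          unfolding l using ne nz
          by (simp add: pd_monomial[OF monomial] pd_mono_def z scaleC_mult_right)
            (rule ksign_cong, unfold upd, use nat_neq_iff[of i j] in \<open>auto simp: of_nat_diff distrib_left right_diff_distrib\<close>)
      qed
    qed
  qed
next
  case (add x y)
  then show ?case by (simp add: distrib_left pd_linear ksign_add)
next
  case (scale c x)
  then show ?case by (simp add: pd_linear scaleC_mult_right scaleC_add_right)
qed (simp add: pd_linear)

lemma pd_one [simp]: "pd i 1 = 0"
proof -
  have "mon (\<lambda>_. 0) = 1" unfolding monomial_def by (induction r) auto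
  then show ?thesis
    using pd_monomial[of "\<lambda>_. 0" i] by (simp add: pd_mono_def exponents_def)
qed

lemma pd_u: "i < r \<Longrightarrow> j < r \<Longrightarrow> pd i (u j) = (if i = j then 1 else 0)"
  using pd_u_mult[of i j 1] by simp

lemma pd_mult: "i < r \<Longrightarrow> pd i (a * b) = pd i a * b + tw (e i) a * pd i b"
proof (induction a rule: hmg_induct)
  case (homogeneous n a)
  have "\<forall>b. pd i (a * b) = pd i a * b + tw (e i) a * pd i b"
    using homogeneous(1)
  proof (induction rule: poly_induct)
    case (gen j)
    then show ?case
      using pd_u_mult[of i j] homogeneous(2) by (simp add: pd_u tw_hmg[OF u_hmg])
  next
    case (mult a b m n)
    then show ?case by (simp add: mult.assoc tw_mult distrib_right distrib_left add.assoc)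
  qed (simp_all add: pd_linear distrib_right distrib_left tw_add scaleC_mult_left scaleC_mult_right
      tw_scaleC scaleC_add_right)
  then show ?case by blast
qed (simp add: pd_linear distrib_right distrib_left tw_add)

lemma pd_hmg: "i < r \<Longrightarrow> f \<in> hmg k \<Longrightarrow> pd i f \<in> hmg (k - e i)"
proof -
  assume i: "i < r"
  assume "f \<in> hmg k"
  then show ?thesis
  proof (induction rule: poly_induct)
    case (gen j)
    then show ?case using i by (auto simp: pd_u hmg_zero hmg_one)
  next
    case (mult a b m n)
    then show ?case
      using i by (auto simp: pd_mult algebra_simps intro!: hmg_add tw_in_hmg elim!: hmg_mult_eq)
        (auto intro!: hmg_mult_eq tw_in_hmg)
  qed (auto simp: pd_linear hmg_zero intro: hmg_add hmg_scaleC)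
qed

end

section \<open>Kaehler forms of a polynomial dg-algebra act on coefficient families\<close>

lemma minus_ksign: "- ksign k x = ksign (k + 1) (x :: 'a::ab_group_add)"
  by (simp add: ksign_def)

lemma tw_minus: "tw k (- x) = - tw k (x :: 'a::dg_module)"
  by (simp add: tw_def par_minus)

declare plus_fun_apply [simp del] zero_fun_apply [simp del] minus_apply [simp del] uminus_apply [simp del]

lemma ksign_fun: "ksign k f x = ksign k (f x)"
  by (simp add: ksign_def uminus_apply)

lemma additive_ksign: "additive F \<Longrightarrow> F (ksign k w) = ksign k (F w)"
  by (simp add: ksign_def additive.minus)

lemma additive_simps:
  assumes "additive F"
  shows "F (x + y) = F x + F y" "F (x - y) = F x - F y" "F (- x) = - F x" "F 0 = 0" "F (ksign k x) = ksign k (F x)"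
  using assms by (simp_all add: additive.add additive.diff additive.minus additive.zero additive_ksign)

definition wscale :: "complex \<Rightarrow> ('i \<Rightarrow> 'a::dg_module) \<Rightarrow> 'i \<Rightarrow> 'a" where
  "wscale c w = (\<lambda>is. c *\<^sub>C w is)"

lemma wscale_app: "wscale c w is = c *\<^sub>C w is"
  by (simp add: wscale_def)

lemma wscale_minus_one: "wscale (-1) w = - w" and wscale_one: "wscale 1 w = w"
  and wscale_add_left: "wscale (b + c) w = wscale b w + wscale c w" for w :: "'i \<Rightarrow> 'b::dg_module"
  by (simp_all add: fun_eq_iff plus_fun_apply uminus_apply wscale_app scaleC_one scaleC_add_left)

lemmas fun_app = plus_fun_apply zero_fun_apply minus_apply uminus_apply ksign_fun wscale_app

context polynomial
begin

text \<open>Lists may contain indices outside the range of generators. The default 0 is homogeneous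
  of every degree, so the recursion for \<open>wD\<close> and its symmetry hold for all
  lists.\<close>

abbreviation U :: "nat \<Rightarrow> 'a" where
  "U i \<equiv> if i < r then u i else 0"

lemma U_hmg: "U i \<in> hmg (e i)"
  by (simp add: u_hmg hmg_zero)

definition dg :: "nat list \<Rightarrow> int" where
  "dg is = (\<Sum>i\<leftarrow>is. e i + 1)"

lemma dg_simps [simp]: "dg [] = 0" "dg (i # is) = e i + 1 + dg is" "dg (xs @ ys) = dg xs + dg ys"
  by (simp_all add: dg_def)

text \<open>A family \<open>w\<close> stands for the right-linear functional on forms with
  \<open>w(du\<^sub>i\<^sub>1 \<cdots> du\<^sub>i\<^sub>s) = w [i\<^sub>1, \<dots>, i\<^sub>s]\<close>, and a form \<open>x\<close> acts on it by \<open>(w x)(y) = w(x y)\<close>: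
  \<open>wmul\<close>, \<open>wdif\<close> and \<open>wX\<close> are the actions of \<open>a\<close>, \<open>df\<close> and \<open>du\<^sub>i\<close>, \<open>wE\<close> is the parity involution,
  and \<open>wD\<close> is the commutator with \<open>\<delta>\<close>. Its recursion expresses \<open>\<delta>(du\<^sub>i) = - d(\<delta> u\<^sub>i)\<close>.\<close>

definition wmul :: "(nat list \<Rightarrow> 'a) \<Rightarrow> 'a \<Rightarrow> nat list \<Rightarrow> 'a" where
  "wmul w a = (\<lambda>is. w is * tw (dg is) a)"

definition wdif :: "(nat list \<Rightarrow> 'a) \<Rightarrow> 'a \<Rightarrow> nat list \<Rightarrow> 'a" where
  "wdif w f = (\<lambda>is. \<Sum>i<r. w (i # is) * tw (dg is) (pd i f))"

definition wE :: "(nat list \<Rightarrow> 'a) \<Rightarrow> nat list \<Rightarrow> 'a" where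
  "wE w = (\<lambda>is. ksign (dg is) (par (w is)))"

definition wX :: "nat \<Rightarrow> (nat list \<Rightarrow> 'a) \<Rightarrow> nat list \<Rightarrow> 'a" where
  "wX i w = (\<lambda>is. w (i # is))"

lemma wX_app: "wX i w is = w (i # is)"
  by (simp add: wX_def)

primrec wD :: "(nat list \<Rightarrow> 'a) \<Rightarrow> nat list \<Rightarrow> 'a" where
  "wD w [] = \<delta> (w [])"
| "wD w (i # is) = wD (wX i w) is + wdif (wE w) (\<delta> (U i)) is"

lemma additive_wmul: "additive (\<lambda>w. wmul w a)"
  by standard (auto simp: fun_eq_iff fun_app wmul_def distrib_right)

lemma additive_wdif: "additive (\<lambda>w. wdif w f)"
  by standard (auto simp: fun_eq_iff fun_app wdif_def distrib_right sum.distrib)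

lemma additive_wE: "additive wE"
  by standard (auto simp: fun_eq_iff fun_app wE_def par_add ksign_add)

lemma additive_wX: "additive (wX i)"
  by standard (auto simp: fun_eq_iff fun_app wX_def)

lemma additive_wD: "additive wD"
proof
  fix w v :: "nat list \<Rightarrow> 'a"
  have "wD (w + v) is = wD w is + wD v is" for "is"
    by (induction "is" arbitrary: w v)
      (simp_all add: fun_app dlt_add additive_wX[THEN additive.add] additive_wE[THEN additive.add]
        additive_wdif[THEN additive.add])
  then show "wD (w + v) = wD w + wD v" by (auto simp: fun_eq_iff fun_app)
qed

lemma pd_minus: "pd i (- f) = - pd i f"
  using pd_linear(2)[of i "-1" f] by simp

lemmas wlin = additive_simps[OF additive_wmul] additive_simps[OF additive_wdif]
  additive_simps[OF additive_wE] additive_simps[OF additive_wX] additive_simps[OF additive_wD]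

lemma wmul_right: "wmul w (a + b) = wmul w a + wmul w b" "wmul w (- a) = - wmul w a"
  "wmul w (c *\<^sub>C a) = wscale c (wmul w a)" "wmul w 0 = 0" "wmul w 1 = w"
  "wmul w (a * b) = wmul (wmul w a) b"
  by (auto simp: fun_eq_iff fun_app wmul_def tw_add tw_scaleC tw_minus distrib_left scaleC_mult_right tw_mult mult.assoc)

lemma wdif_right: "wdif w (a + b) = wdif w a + wdif w b" "wdif w (- a) = - wdif w a"
  "wdif w (c *\<^sub>C a) = wscale c (wdif w a)" "wdif w 0 = 0" "wdif w 1 = 0"
  by (auto simp: fun_eq_iff fun_app wdif_def tw_add tw_scaleC tw_minus pd_minus distrib_left scaleC_mult_right
      pd_linear sum.distrib sum_negf complex_vector.scale_sum_right)

lemma wmul_ksign: "wmul w (ksign k a) = ksign k (wmul w a)"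
  and wdif_ksign: "wdif w (ksign k a) = ksign k (wdif w a)"
  by (simp_all add: ksign_def wmul_right wdif_right)

lemma wscale_wscale [simp]: "wscale b (wscale c w) = wscale (b * c) w" for w :: "'i \<Rightarrow> 'b::dg_module"
  by (auto simp: wscale_def scaleC_scaleC)

lemma wscale_lin:
  "wmul (wscale c w) a = wscale c (wmul w a)" "wdif (wscale c w) a = wscale c (wdif w a)"
  "wE (wscale c w) = wscale c (wE w)" "wX i (wscale c w) = wscale c (wX i w)"
  by (auto simp: fun_eq_iff fun_app wX_app wmul_def wdif_def wE_def scaleC_mult_left par_scaleC complex_vector.scale_sum_right)

lemma wscale_plus: "wscale c (v + w) = wscale c v + wscale c w" "wscale c (v - w) = wscale c v - wscale c w"
  for w :: "'i \<Rightarrow> 'b::dg_module"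
  by (auto simp: fun_eq_iff fun_app scaleC_add_right complex_vector.scale_right_diff_distrib)

lemma wD_wscale: "wD (wscale c w) = wscale c (wD w)"
proof -
  have "wD (wscale c w) is = c *\<^sub>C wD w is" for "is"
    by (induction "is" arbitrary: w) (simp_all add: fun_app dlt_scaleC wscale_lin scaleC_add_right wX_app)
  then show ?thesis by (auto simp: fun_eq_iff fun_app)
qed

lemma wE_wE [simp]: "wE (wE w) = w"
  by (auto simp: wE_def ksign_even)

lemma wE_wX: "wE (wX i w) = ksign (e i + 1) (wX i (wE w))"
  by (rule ext) (auto simp: fun_app wE_def wX_app intro: ksign_cong)

lemma wE_wmul: "wE (wmul w a) = wmul (wE w) (par a)"
  by (auto simp: wE_def wmul_def par_mult par_tw tw_par)

lemma wE_wdif: "wE (wdif w f) = - wdif (wE w) (par f)"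
proof
  fix "is"
  have "ksign (dg is) (par (w (i # is) * tw (dg is) (pd i f))) =
      - (ksign (e i + 1 + dg is) (par (w (i # is))) * tw (dg is) (pd i (par f)))" if "i < r" for i
  proof (induction f rule: hmg_induct)
    case (homogeneous n f)
    have "pd i (par f) = ksign n (pd i f)"
      using par_hmg[OF homogeneous] pd_linear(2) by (simp add: ksign_conv_scaleC)
    then show ?case
      by (simp add: par_mult par_tw minus_ksign tw_hmg[OF pd_hmg[OF that homogeneous]]
          par_hmg[OF pd_hmg[OF that homogeneous]])
        (rule ksign_cong, auto)
  next
    case (add x y)
    then show ?case by (simp add: pd_linear par_add tw_add distrib_left ksign_add)
  qed
  then show "wE (wdif w f) is = (- wdif (wE w) (par f)) is"
    by (simp add: fun_app wE_def wdif_def par_sum_distrib ksign_sum sum_negf[symmetric])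
qed

lemma wmul_wmul: "a \<in> hmg m \<Longrightarrow> wmul (wmul w b) a = wmul (wmul w a) (tw m b)"
  by (rule ext) (simp add: wmul_def mult.assoc commute_tw[OF tw_in_hmg, of a m "tw _ b"] tw_tw add.commute)

text \<open>The relation between \<open>a df\<close> and \<open>df a\<close>, read on families;
  \<open>n + 1\<close> is the degree of \<open>df\<close>.\<close>

lemma wdif_wmul: "f \<in> hmg n \<Longrightarrow> wdif (wmul w a) f = wmul (wdif w f) (tw (n + 1) a)"
proof
  fix "is"
  assume f: "f \<in> hmg n"
  have "tw (e i + 1 + dg is) a * tw (dg is) (pd i f) = tw (dg is) (pd i f) * tw (dg is) (tw (n + 1) a)" if "i < r" for i
    unfolding commute_tw[OF tw_in_hmg[OF pd_hmg[OF that f]]] tw_tw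
    by (rule arg_cong[of _ _ "(*) _"], rule tw_cong) auto
  then show "wdif (wmul w a) f is = wmul (wdif w f) (tw (n + 1) a) is"
    by (simp add: wdif_def wmul_def sum_distrib_right mult.assoc)
qed

lemma wdif_mult: "wdif w (a * b) = wmul (wdif w a) b + wdif (wmul w (par a)) b"
proof
  fix "is"
  have "w (i # is) * tw (dg is) (pd i (a * b)) =
    w (i # is) * tw (dg is) (pd i a) * tw (dg is) b + w (i # is) * tw (e i + 1 + dg is) (par a) * tw (dg is) (pd i b)"
    if "i < r" for i
  proof -
    have "tw (e i + 1 + dg is) (par a) = tw (dg is) (tw (e i) a)"
      by (auto simp: tw_par tw_tw intro: tw_cong)
    then show ?thesis
      using that by (simp add: pd_mult tw_add tw_mult distrib_left mult.assoc)
  qed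
  then show "wdif w (a * b) is = (wmul (wdif w a) b + wdif (wmul w (par a)) b) is"
    by (simp add: fun_app wdif_def wmul_def sum_distrib_right sum.distrib)
qed

lemma wdif_u: "i < r \<Longrightarrow> wdif w (u i) = wX i w"
proof
  fix "is" assume "i < r"
  have "wdif w (u i) is = (\<Sum>j<r. if j = i then w (i # is) else 0)"
    unfolding wdif_def by (rule sum.cong) (auto simp: pd_u \<open>i < r\<close>)
  then show "wdif w (u i) is = wX i w is"
    using \<open>i < r\<close> by (simp add: wX_app)
qed

lemma wX_wmul: "wX i (wmul w a) = wmul (wX i w) (tw (e i + 1) a)"
  by (rule ext) (simp add: wmul_def wX_app tw_tw add.commute)

lemma wlin_app: "wmul (v + w) a is = wmul v a is + wmul w a is" "wmul (v - w) a is = wmul v a is - wmul w a is"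
  by (simp_all add: wlin fun_app)

lemma wX_wD: "wX i (wD w) = wD (wX i w) + wdif (wE w) (\<delta> (U i))"
  by (rule ext) (simp add: wX_app fun_app)

lemma wD_wmul: "wD (wmul w a) = wmul (wD w) a + wmul (wE w) (\<delta> a)"
proof
  fix "is"
  show "wD (wmul w a) is = (wmul (wD w) a + wmul (wE w) (\<delta> a)) is"
  proof (induction "is" arbitrary: w a)
    case Nil
    then show ?case by (simp add: fun_app wmul_def wE_def dlt_mult_par)
  next
    case (Cons i "is")
    have d: "\<delta> (U i) \<in> hmg (e i - 1)" by (rule dlt_hmg[OF U_hmg])
    have "wmul (wE w) (\<delta> a) (i # is) = wX i (wmul (wE w) (\<delta> a)) is" by (simp add: wX_app)
    also have "\<dots> = wmul (wE (wX i w)) (\<delta> (tw (e i + 1) a)) is"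
      by (simp only: wX_wmul wE_wX tw_dlt wlin) (simp add: fun_app wmul_def ksign_even)
    finally have 1: "wmul (wE w) (\<delta> a) (i # is) = \<dots>" .
    have "wmul (wD w) a (i # is) = wX i (wmul (wD w) a) is" by (simp add: wX_app)
    also have "\<dots> = wmul (wX i (wD w)) (tw (e i + 1) a) is"
      by (simp only: wX_wmul)
    also have "wX i (wD w) = wD (wX i w) + wdif (wE w) (\<delta> (U i))"
      by (rule wX_wD)
    finally have 2: "wmul (wD w) a (i # is) =
        wmul (wD (wX i w)) (tw (e i + 1) a) is + wmul (wdif (wE w) (\<delta> (U i))) (tw (e i + 1) a) is"
      by (simp only: wlin_app)
    have 3: "wdif (wE (wmul w a)) (\<delta> (U i)) = wmul (wdif (wE w) (\<delta> (U i))) (tw (e i + 1) a)"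
      unfolding wE_wmul wdif_wmul[OF d] by (simp add: tw_par)
    show ?case
      using Cons[of "wX i w" "tw (e i + 1) a"] by (simp only: wD.simps wX_wmul plus_fun_apply 1 2 3 add_ac)
  qed
qed

text \<open>For a generator this is the recursion defining \<open>wD\<close>; products follow
  because both sides obey the same Leibniz rule.\<close>

lemma wD_wdif: "wD (wdif w f) = wdif (wD w) f - wdif (wE w) (\<delta> f)"
proof (induction f rule: hmg_induct)
  case (homogeneous n f)
  have "\<forall>w. wD (wdif w f) = wdif (wD w) f - wdif (wE w) (\<delta> f)"
    using homogeneous
  proof (induction rule: poly_induct)
    case (gen i)
    then show ?case by (simp add: wdif_u wX_wD algebra_simps)
  next
    case (mult a b m n)
    show ?case
      by (intro allI, simp only: wdif_mult wD_wmul wlin mult(6,7)[rule_format] dlt_mult_par wdif_right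
          wE_wmul wE_wdif par_dlt wmul_right par_par) (simp only: algebra_simps, simp)
  qed (auto simp: wdif_right wlin dlt_add dlt_scaleC wD_wscale wscale_plus)
  then show ?case by blast
qed (auto simp: wdif_right wlin dlt_add)

lemma wE_wD: "wE (wD w) = - wD (wE w)"
proof
  fix "is"
  show "wE (wD w) is = (- wD (wE w)) is"
  proof (induction "is" arbitrary: w)
    case Nil
    then show ?case by (simp add: fun_app wE_def par_dlt)
  next
    case (Cons i "is")
    have d: "\<delta> (U i) \<in> hmg (e i - 1)" by (rule dlt_hmg[OF U_hmg])
    have "wE (wD w) (i # is) = wX i (wE (wD w)) is" by (simp add: wX_app)
    also have "wX i (wE (wD w)) = ksign (e i + 1) (wE (wX i (wD w)))"
      unfolding wE_wX by (simp add: ksign_even)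
    also note wX_wD
    also have "ksign (e i + 1) (wE (wD (wX i w) + wdif (wE w) (\<delta> (U i)))) is =
        ksign (e i + 1) (wE (wD (wX i w)) is - wdif w (par (\<delta> (U i))) is)"
      by (simp only: wlin wE_wdif wE_wE fun_app) simp
    also have "\<dots> = ksign (e i + 1) (- wD (wE (wX i w)) is - wdif w (par (\<delta> (U i))) is)"
      by (simp add: Cons fun_app)
    also have "\<dots> = - wD (wX i (wE w)) is - wdif w (\<delta> (U i)) is"
      unfolding par_hmg[OF d] wE_wX
      by (cases "even (e i)") (simp_all add: fun_app ksign_def wlin wdif_right)
    finally show ?case by (simp add: fun_app)
  qed
qed

text \<open>Induction on the list: stripping the first index from \<open>wD w\<close> leaves two
  correction terms, which cancel because \<open>wE\<close> anticommutes with \<open>wD\<close> and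
  \<delta> squares to 0.\<close>

lemma wD_wD: "wD (wD w) = 0"
proof
  fix "is"
  show "wD (wD w) is = 0 is"
  proof (induction "is" arbitrary: w)
    case Nil
    then show ?case by (simp add: dlt_dlt fun_app)
  next
    case (Cons i "is")
    note X = wX_wD[of i w]
    have "wD (wD w) (i # is) = wD (wdif (wE w) (\<delta> (U i))) is + wdif (wE (wD w)) (\<delta> (U i)) is"
      using Cons[of "wX i w"] by (simp only: wD.simps X wlin plus_fun_apply) (simp add: fun_app)
    then show ?case
      by (simp add: wD_wdif wE_wD wlin dlt_dlt wdif_right fun_app)
  qed
qed

section \<open>Graded symmetric families\<close>

text \<open>Expresses that the \<open>du\<close> of the generators commute up to the Koszul sign of
  their degrees \<open>e i + 1\<close>. On such families the formal relation of graded commutativity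
  is respected.\<close>

definition wSym :: "(nat list \<Rightarrow> 'a) \<Rightarrow> bool" where
  "wSym w \<longleftrightarrow> (\<forall>xs i j ys. w (xs @ i # j # ys) = ksign ((e i + 1) * (e j + 1)) (w (xs @ j # i # ys)))"

lemma wSymD: "wSym w \<Longrightarrow> w (xs @ i # j # ys) = ksign ((e i + 1) * (e j + 1)) (w (xs @ j # i # ys))"
  unfolding wSym_def by blast

lemma wSym_X: "wSym w \<Longrightarrow> wSym (wX i w)"
  unfolding wSym_def wX_app by (metis append_Cons)

lemma wSymI:
  "(\<And>xs i j ys. w (xs @ i # j # ys) = ksign ((e i + 1) * (e j + 1)) (w (xs @ j # i # ys))) \<Longrightarrow> wSym w"
  unfolding wSym_def by blast

lemma wSym_lin:
  shows "wSym v \<Longrightarrow> wSym w \<Longrightarrow> wSym (v + w)" "wSym v \<Longrightarrow> wSym w \<Longrightarrow> wSym (v - w)"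
    "wSym w \<Longrightarrow> wSym (wscale c w)"
  subgoal
    by (rule wSymI, unfold plus_fun_apply ksign_add, rule arg_cong2[of _ _ _ _ "(+)"]; erule wSymD)
  subgoal
    by (rule wSymI, unfold minus_apply ksign_diff, rule arg_cong2[of _ _ _ _ "(-)"]; erule wSymD)
  subgoal
    by (rule wSymI, unfold wscale_app ksign_scaleC[symmetric], rule arg_cong[of _ _ "scaleC c"], erule wSymD)
  done

lemma wSym_mul:
  assumes "wSym w" shows "wSym (wmul w a)"
proof (rule wSymI)
  fix xs i j ys
  show "wmul w a (xs @ i # j # ys) = ksign ((e i + 1) * (e j + 1)) (wmul w a (xs @ j # i # ys))"
    unfolding wmul_def using wSymD[OF assms, of xs i j ys] by (simp add: add_ac)
qed

lemma wSym_dif: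
  assumes "wSym w" shows "wSym (wdif w f)"
proof (rule wSymI)
  fix xs i j ys
  have "w (k # xs @ i # j # ys) = ksign ((e i + 1) * (e j + 1)) (w (k # xs @ j # i # ys))" for k
    using wSymD[OF assms, of "k # xs" i j ys] by simp
  then show "wdif w f (xs @ i # j # ys) = ksign ((e i + 1) * (e j + 1)) (wdif w f (xs @ j # i # ys))"
    unfolding wdif_def by (simp add: add_ac ksign_sum)
qed

lemma wSym_E: "wSym w \<Longrightarrow> wSym (wE w)"
  proof (rule wSymI)
  fix xs i j ys
  assume "wSym w"
  then show "wE w (xs @ i # j # ys) = ksign ((e i + 1) * (e j + 1)) (wE w (xs @ j # i # ys))"
    using wSymD[of w xs i j ys] by (auto simp: wE_def intro: ksign_cong)
qed

lemma wdif_Cons: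
  assumes "wSym w" "f \<in> hmg n"
  shows "wdif w f (j # is) = ksign ((e j + 1) * (n + 1)) (wdif (wX j w) f is)"
proof -
  have "w (i # j # is) * tw (e j + 1 + dg is) (pd i f) =
    ksign ((e j + 1) * (n + 1)) (w (j # i # is) * tw (dg is) (pd i f))" if "i < r" for i
    using wSymD[OF assms(1), of "[]" i j "is"]
    by (simp add: tw_hmg[OF pd_hmg[OF that assms(2)]]) (rule ksign_cong, auto)
  then show ?thesis
    unfolding wdif_def by (simp add: ksign_sum wX_app)
qed

lemma wSym_D: "wSym w \<Longrightarrow> wSym (wD w)"
proof -
  have "wD w (xs @ i # j # ys) = ksign ((e i + 1) * (e j + 1)) (wD w (xs @ j # i # ys))" if "wSym w" for xs i j ys w
    using that
  proof (induction xs arbitrary: w)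
    case Nil
    have d: "\<delta> (U i) \<in> hmg (e i - 1)" for i by (rule dlt_hmg[OF U_hmg])
    have XX: "wX j (wX i w) = ksign ((e i + 1) * (e j + 1)) (wX i (wX j w))"
    proof
      fix ys
      show "wX j (wX i w) ys = ksign ((e i + 1) * (e j + 1)) (wX i (wX j w)) ys"
        using wSymD[OF Nil, of "[]" i j ys] by (simp add: wX_app fun_app)
    qed
    \<comment> \<open>The correction caused by the first index, read with the second index in front,
      is up to sign the correction it causes once the second index is stripped. Swapping the indices
      therefore exchanges the two corrections.\<close>
    have E: "wdif (wE w) (\<delta> (U i)) (j # ys) =
        ksign ((e i + 1) * (e j + 1)) (wdif (wE (wX j w)) (\<delta> (U i)) ys)" for i j
      unfolding wdif_Cons[OF wSym_E[OF Nil] d] wE_wX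
      by (simp only: wlin ksign_fun ksign_ksign) (rule ksign_cong, auto)
    have "wD w (i # j # ys) = wD (wX j (wX i w)) ys + wdif (wE (wX i w)) (\<delta> (U j)) ys + wdif (wE w) (\<delta> (U i)) (j # ys)" for i j
      by (simp add: wX_app)
    note * = this[of i j] this[of j i]
    show ?case
      unfolding append.append_Nil *
      unfolding E[of i j] E[of j i] XX
      by (simp only: wlin ksign_fun ksign_add ksign_ksign) (simp add: ksign_def ac_simps)
  next
    case (Cons x xs)
    have "wSym (wdif (wE w) (\<delta> (U x)))"
      by (intro wSym_dif wSym_E Cons.prems)
    from wSymD[OF this, of xs i j ys] show ?case
      by (simp add: Cons.IH[OF wSym_X[OF Cons.prems]] ksign_add)
  qed
  then show "wSym w \<Longrightarrow> ?thesis" by (blast intro: wSymI)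
qed

text \<open>In degree \<open>k\<close> one has \<open>wD (w x) = (wD w) x + (-1)\<^sup>k w (\<delta> x)\<close>, which dictates the clause for \<open>Delta\<close>.\<close>

primrec act :: "'a kterm \<Rightarrow> (nat list \<Rightarrow> 'a) \<Rightarrow> nat list \<Rightarrow> 'a" where
  "act (Inc a) w = wmul w a"
| "act (Dif a) w = wdif w a"
| "act (Plus s t) w = act s w + act t w"
| "act (Times s t) w = act t (act s w)"
| "act (Scale c t) w = wscale c (act t w)"
| "act (Delta t) w = wD (act t (wE w)) - act t (wD (wE w))"

lemma additive_act: "additive (act t)"
proof
  fix v w
  show "act t (v + w) = act t v + act t w"
    by (induction t arbitrary: v w) (auto simp: wlin wscale_plus algebra_simps)
qed

lemmas alin = additive_simps[OF additive_act]

lemma act_wscale: "act t (wscale c w) = wscale c (act t w)"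
  by (induction t arbitrary: w) (auto simp: wscale_lin wD_wscale wscale_plus mult.commute)

lemma wSym_act: "wSym w \<Longrightarrow> wSym (act t w)"
  by (induction t arbitrary: w) (simp_all add: wSym_lin wSym_mul wSym_dif wSym_D wSym_E)

lemma wscale_ksign: "wscale c (ksign k w) = ksign k (wscale c w)" for w :: "'i \<Rightarrow> 'b::dg_module"
  by (simp add: fun_eq_iff fun_app)

lemma wE_act: "khom t n \<Longrightarrow> wE (act t w) = ksign n (act t (wE w))"
proof (induction arbitrary: w rule: khom.induct)
  case (1 a n)
  then show ?case by (simp add: wE_wmul par_hmg wmul_ksign)
next
  case (2 a n)
  then show ?case by (simp add: wE_wdif par_hmg wdif_ksign minus_ksign)
next
  case (6 t n)
  have "wE (act (Delta t) w) = - wD (wE (act t (wE w))) - wE (act t (wD (wE w)))"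
    by (simp add: wlin wE_wD)
  also have "\<dots> = ksign n (- wD (act t w)) - ksign n (act t (wE (wD (wE w))))"
    by (simp add: "6.IH" wlin ksign_minus)
  also have "\<dots> = ksign (n - 1) (act (Delta t) (wE w))"
    by (simp add: wE_wD alin) (simp add: ksign_def)
  finally show ?case .
qed (auto simp: wlin alin ksign_add wscale_lin wscale_ksign add.commute)

text \<open>Exchanging the two summations, symmetry of \<open>w\<close> swaps the two indices and
  graded commutativity of the algebra swaps the two partial derivatives; the product of the two
  signs does not depend on the indices.\<close>

lemma wdif_wdif:
  assumes w: "wSym w" and a: "a \<in> hmg m" and b: "b \<in> hmg n"
  shows "wdif (wdif w b) a = ksign ((m + 1) * (n + 1)) (wdif (wdif w a) b)"
proof
  fix "is"
  let ?k = "ksign ((m + 1) * (n + 1))"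
  have "w (j # i # is) * tw (e i + 1 + dg is) (pd j b) * tw (dg is) (pd i a) =
    ?k (w (i # j # is) * tw (e j + 1 + dg is) (pd i a) * tw (dg is) (pd j b))" if i: "i < r" and j: "j < r" for i j
  proof -
    note 1 = tw_hmg[OF pd_hmg[OF i a]] tw_hmg[OF pd_hmg[OF j b]]
    have 2: "pd j b * pd i a = ksign ((n - e j) * (m - e i)) (pd i a * pd j b)"
      by (rule graded_commute[OF pd_hmg[OF j b] pd_hmg[OF i a]])
    show ?thesis
      using wSymD[OF w, of "[]" j i "is"]
      by (simp add: 1 2 mult.assoc) (rule ksign_cong, auto)
  qed
  then have "(\<Sum>i<r. \<Sum>j<r. w (j # i # is) * tw (e i + 1 + dg is) (pd j b) * tw (dg is) (pd i a)) =
    (\<Sum>i<r. \<Sum>j<r. ?k (w (i # j # is) * tw (e j + 1 + dg is) (pd i a) * tw (dg is) (pd j b)))"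
    by simp
  also have "\<dots> = (\<Sum>j<r. \<Sum>i<r. ?k (w (i # j # is) * tw (e j + 1 + dg is) (pd i a) * tw (dg is) (pd j b)))"
    by (rule sum.swap)
  finally show "wdif (wdif w b) a is = ?k (wdif (wdif w a) b) is"
    unfolding ksign_fun wdif_def by (simp add: sum_distrib_right ksign_sum)
qed

text \<open>A generator together with its degree and its differential, normalised to be a generator
  again. This closure is needed to commute a generator past a formal \<open>Delta\<close>: the
  commutation leaves the differentiated generator behind, and the induction hypothesis has to apply
  to it.\<close>

inductive generator :: "'a kterm \<Rightarrow> int \<Rightarrow> 'a kterm \<Rightarrow> bool" where
  "a \<in> hmg n \<Longrightarrow> generator (Inc a) n (Inc (\<delta> a))"
| "a \<in> hmg n \<Longrightarrow> generator (Dif a) (n + 1) (Dif (- \<delta> a))"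

lemma generator_khom: "generator y n y' \<Longrightarrow> khom y n"
  by (erule generator.cases) (auto intro: khom.intros)

lemma generator_next: "generator y n y' \<Longrightarrow> \<exists>y''. generator y' (n - 1) y''"
proof (erule generator.cases)
  fix a m assume a: "a \<in> hmg m" "y = Inc a" "n = m" "y' = Inc (\<delta> a)"
  then show ?thesis using generator.intros(1)[OF dlt_hmg[OF a(1)]] by blast
next
  fix a m assume a: "a \<in> hmg m" "y = Dif a" "n = m + 1" "y' = Dif (- \<delta> a)"
  then show ?thesis using generator.intros(2)[OF hmg_minus[OF dlt_hmg[OF a(1)]]] by auto
qed

lemma wD_generator: "generator y n y' \<Longrightarrow> wD (act y w) = act y (wD w) + act y' (wE w)"
  by (erule generator.cases) (auto simp: wD_wmul wD_wdif wdif_right)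

lemma act_generator_commute:
  assumes "khom s m" "generator y n y'" "wSym w"
  shows "act y (act s w) = ksign (m * n) (act s (act y w))"
  using assms
proof (induction arbitrary: w y n y' rule: khom.induct)
  case (1 b m)
  from 1(2) show ?case
  proof cases
    case (1 a)
    then show ?thesis
      using \<open>b \<in> hmg m\<close> by (simp add: wmul_wmul[of a n] tw_hmg[of b m] wmul_ksign mult.commute)
  next
    case (2 a n)
    then show ?thesis
      using \<open>b \<in> hmg m\<close> by (simp add: wdif_wmul[of a n] tw_hmg[of b m] wmul_ksign mult.commute)
  qed
next
  case (2 b m)
  from 2(2) show ?case
  proof cases
    case (1 a)
    then show ?thesis
      using \<open>b \<in> hmg m\<close> by (simp add: wdif_wmul[of b m] tw_hmg[of a n] wmul_ksign ksign_even)
  next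
    case (2 a n)
    then show ?thesis
      using wdif_wdif[OF \<open>wSym w\<close> _ \<open>b \<in> hmg m\<close>, of a n] by (simp add: mult.commute)
  qed
next
  case (3 s m t)
  have "act y (act s w) = ksign (m * n) (act s (act y w))" "act y (act t w) = ksign (m * n) (act t (act y w))"
    by (rule "3.IH"(1)[OF "3.prems"], rule "3.IH"(2)[OF "3.prems"])
  then show ?case by (simp only: act.simps alin ksign_add)
next
  case (4 s m t k)
  have "act y (act t (act s w)) = ksign (k * n) (act t (act y (act s w)))"
    by (rule "4.IH"(2)[OF "4.prems"(1) wSym_act[OF "4.prems"(2)]])
  also have "\<dots> = ksign ((m + k) * n) (act t (act s (act y w)))"
    by (simp only: alin "4.IH"(1)[OF "4.prems"] ksign_ksign distrib_right add.commute)
  finally show ?case by simp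
next
  case (5 t n c)
  then show ?case by (simp add: act_wscale wscale_ksign)
next
  case (6 t m)
  obtain y'' where y'': "generator y' (n - 1) y''" using generator_next[OF 6(3)] by blast
  note g = wD_generator[OF 6(3)]
  note E = wE_act[OF generator_khom[OF 6(3)]] wE_act[OF 6(1)]
  have "act y (act (Delta t) w) = act y (wD (act t (wE w))) - act y (act t (wD (wE w)))"
    by (simp add: alin)
  also have "act y (wD (act t (wE w))) = wD (act y (act t (wE w))) - act y' (wE (act t (wE w)))"
    by (simp add: g)
  also have "act y (act t (wE w)) = ksign (m * n) (act t (act y (wE w)))"
    by (rule 6(2)[OF 6(3) wSym_E[OF 6(4)]])
  also have "act y (act t (wD (wE w))) = ksign (m * n) (act t (act y (wD (wE w))))"
    by (rule 6(2)[OF 6(3) wSym_D[OF wSym_E[OF 6(4)]]])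
  also have "act y' (wE (act t (wE w))) = ksign (m * n) (act t (act y' w))"
    using 6(2)[OF y'' 6(4)] by (simp add: E alin) (rule ksign_cong, auto)
  finally have 1: "act y (act (Delta t) w) =
      ksign (m * n) (wD (act t (act y (wE w))) - act t (act y' w) - act t (act y (wD (wE w))))"
    by (simp add: wlin ksign_diff)
  have "act (Delta t) (act y w) = ksign n (wD (act t (act y (wE w))) - act t (wD (act y (wE w))))"
    by (simp add: E alin wlin ksign_diff)
  also have "\<dots> = ksign n (wD (act t (act y (wE w))) - act t (act y (wD (wE w))) - act t (act y' w))"
    by (simp add: g alin diff_diff_eq)
  finally have 2: "ksign ((m - 1) * n) (act (Delta t) (act y w)) =
      ksign ((m - 1) * n + n) (wD (act t (act y (wE w))) - act t (act y (wD (wE w))) - act t (act y' w))"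
    by simp
  show ?case unfolding 1 2 by (rule ksign_cong) (auto simp: algebra_simps)
qed

text \<open>The induction is on \<open>t\<close> with \<open>s\<close> arbitrary. In the case
  \<open>Delta t\<close> the differential is moved over to the other factor, so the hypothesis for
  \<open>t\<close> is used at \<open>Delta s\<close>; the base cases are those of a generator
  against an arbitrary term.\<close>

lemma act_commute:
  assumes "khom t n" "khom s m" "wSym w"
  shows "act t (act s w) = ksign (m * n) (act s (act t w))"
  using assms
proof (induction arbitrary: w s m rule: khom.induct)
  case (1 a n)
  then show ?case using act_generator_commute generator.intros(1) by blast
next
  case (2 a n)
  then show ?case using act_generator_commute generator.intros(2) by blast
next
  case (3 s n t)
  show ?case
    by (simp only: act.simps alin "3.IH"(1)[OF "3.prems"] "3.IH"(2)[OF "3.prems"] ksign_add)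
next
  case (4 t1 n1 t2 n2)
  have "act t2 (act t1 (act s w)) = act t2 (ksign (m * n1) (act s (act t1 w)))"
    by (simp only: "4.IH"(1)[OF "4.prems"])
  also have "\<dots> = ksign (m * n1) (ksign (m * n2) (act s (act t2 (act t1 w))))"
    by (simp only: alin "4.IH"(2)[OF "4.prems"(1) wSym_act[OF "4.prems"(2)]])
  finally show ?case by (simp only: act.simps ksign_ksign distrib_left)
next
  case (5 t n c)
  then show ?case by (simp add: act_wscale wscale_ksign)
next
  case (6 t n)
  have D: "wD (act s x) = act (Delta s) (wE x) + act s (wD x)" for x
    by simp
  note E = wE_act[OF 6(1)] wE_act[OF 6(3)]
  have "act (Delta t) (act s w) = ksign m (wD (act t (act s (wE w))) - act t (wD (act s (wE w))))"
    by (simp add: E alin wlin ksign_diff)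
  also have "act t (act s (wE w)) = ksign (m * n) (act s (act t (wE w)))"
    by (rule 6(2)[OF 6(3) wSym_E[OF 6(4)]])
  also have "wD (ksign (m * n) (act s (act t (wE w)))) =
      ksign (m * n) (act (Delta s) (wE (act t (wE w))) + act s (wD (act t (wE w))))"
    by (simp only: wlin D)
  also have "\<dots> = ksign ((m - 1) * n) (act (Delta s) (act t w)) + ksign (m * n) (act s (wD (act t (wE w))))"
    unfolding E(1) alin wE_wE ksign_add ksign_ksign
    by (rule arg_cong2[of _ _ _ _ "(+)"]; rule ksign_cong) (auto simp: algebra_simps)
  also have "act t (wD (act s (wE w))) = act t (act (Delta s) w) + act t (act s (wD (wE w)))"
    by (simp only: D alin wE_wE)
  also have "act t (act (Delta s) w) = ksign ((m - 1) * n) (act (Delta s) (act t w))"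
    by (rule 6(2)[OF khom.intros(6)[OF 6(3)] 6(4)])
  also have "act t (act s (wD (wE w))) = ksign (m * n) (act s (act t (wD (wE w))))"
    by (rule 6(2)[OF 6(3) wSym_D[OF wSym_E[OF 6(4)]]])
  finally have "act (Delta t) (act s w) = ksign (m + m * n) (act s (wD (act t (wE w))) - act s (act t (wD (wE w))))"
    by (simp only: add_diff_cancel_left ksign_diff ksign_ksign)
  also have "\<dots> = ksign (m * (n - 1)) (act s (act (Delta t) w))"
    by (simp only: act.simps alin) (rule ksign_cong, auto)
  finally show ?case .
qed

lemma act_tsign: "act (tsign k t) w = ksign k (act t w)"
  by (auto simp: fun_eq_iff fun_app tsign_def ksign_def scaleC_one)

text \<open>The action descends to Kaehler forms. Symmetry of \<open>w\<close> enters with graded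
  commutativity, and it persists under the operators applied on the way.\<close>

lemma act_keq: "s \<approx> t \<Longrightarrow> wSym w \<Longrightarrow> act s w = act t w"
proof (induction arbitrary: w rule: keq.induct)
  case (Times s s' t t')
  then show ?case by (simp add: wSym_act)
next
  case (Delta t t')
  then show ?case by (simp add: wSym_E wSym_D)
next
  case (Times_comm s m t n)
  then show ?case using act_commute[of t n s m w] by (simp add: act_tsign)
next
  case (Delta_Times s m t)
  then show ?case by (simp add: act_tsign wE_act alin wlin ksign_diff ksign_even)
next
  case (Delta_Delta t)
  then show ?case by (auto simp: wlin alin wE_wD wD_wD wmul_right)
next
  case (Dif_mult a m b)
  then show ?case by (simp add: wdif_mult par_hmg act_tsign wmul_ksign wlin)
qed (auto simp: wmul_right wdif_right alin act_wscale wscale_plus wD_wmul wD_wdif wD_wscale wlin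
    wscale_minus_one wscale_one wscale_add_left add_ac)

section \<open>Functionals on Kaehler forms with prescribed values\<close>

definition kact :: "(nat list \<Rightarrow> 'a) \<Rightarrow> 'a kaehler \<Rightarrow> nat list \<Rightarrow> 'a" where
  "kact w x = act (rep_kaehler x) w"

lemma kact_kabs: "wSym w \<Longrightarrow> kact w (kabs t) = act t w"
proof -
  have "kabs (rep_kaehler (kabs t)) = kabs t"
    by (rule Quotient3_abs_rep[OF Quotient3_kaehler])
  then show "wSym w \<Longrightarrow> ?thesis"
    unfolding kact_def kabs_eq_iff by (rule act_keq)
qed

lemma kabs_cases: obtains t where "x = kabs t"
  by (metis Quotient3_abs_rep[OF Quotient3_kaehler])

lemma kact_simps:
  assumes "wSym w"
  shows "kact w (x + y) = kact w x + kact w y" "kact w (x * y) = kact (kact w x) y"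
    "kact w (c *\<^sub>C x) = wscale c (kact w x)" "kact w (inc a) = wmul w a" "kact w (\<d> f) = wdif w f"
    "wSym (kact w x)"
  subgoal using assms by (cases x rule: kabs_cases, cases y rule: kabs_cases) (simp add: kact_kabs flip: kabs_simps)
  subgoal using assms by (cases x rule: kabs_cases, cases y rule: kabs_cases) (simp add: kact_kabs wSym_act flip: kabs_simps)
  subgoal using assms by (cases x rule: kabs_cases) (simp add: kact_kabs flip: kabs_simps)
  subgoal using assms by (simp add: kact_kabs flip: kabs_simps)
  subgoal using assms by (simp add: kact_kabs flip: kabs_simps)
  subgoal using assms by (simp add: kact_def wSym_act)
  done

definition wHom :: "int \<Rightarrow> (nat list \<Rightarrow> 'a) \<Rightarrow> bool" where
  "wHom k w \<longleftrightarrow> (\<forall>is. w is \<in> hmg (dg is + k))"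

lemma wHomD: "wHom k w \<Longrightarrow> w is \<in> hmg (dg is + k)"
  by (simp add: wHom_def)

lemma wHom_D: "wHom k w \<Longrightarrow> wHom (k - 1) (wD w)"
proof -
  have "wD w is \<in> hmg (dg is + (k - 1))" if "wHom k w" for "is" w k
    using that
  proof (induction "is" arbitrary: w k)
    case Nil
    then show ?case using dlt_hmg[of "w []" k] by (auto simp: wHom_def dest: spec[of _ "[]"])
  next
    case (Cons i "is")
    have "wHom (k + (e i + 1)) (wX i w)" using wHomD[OF Cons.prems, of "i # is" for "is"] by (auto simp: wHom_def wX_app algebra_simps)
    from Cons.IH[OF this] have "wD (wX i w) is \<in> hmg (dg (i # is) + (k - 1))" by (simp add: algebra_simps)
    moreover have "wE w (j # is) * tw (dg is) (pd j (\<delta> (U i))) \<in> hmg (dg (i # is) + (k - 1))" if "j < r" for j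
    proof (rule hmg_mult_eq)
      show "wE w (j # is) \<in> hmg (dg (j # is) + k)"
        unfolding wE_def by (intro hmg_ksign par_in_hmg wHomD Cons.prems)
      show "tw (dg is) (pd j (\<delta> (U i))) \<in> hmg (e i - 1 - e j)"
        by (intro tw_in_hmg pd_hmg[OF that] dlt_hmg U_hmg)
    qed simp
    ultimately show ?case
      unfolding wD.simps wdif_def by (intro hmg_add hmg_sum) auto
  qed
  then show "wHom k w \<Longrightarrow> ?thesis" unfolding wHom_def by blast
qed

lemma wHom_E: "wHom k w \<Longrightarrow> wHom k (wE w)"
  by (auto simp: wHom_def wE_def intro!: hmg_ksign par_in_hmg)

lemma wHom_act: "khom t n \<Longrightarrow> wHom k w \<Longrightarrow> wHom (k + n) (act t w)"
proof (induction arbitrary: k w rule: khom.induct)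
  case (1 a n)
  then show ?case by (auto simp: wHom_def wmul_def intro!: hmg_mult_eq tw_in_hmg)
next
  case (2 a n)
  have "w (i # is) * tw (dg is) (pd i a) \<in> hmg (dg is + (k + (n + 1)))" if "i < r" for i "is"
    by (rule hmg_mult_eq[OF _ tw_in_hmg[OF pd_hmg[OF that 2(1)]], of _ "dg (i # is) + k"])
      (use wHomD[OF 2(2), of "i # is"] in \<open>simp_all add: algebra_simps\<close>)
  then show ?case by (auto simp: wHom_def wdif_def intro!: hmg_sum)
next
  case (3 s n t)
  then show ?case unfolding wHom_def act.simps plus_fun_apply by (blast intro: hmg_add)
next
  case (4 s m t n)
  then show ?case by (metis act.simps(4) add.assoc)
next
  case (5 t n c)
  then show ?case by (auto simp: wHom_def fun_app intro!: hmg_scaleC)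
next
  case (6 t n)
  have "wHom (k + (n - 1)) (wD (act t (wE w)))"
    using wHom_D[OF "6.IH"[OF wHom_E[OF 6(3)]]] by (simp add: algebra_simps)
  moreover have "wHom (k + (n - 1)) (act t (wD (wE w)))"
    using "6.IH"[OF wHom_D[OF wHom_E[OF 6(3)]]] by (simp add: algebra_simps)
  ultimately show ?case
    unfolding wHom_def act.simps minus_apply diff_conv_add_uminus[of "_ :: 'a"] by (blast intro: hmg_add hmg_minus)
qed

text \<open>The value at the empty list is the value of the functional at 1, so this is the
  functional of \<open>w\<close> at \<open>x\<close>. Forms with any number of differentials are
  covered by the same \<open>w\<close>.\<close>

definition ev :: "(nat list \<Rightarrow> 'a) \<Rightarrow> 'a kaehler \<Rightarrow> 'a" where
  "ev w x = kact w x []"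

lemma ev_add: "wSym w \<Longrightarrow> ev w (x + y) = ev w x + ev w y"
  by (simp add: ev_def kact_simps fun_app)

lemma ev_scaleC: "wSym w \<Longrightarrow> ev w (c *\<^sub>C x) = c *\<^sub>C ev w x"
  by (simp add: ev_def kact_simps fun_app)

lemma ev_mult_inc: "wSym w \<Longrightarrow> ev w (x * inc a) = ev w x * a"
  by (simp add: ev_def kact_simps wmul_def)

lemma ev_hmg: "wSym w \<Longrightarrow> wHom k w \<Longrightarrow> x \<in> hmg n \<Longrightarrow> ev w x \<in> hmg (k + n)"
proof -
  assume w: "wSym w" "wHom k w" and "x \<in> hmg n"
  then obtain t where "khom t n" "x = kabs t" by (auto simp: hmg_kaehler_iff)
  then show ?thesis
    using wHom_act[of t n k w] w by (auto simp: ev_def kact_kabs wHom_def dest: spec[of _ "[]"])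
qed

text \<open>The existence half of freeness: every graded symmetric family consists of the values of
  a functional on products of the \<open>du\<close> of generators.\<close>

lemma ev_generators:
  "wSym w \<Longrightarrow> set is \<subseteq> {..<r} \<Longrightarrow> ev w (prod_list (map (\<lambda>i. \<d> (u i)) is)) = w is"
  unfolding ev_def
proof (induction "is" arbitrary: w)
  case Nil
  then show ?case using kact_simps(4)[OF Nil(1), of 1] by (simp add: inc_kaehler wmul_right)
next
  case (Cons i "is")
  have "kact (wX i w) (prod_list (map (\<lambda>i. \<d> (u i)) is)) [] = wX i w is"
    using Cons.prems by (intro Cons.IH wSym_X) auto
  also have "\<dots> = w (i # is)" by (rule wX_app)
  finally show ?case using Cons.prems by (simp add: kact_simps wdif_u)
qed

lemma ev_plus: "ev (v + w) x = ev v x + ev w x"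
  by (simp add: ev_def kact_def alin fun_app)

end

section \<open>The pre-Lie product of cochains\<close>

text \<open>Arguments are pairs \<open>(f, m)\<close> with \<open>m\<close> the degree of \<open>df\<close>, one more than that of \<open>f\<close>.\<close>

definition graded :: "('a::cdga \<times> int) list \<Rightarrow> bool" where
  "graded zs \<longleftrightarrow> (\<forall>(f, m)\<in>set zs. f \<in> hmg (m - 1))"

definition degs :: "('a \<times> int) list \<Rightarrow> int" where
  "degs zs = sum_list (map snd zs)"

lemma graded_simps [simp]:
  "graded []" "graded (z # zs) \<longleftrightarrow> fst z \<in> hmg (snd z - 1) \<and> graded zs"
  "graded (xs @ ys) \<longleftrightarrow> graded xs \<and> graded ys"
  by (auto simp: graded_def)

lemma degs_simps [simp]: "degs [] = 0" "degs (z # zs) = snd z + degs zs" "degs (xs @ ys) = degs xs + degs ys"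
  by (simp_all add: degs_def)

text \<open>Reading the arguments from the left, each one is given either to \<open>l\<close>, where it has to pass
  \<open>p\<close> and the arguments already given to \<open>p\<close> (of total degree \<open>k\<close>), or to \<open>p\<close>.\<close>

primrec prelie ::
  "int \<Rightarrow> (('a \<times> int) list \<Rightarrow> 'a::cdga) \<Rightarrow> (('a \<times> int) list \<Rightarrow> 'a) \<Rightarrow> ('a \<times> int) list \<Rightarrow> 'a" where
  "prelie k l p [] = l [(p [], k)]"
| "prelie k l p (z # zs) =
     ksign (snd z * k) (prelie k (\<lambda>x. l (z # x)) p zs) + prelie (k + snd z) l (\<lambda>x. p (z # x)) zs"

text \<open>\<open>k\<close> is the degree of d composed with \<open>p\<close>, one more than that
  of \<open>p\<close>. Thus \<open>(p zs, k + degs zs)\<close> is again a legitimate argument, as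
  needed by \<open>prelie\<close>.\<close>

definition cochain_degree :: "int \<Rightarrow> (('a \<times> int) list \<Rightarrow> 'a::cdga) \<Rightarrow> bool" where
  "cochain_degree k p \<longleftrightarrow> (\<forall>zs. graded zs \<longrightarrow> p zs \<in> hmg (k - 1 + degs zs))"

definition multiadditive :: "(('a \<times> int) list \<Rightarrow> 'a::cdga) \<Rightarrow> bool" where
  "multiadditive l \<longleftrightarrow> (\<forall>xs f g m ys. l (xs @ (f + g, m) # ys) = l (xs @ (f, m) # ys) + l (xs @ (g, m) # ys))"

definition multisymmetric :: "(('a \<times> int) list \<Rightarrow> 'a::cdga) \<Rightarrow> bool" where
  "multisymmetric l \<longleftrightarrow> (\<forall>xs y z ys. graded [y, z] \<longrightarrow>
     l (xs @ y # z # ys) = ksign (snd y * snd z) (l (xs @ z # y # ys)))"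

lemma cochain_degreeD: "cochain_degree k p \<Longrightarrow> graded zs \<Longrightarrow> p zs \<in> hmg (k - 1 + degs zs)"
  by (simp add: cochain_degree_def)

lemma cochain_degree_Cons:
  "cochain_degree k p \<Longrightarrow> graded [z] \<Longrightarrow> cochain_degree (k + snd z) (\<lambda>x. p (z # x))"
  unfolding cochain_degree_def by (metis add.assoc diff_add_eq degs_simps(2) graded_simps(1,2))

lemma multiadditive_Cons: "multiadditive l \<Longrightarrow> multiadditive (\<lambda>x. l (z # x))"
  unfolding multiadditive_def by (metis append_Cons)

lemma multisymmetric_Cons: "multisymmetric l \<Longrightarrow> multisymmetric (\<lambda>x. l (z # x))"
  unfolding multisymmetric_def by (metis append_Cons)

lemma multiadditive_additive: "multiadditive l \<Longrightarrow> additive (\<lambda>f. l (xs @ (f, m) # ys))"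
  by standard (simp add: multiadditive_def)

lemma multiadditive_simps:
  assumes "multiadditive l"
  shows "l (xs @ (f + g, m) # ys) = l (xs @ (f, m) # ys) + l (xs @ (g, m) # ys)"
    "l (xs @ (f - g, m) # ys) = l (xs @ (f, m) # ys) - l (xs @ (g, m) # ys)"
    "l (xs @ (0, m) # ys) = 0"
    "l (xs @ (ksign k f, m) # ys) = ksign k (l (xs @ (f, m) # ys))"
  using additive_simps[OF multiadditive_additive[OF assms, of xs m ys]] by auto

lemmas multiadditive_single = multiadditive_simps[where xs = "[]" and ys = "[]", unfolded append_Nil]

lemma prelie_left_add: "prelie k (\<lambda>x. l x + l' x) p zs = prelie k l p zs + prelie k l' p zs"
  by (induction zs arbitrary: k l l' p) (simp_all add: ksign_add)

lemma prelie_left_ksign: "prelie k (\<lambda>x. ksign c (l x)) p zs = ksign c (prelie k l p zs)"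
  by (induction zs arbitrary: k l p) (simp_all add: ksign_add add.commute)

lemma prelie_right_add:
  "multiadditive l \<Longrightarrow> prelie k l (\<lambda>x. p x + p' x) zs = prelie k l p zs + prelie k l p' zs"
  by (induction zs arbitrary: k l p p') (simp_all add: ksign_add multiadditive_single multiadditive_Cons)

lemma prelie_right_ksign:
  "multiadditive l \<Longrightarrow> prelie k l (\<lambda>x. ksign c (p x)) zs = ksign c (prelie k l p zs)"
  by (induction zs arbitrary: k l p) (simp_all add: ksign_add multiadditive_single multiadditive_Cons add.commute)

text \<open>The associator only sees the terms in which \<open>p\<close> and \<open>q\<close> are both inserted directly into \<open>l\<close>,
  hence its symmetry.\<close>

definition asc ::
  "int \<Rightarrow> int \<Rightarrow> (('a \<times> int) list \<Rightarrow> 'a::cdga) \<Rightarrow> (('a \<times> int) list \<Rightarrow> 'a) \<Rightarrow> (('a \<times> int) list \<Rightarrow> 'a) \<Rightarrow> ('a \<times> int) list \<Rightarrow> 'a" where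
  "asc kp kq l p q zs = prelie kq (prelie kp l p) q zs - prelie (kp + kq) l (prelie kq p q) zs"

lemma asc_Nil: "asc kp kq l p q [] = ksign (kq * kp) (l [(q [], kq), (p [], kp)])"
  by (simp add: asc_def)

text \<open>The next argument goes to \<open>l\<close>, to \<open>p\<close> or to \<open>q\<close>;
  the terms in which \<open>q\<close> is nested in \<open>p\<close> have cancelled.\<close>

lemma asc_Cons:
  assumes "multiadditive l"
  shows "asc kp kq l p q (z # zs) = ksign (snd z * (kp + kq)) (asc kp kq (\<lambda>x. l (z # x)) p q zs)
    + ksign (snd z * kq) (asc (kp + snd z) kq l (\<lambda>x. p (z # x)) q zs) + asc kp (kq + snd z) l p (\<lambda>x. q (z # x)) zs"
  unfolding asc_def
  by (simp add: prelie_left_add prelie_left_ksign prelie_right_add[OF assms] prelie_right_ksign[OF assms]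
      ksign_add ksign_diff algebra_simps)

lemma add_swap_right: "\<lbrakk>a = a'; b = b'; c = c'\<rbrakk> \<Longrightarrow> a + b + c = a' + c' + (b' :: 'a::ab_group_add)"
  and add_swap_middle: "\<lbrakk>a = a'; b = b'; c = c'; d = d'\<rbrakk> \<Longrightarrow> a + b + (c + d) = a' + c' + (b' + (d' :: 'a))"
  by (simp_all add: algebra_simps)

text \<open>\<open>p\<close> and \<open>q\<close> play the same role in the recursion, so everything
  reduces to the empty list, where symmetry of \<open>l\<close> exchanges the two inserted
  values.\<close>

lemma asc_symmetric:
  assumes "multiadditive l" "multisymmetric l" "cochain_degree kp p" "cochain_degree kq q" "graded zs"
  shows "asc kp kq l p q zs = ksign (kp * kq) (asc kq kp l q p zs)"
  using assms
proof (induction zs arbitrary: kp kq l p q)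
  case Nil
  have "l [(q [], kq), (p [], kp)] = ksign (kq * kp) (l [(p [], kp), (q [], kq)])"
    using Nil(2) cochain_degreeD[OF Nil(3), of "[]"] cochain_degreeD[OF Nil(4), of "[]"]
    unfolding multisymmetric_def by (metis append_Nil degs_simps(1) add_0_right fst_conv snd_conv graded_simps(1,2))
  then show ?case by (simp add: asc_Nil mult.commute)
next
  case (Cons z zs)
  let ?m = "snd z"
  have z: "graded [z]" and zs: "graded zs" using Cons.prems(5) by auto
  note p' = cochain_degree_Cons[OF Cons.prems(3) z] and q' = cochain_degree_Cons[OF Cons.prems(4) z]
  note 1 = Cons.IH[OF multiadditive_Cons[OF Cons.prems(1)] multisymmetric_Cons[OF Cons.prems(2)] Cons.prems(3,4) zs, of z]
  note 2 = Cons.IH[OF Cons.prems(1,2) p' Cons.prems(4) zs]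
  note 3 = Cons.IH[OF Cons.prems(1,2) Cons.prems(3) q' zs]
  show ?case
    unfolding asc_Cons[OF Cons.prems(1)] 1 2 3 ksign_add ksign_ksign
    by (rule add_swap_right; rule ksign_cong) auto
qed

lemma self_minus_eq_0: "x = - x \<Longrightarrow> x = (0 :: 'a::dg_module)"
proof -
  assume "x = - x"
  then have "x + x = 0" by (metis add.left_inverse)
  then have "2 *\<^sub>C x = 0"
    using scaleC_add_left[of 1 1 x] by (simp add: scaleC_one)
  then show ?thesis using complex_vector.scale_eq_0_iff[of 2 x] by (metis zero_neq_numeral)
qed

text \<open>For equal cochains of odd degree the symmetry says that the associator is its own
  negative, hence 0 over the complex numbers.\<close>

lemma bianchi:
  assumes "multiadditive p" "multisymmetric p" "cochain_degree k p" "odd k" "graded zs"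
  shows "prelie k (prelie k p p) p zs = prelie (k + k) p (prelie k p p) zs"
proof -
  have "asc k k p p p zs = - asc k k p p p zs"
    using asc_symmetric[OF assms(1,2,3,3,5)] assms(4) by (simp add: ksign_odd)
  then have "asc k k p p p zs = 0" by (rule self_minus_eq_0)
  then show ?thesis by (simp add: asc_def)
qed

lemma prelie_symmetric:
  assumes "multiadditive l" "multisymmetric l" "multisymmetric p" "graded [y, z]"
  shows "prelie k l p (xs @ y # z # ys) = ksign (snd y * snd z) (prelie k l p (xs @ z # y # ys))"
  using assms
proof (induction xs arbitrary: k l p)
  case Nil
  let ?c = "snd y * snd z"
  have l: "(\<lambda>x. l (y # z # x)) = (\<lambda>x. ksign ?c (l (z # y # x)))"
    and p: "(\<lambda>x. p (y # z # x)) = (\<lambda>x. ksign ?c (p (z # y # x)))"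
    using Nil(2-4) unfolding multisymmetric_def by (metis append_Nil)+
  show ?case
    unfolding append_Nil prelie.simps l p prelie_left_ksign prelie_right_ksign[OF Nil(1)] ksign_add ksign_ksign
    by (rule add_swap_middle; rule ksign_cong) (auto simp: add_ac)
next
  case (Cons x xs)
  show ?case
    using Cons.IH[OF multiadditive_Cons[OF Cons.prems(1), of x] multisymmetric_Cons[OF Cons.prems(2)] Cons.prems(3,4), of k]
      Cons.IH[OF Cons.prems(1,2) multisymmetric_Cons[OF Cons.prems(3), of x] Cons.prems(4), of "k + snd x"]
    by (simp add: ksign_add add.commute)
qed

text \<open>\<open>l\<close> is evaluated on the arguments not given to \<open>p\<close> and one
  inserted value: at most one argument more, and total degree shifted by exactly
  \<open>k\<close>.\<close>

lemma prelie_zero_left: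
  assumes "cochain_degree k p" "graded zs"
    and "\<And>zs'. \<lbrakk>graded zs'; length zs' \<le> Suc (length zs); degs zs' = degs zs + k\<rbrakk> \<Longrightarrow> l zs' = 0"
  shows "prelie k l p zs = 0"
  using assms
proof (induction zs arbitrary: k l p)
  case Nil
  then show ?case using cochain_degreeD[OF Nil(1), of "[]"] by simp
next
  case (Cons z zs)
  have z: "graded [z]" and zs: "graded zs" using Cons.prems(2) by auto
  have "prelie k (\<lambda>x. l (z # x)) p zs = 0"
    using z by (intro Cons.IH Cons.prems zs) auto
  moreover have "prelie (k + snd z) l (\<lambda>x. p (z # x)) zs = 0"
    by (intro Cons.IH cochain_degree_Cons Cons.prems z zs) auto
  ultimately show ?case by simp
qed

text \<open>When the constant value of \<open>p\<close> is 0, an insertion that counts consumes at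
  least one argument, so \<open>l\<close> never sees more arguments than were given.\<close>

lemma prelie_zero_left':
  assumes "cochain_degree k p" "p [] = 0" "multiadditive l" "graded zs"
    and "\<And>zs'. \<lbrakk>graded zs'; length zs' \<le> length zs; degs zs' = degs zs + k\<rbrakk> \<Longrightarrow> l zs' = 0"
  shows "prelie k l p zs = 0"
  using assms
proof (induction zs arbitrary: l)
  case Nil
  then show ?case by (simp add: multiadditive_single)
next
  case (Cons z zs)
  have z: "graded [z]" and zs: "graded zs" using Cons.prems(4) by auto
  have "prelie k (\<lambda>x. l (z # x)) p zs = 0"
    using z by (intro Cons.IH multiadditive_Cons Cons.prems zs) auto
  moreover have "prelie (k + snd z) l (\<lambda>x. p (z # x)) zs = 0"
    by (intro prelie_zero_left cochain_degree_Cons Cons.prems z zs) auto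
  ultimately show ?case by simp
qed

lemma prelie_zero_right:
  assumes "multiadditive l" "graded zs"
    and "\<And>zs'. \<lbrakk>graded zs'; length zs' \<le> length zs\<rbrakk> \<Longrightarrow> p zs' = 0"
  shows "prelie k l p zs = 0"
  using assms
  by (induction zs arbitrary: k l p) (simp_all add: multiadditive_single multiadditive_Cons)

text \<open>Only the term handing all arguments to \<open>p\<close> survives. With the unary part of
  \<open>l\<close> equal to \<delta>, a composition turns into \<delta> of a value.\<close>

lemma prelie_last:
  assumes "multiadditive l" "graded zs"
    and "\<And>zs'. \<lbrakk>graded zs'; length zs' < length zs\<rbrakk> \<Longrightarrow> p zs' = 0"
  shows "prelie k l p zs = l [(p zs, k + degs zs)]"
  using assms
proof (induction zs arbitrary: k p)
  case (Cons z zs)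
  have "prelie k (\<lambda>x. l (z # x)) p zs = 0"
    using Cons.prems by (intro prelie_zero_right multiadditive_Cons) auto
  moreover have "prelie (k + snd z) l (\<lambda>x. p (z # x)) zs = l [(p (z # zs), k + snd z + degs zs)]"
    using Cons.prems by (intro Cons.IH) auto
  ultimately show ?case by (simp add: add.assoc)
qed simp

section \<open>Multivectors as cochains\<close>

definition right_linear :: "('a::cdga kaehler \<Rightarrow> 'a) \<Rightarrow> bool" where
  "right_linear P \<longleftrightarrow> (\<forall>x y. P (x + y) = P x + P y) \<and> (\<forall>c x. P (c *\<^sub>C x) = c *\<^sub>C P x) \<and>
     (\<forall>x a. P (x * inc a) = P x * a)"

definition map_degree :: "int \<Rightarrow> ('a::cdga kaehler \<Rightarrow> 'a) \<Rightarrow> bool" where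
  "map_degree k P \<longleftrightarrow> (\<forall>n. \<forall>x\<in>hmg n. P x \<in> hmg (k + n))"

lemma right_linearD:
  assumes "right_linear P"
  shows "P (x + y) = P x + P y" "P (c *\<^sub>C x) = c *\<^sub>C P x" "P (x * inc a) = P x * a" "P 0 = 0" "P (- x) = - P x"
    "P (ksign k x) = ksign k (P x)" "P (x - y) = P x - P y"
proof -
  show *: "P (x + y) = P x + P y" "P (c *\<^sub>C x) = c *\<^sub>C P x" "P (x * inc a) = P x * a" for x y c a
    using assms by (auto simp: right_linear_def)
  interpret additive P by standard (rule *)
  show "P 0 = 0" "P (- x) = - P x" "P (x - y) = P x - P y" by (fact zero minus diff)+
  then show "P (ksign k x) = ksign k (P x)" by (simp add: ksign_def)
qed

definition dprod :: "('a::cdga \<times> int) list \<Rightarrow> 'a kaehler" where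
  "dprod zs = prod_list (map (\<lambda>z. \<d> (fst z)) zs)"

lemma dprod_simps [simp]: "dprod [] = 1" "dprod (z # zs) = \<d> (fst z) * dprod zs" "dprod (xs @ ys) = dprod xs * dprod ys"
  by (simp_all add: dprod_def)

lemma dprod_hmg: "graded zs \<Longrightarrow> dprod zs \<in> hmg (degs zs)"
  using hmg_kaehler_closed(8) by (induction zs) (fastforce intro: hmg_one hmg_mult)+

abbreviation cochain :: "('a::cdga kaehler \<Rightarrow> 'a) \<Rightarrow> ('a \<times> int) list \<Rightarrow> 'a" where
  "cochain P \<equiv> \<lambda>zs. P (dprod zs)"

lemma kd_hmg: "graded [z] \<Longrightarrow> \<d> (fst z) \<in> hmg (snd z)"
  using hmg_kaehler_closed(8)[of "fst z" "snd z - 1"] by simp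

lemma multiadditive_cochain: "right_linear P \<Longrightarrow> multiadditive (cochain P)"
  by (simp add: multiadditive_def kd_kaehler right_linearD distrib_left distrib_right)

lemma multisymmetric_cochain: "right_linear P \<Longrightarrow> multisymmetric (cochain P)"
proof -
  assume P: "right_linear P"
  have "dprod (xs @ y # z # ys) = ksign (snd y * snd z) (dprod (xs @ z # y # ys))" if "graded [y, z]" for xs y z ys
  proof -
    have "\<d> (fst y) * \<d> (fst z) = ksign (snd y * snd z) (\<d> (fst z) * \<d> (fst y))"
      using that by (intro graded_commute kd_hmg) auto
    then show ?thesis
      by (simp flip: mult.assoc)
  qed
  then show ?thesis unfolding multisymmetric_def by (metis right_linearD(6)[OF P])
qed

lemma cochain_degree_cochain: "map_degree (k - 1) P \<Longrightarrow> cochain_degree k (cochain P)"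
  by (auto simp: cochain_degree_def map_degree_def dest: dprod_hmg)

lemma right_linear_contract: "right_linear P \<Longrightarrow> right_linear (\<lambda>x. P (y * x))"
  by (simp add: right_linear_def distrib_left kaehler_rules flip: mult.assoc)

lemma map_degree_contract: "map_degree k P \<Longrightarrow> y \<in> hmg m \<Longrightarrow> map_degree (k + m) (\<lambda>x. P (y * x))"
  unfolding map_degree_def by (auto simp: add.assoc intro: hmg_mult)

lemma prelie_cochain_Cons:
  "prelie k (cochain L) (cochain P) (z # zs) =
     ksign (snd z * k) (prelie k (cochain (\<lambda>x. L (\<d> (fst z) * x))) (cochain P) zs)
     + prelie (k + snd z) (cochain L) (cochain (\<lambda>x. P (\<d> (fst z) * x))) zs"
  by simp

lemma prelie_last_linear:
  assumes "right_linear L" "right_linear P"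
  shows "prelie k (cochain L) (cochain P) (zs @ [(f + g, m)]) =
      prelie k (cochain L) (cochain P) (zs @ [(f, m)]) + prelie k (cochain L) (cochain P) (zs @ [(g, m)])"
    and "prelie k (cochain L) (cochain P) (zs @ [(c *\<^sub>C f, m)]) =
      c *\<^sub>C prelie k (cochain L) (cochain P) (zs @ [(f, m)])"
  using assms
proof (induction zs arbitrary: k L P)
  case Nil
  {
    case 1
    then show ?case
      by (simp add: kd_kaehler right_linearD distrib_right ksign_add algebra_simps)
  next
    case 2
    then show ?case
      by (simp add: kd_kaehler right_linearD kaehler_rules scaleC_add_right)
  }
next
  case (Cons z zs)
  {
    case 1
    show ?case
      unfolding append_Cons prelie_cochain_Cons
        Cons.IH(1)[OF right_linear_contract[OF 1(1)] 1(2)] Cons.IH(1)[OF 1(1) right_linear_contract[OF 1(2)]]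
      by (simp add: ksign_add algebra_simps)
  next
    case 2
    show ?case
      unfolding append_Cons prelie_cochain_Cons
        Cons.IH(2)[OF right_linear_contract[OF 2(1)] 2(2)] Cons.IH(2)[OF 2(1) right_linear_contract[OF 2(2)]]
      by (simp add: scaleC_add_right)
  }
qed

lemma kd_mult_right:
  assumes "a \<in> hmg m" "b \<in> hmg n"
  shows "\<d> (a * b) = \<d> a * inc b + ksign (m * n) (\<d> b * inc a)"
proof -
  have "inc a * \<d> b = ksign (m * (n + 1)) (\<d> b * inc a)"
    using assms by (intro graded_commute hmg_kaehler_closed)
  then show ?thesis
    by (simp add: kd_kaehler(3)[OF assms(1)]) (rule ksign_cong, auto)
qed

text \<open>Neither half is a derivation in the last argument: inserting a product produces cross terms
  \<open>L(da) P(db)\<close>, which cancel only in the bracket.\<close>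

definition bracket ::
  "int \<Rightarrow> int \<Rightarrow> ('a::cdga kaehler \<Rightarrow> 'a) \<Rightarrow> ('a kaehler \<Rightarrow> 'a) \<Rightarrow> ('a \<times> int) list \<Rightarrow> 'a" where
  "bracket kl kp L P zs =
     prelie kp (cochain L) (cochain P) zs - ksign (kl * kp) (prelie kl (cochain P) (cochain L) zs)"

lemma bracket_Cons:
  "bracket kl kp L P (z # zs) =
     ksign (snd z * kp) (bracket (kl + snd z) kp (\<lambda>x. L (\<d> (fst z) * x)) P zs)
     + bracket kl (kp + snd z) L (\<lambda>x. P (\<d> (fst z) * x)) zs"
  unfolding bracket_def prelie_cochain_Cons ksign_add ksign_diff ksign_ksign
  by (simp add: algebra_simps) (simp add: ksign_def)

text \<open>The cross terms arise where d meets the scalars of the inner value: the differential of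
  \<open>P(da) b\<close> contains \<open>db P(da)\<close> up to sign, on which right-linear
  \<open>L\<close> gives \<open>L(db) P(da)\<close>, and likewise with \<open>a\<close> and
  \<open>b\<close> exchanged.\<close>

lemma prelie_single:
  assumes L: "right_linear L" and P: "right_linear P" "map_degree (k - 1) P" and a: "a \<in> hmg m" and b: "b \<in> hmg n"
  shows "prelie k (cochain L) (cochain P) [(a * b, m + n + 1)] =
    prelie k (cochain L) (cochain P) [(a, m + 1)] * b + ksign (m * n) (prelie k (cochain L) (cochain P) [(b, n + 1)] * a)
    + ksign (n * (k + m)) (L (\<d> b) * P (\<d> a)) + ksign (m * k) (L (\<d> a) * P (\<d> b))"
proof -
  have P1: "P 1 \<in> hmg (k - 1)" and Pa: "P (\<d> a) \<in> hmg (k + m)" and Pb: "P (\<d> b) \<in> hmg (k + n)"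
    using P(2) hmg_one hmg_kaehler_closed(8)[OF a] hmg_kaehler_closed(8)[OF b]
    unfolding map_degree_def by fastforce+
  have dP1: "\<d> (P 1) \<in> hmg k" using hmg_kaehler_closed(8)[OF P1] by simp
  have c: "inc b * \<d> (P 1) = ksign (n * k) (\<d> (P 1) * inc b)" "inc a * \<d> (P 1) = ksign (m * k) (\<d> (P 1) * inc a)"
    by (intro graded_commute hmg_kaehler_closed a b dP1)+
  have 1: "L (\<d> (a * b) * \<d> (P 1)) = ksign (n * k) (L (\<d> a * \<d> (P 1)) * b) + ksign (m * n + m * k) (L (\<d> b * \<d> (P 1)) * a)"
    unfolding kd_mult_right[OF a b]
    by (simp add: distrib_right mult.assoc c right_linearD[OF L]) (simp add: right_linearD(3)[OF L] flip: mult.assoc)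
  have 2: "P (\<d> (a * b)) = P (\<d> a) * b + ksign (m * n) (P (\<d> b) * a)"
    unfolding kd_mult_right[OF a b] by (simp add: right_linearD[OF P(1)])
  have k: "\<d> (ksign c x) = ksign c (\<d> x)" for c and x :: 'a
    using kd_kaehler(2)[of "-1" x] by (simp add: ksign_def)
  have 3: "L (\<d> (P (\<d> (a * b)))) = L (\<d> (P (\<d> a))) * b + ksign ((k + m) * n) (L (\<d> b) * P (\<d> a))
      + ksign (m * n) (L (\<d> (P (\<d> b))) * a + ksign ((k + n) * m) (L (\<d> a) * P (\<d> b)))"
    unfolding 2 kd_kaehler(1) k kd_mult_right[OF Pa b] kd_mult_right[OF Pb a]
    by (simp add: right_linearD[OF L])
  have s: "ksign ((m + n + 1) * k) (ksign (n * k) x) = ksign ((m + 1) * k) x"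
    "ksign ((m + n + 1) * k) (ksign (m * n + m * k) x) = ksign (m * n + (n + 1) * k) x"
    "ksign (m * n) (ksign ((k + n) * m) x) = ksign (m * k) x" for x :: 'a
    unfolding ksign_ksign by (rule ksign_cong, auto)+
  show ?thesis
    by (simp add: 1 3) (simp add: ksign_add s mult.commute[of n] distrib_right algebra_simps del: ksign_ksign,
        simp, intro arg_cong2[of _ _ _ _ "(+)"] ksign_cong; auto)
qed

lemma bracket_derivation:
  assumes "right_linear L" "right_linear P" "map_degree (kl - 1) L" "map_degree (kp - 1) P" "graded zs"
    and a: "a \<in> hmg m" and b: "b \<in> hmg n"
  shows "bracket kl kp L P (zs @ [(a * b, m + n + 1)]) =
    bracket kl kp L P (zs @ [(a, m + 1)]) * b + ksign (m * n) (bracket kl kp L P (zs @ [(b, n + 1)]) * a)"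
  using assms(1-5)
proof (induction zs arbitrary: kl kp L P)
  case Nil
  have d: "L (\<d> a) \<in> hmg (kl + m)" "P (\<d> a) \<in> hmg (kp + m)" "L (\<d> b) \<in> hmg (kl + n)" "P (\<d> b) \<in> hmg (kp + n)"
    using Nil(3,4) hmg_kaehler_closed(8)[OF a] hmg_kaehler_closed(8)[OF b]
    unfolding map_degree_def by fastforce+
  have c: "P (\<d> b) * L (\<d> a) = ksign ((kp + n) * (kl + m)) (L (\<d> a) * P (\<d> b))"
    "P (\<d> a) * L (\<d> b) = ksign ((kp + m) * (kl + n)) (L (\<d> b) * P (\<d> a))"
    by (intro graded_commute d)+
  \<comment> \<open>Each cross term of one half becomes a cross term of the other half after
    commuting its two values.\<close>
  have s: "ksign (kl * kp) (ksign (n * (kl + m)) (P (\<d> b) * L (\<d> a))) = ksign (m * kp) (L (\<d> a) * P (\<d> b))"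
    "ksign (kl * kp) (ksign (m * kl) (P (\<d> a) * L (\<d> b))) = ksign (n * (kp + m)) (L (\<d> b) * P (\<d> a))"
    unfolding c ksign_ksign by (rule ksign_cong, auto)+
  show ?case
    unfolding bracket_def append_Nil prelie_single[OF Nil(1,2,4) a b] prelie_single[OF Nil(2,1,3) a b] ksign_add s
    by (simp add: algebra_simps ksign_diff)
next
  case (Cons z zs)
  have z: "graded [z]" and zs: "graded zs" using Cons.prems(5) by auto
  have "map_degree (kl + snd z - 1) (\<lambda>x. L (\<d> (fst z) * x))" "map_degree (kp + snd z - 1) (\<lambda>x. P (\<d> (fst z) * x))"
    using map_degree_contract[OF Cons.prems(3) kd_hmg[OF z]] map_degree_contract[OF Cons.prems(4) kd_hmg[OF z]]
    by (simp_all add: algebra_simps)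
  note d = this
  show ?case
    unfolding append_Cons bracket_Cons
      Cons.IH[OF right_linear_contract[OF Cons.prems(1)] Cons.prems(2) d(1) Cons.prems(4) zs]
      Cons.IH[OF Cons.prems(1) right_linear_contract[OF Cons.prems(2)] Cons.prems(3) d(2) zs]
    by (simp add: ksign_add distrib_right algebra_simps)
qed

text \<open>Linearity and the Leibniz rule are required in the last argument only: there the scalar
  split off leaves to the right without crossing other arguments, and the symmetry clause transports
  the rule to every position.\<close>

definition multiderivation :: "(('a \<times> int) list \<Rightarrow> 'a::cdga) \<Rightarrow> bool" where
  "multiderivation c \<longleftrightarrow>
     (\<forall>xs y z ys. graded [y, z] \<longrightarrow> c (xs @ y # z # ys) = ksign (snd y * snd z) (c (xs @ z # y # ys))) \<and>
     (\<forall>zs f g m. c (zs @ [(f + g, m)]) = c (zs @ [(f, m)]) + c (zs @ [(g, m)])) \<and>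
     (\<forall>zs b f m. c (zs @ [(b *\<^sub>C f, m)]) = b *\<^sub>C c (zs @ [(f, m)])) \<and>
     (\<forall>zs a b m n. graded zs \<longrightarrow> a \<in> hmg m \<longrightarrow> b \<in> hmg n \<longrightarrow>
        c (zs @ [(a * b, m + n + 1)]) = c (zs @ [(a, m + 1)]) * b + ksign (m * n) (c (zs @ [(b, n + 1)]) * a))"

lemma multiderivation_swap:
  "multiderivation c \<Longrightarrow> graded [y, z] \<Longrightarrow> c (xs @ y # z # ys) = ksign (snd y * snd z) (c (xs @ z # y # ys))"
  unfolding multiderivation_def by blast

lemma multiderivation_cochain:
  assumes "right_linear P" shows "multiderivation (cochain P)"
proof -
  have "P (dprod (zs @ [(a * b, m + n + 1)])) = P (dprod (zs @ [(a, m + 1)])) * b + ksign (m * n) (P (dprod (zs @ [(b, n + 1)])) * a)"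
    if "a \<in> hmg m" "b \<in> hmg n" for zs a b m n
    by (simp add: kd_mult_right[OF that] right_linearD[OF assms] distrib_left)
      (simp add: right_linearD(3)[OF assms] flip: mult.assoc)
  moreover have "P (dprod (zs @ [(f + g, m)])) = P (dprod (zs @ [(f, m)])) + P (dprod (zs @ [(g, m)]))"
    "P (dprod (zs @ [(b *\<^sub>C f, m)])) = b *\<^sub>C P (dprod (zs @ [(f, m)]))" for zs f g m b
    by (simp_all add: kd_kaehler right_linearD[OF assms] distrib_left kaehler_rules)
  ultimately show ?thesis
    using multisymmetric_cochain[OF assms] unfolding multiderivation_def multisymmetric_def by blast
qed

text \<open>For odd \<open>k\<close> the bracket of \<open>P\<close> with itself is twice the
  composition, so the Leibniz rule of the bracket can be halved.\<close>

lemma multiderivation_prelie: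
  assumes P: "right_linear P" "map_degree (k - 1) P" and k: "odd k"
  shows "multiderivation (prelie k (cochain P) (cochain P))"
proof -
  let ?c = "prelie k (cochain P) (cochain P)"
  have two: "x + x = y + y \<Longrightarrow> x = y" for x y :: 'a
  proof -
    assume "x + x = y + y"
    then have "x - y = - (x - y)" by (metis add_diff_cancel_left' add_diff_eq diff_diff_eq2 minus_diff_eq)
    then have "x - y = 0" by (rule self_minus_eq_0)
    then show "x = y" by simp
  qed
  have b: "bracket k k P P zs = ?c zs + ?c zs" for zs
    unfolding bracket_def using k by (simp add: ksign_odd)
  have "?c (zs @ [(a * b, m + n + 1)]) = ?c (zs @ [(a, m + 1)]) * b + ksign (m * n) (?c (zs @ [(b, n + 1)]) * a)"
    if "graded zs" "a \<in> hmg m" "b \<in> hmg n" for zs a b m n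
    using bracket_derivation[OF P(1,1,2,2) that] unfolding b
    by - (rule two, simp add: distrib_right ksign_add algebra_simps)
  moreover have "?c (xs @ y # z # ys) = ksign (snd y * snd z) (?c (xs @ z # y # ys))" if "graded [y, z]" for xs y z ys
    by (intro prelie_symmetric multiadditive_cochain multisymmetric_cochain P that)
  ultimately show ?thesis
    unfolding multiderivation_def using prelie_last_linear[OF P(1,1)] by blast
qed

context polynomial
begin

definition gens :: "nat list \<Rightarrow> ('a \<times> int) list" where
  "gens is = map (\<lambda>i. (u i, e i + 1)) is"

lemma gens_simps [simp]: "gens [] = []" "gens (i # is) = (u i, e i + 1) # gens is" "gens (xs @ ys) = gens xs @ gens ys"
  "length (gens is) = length is" "degs (gens is) = dg is"
  by (simp_all add: gens_def degs_def dg_def comp_def)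

lemma graded_gens: "set is \<subseteq> {..<r} \<Longrightarrow> graded (gens is)"
  by (induction "is") (auto simp: u_hmg)

text \<open>Arguments are rotated one by one to the end, expanded there into generators, and kept as
  generators. The bound \<open>n\<close> is respected throughout, which is what makes an induction
  on total degree possible.\<close>

lemma multiderivation_zero:
  assumes c: "multiderivation c"
    and gen: "\<And>is. \<lbrakk>set is \<subseteq> {..<r}; length is = s; dg is \<le> n\<rbrakk> \<Longrightarrow> c (gens is) = 0"
    and zs: "graded zs" "length zs = s" "degs zs \<le> n"
  shows "c zs = 0"
proof -
  have swap: "graded [y, z] \<Longrightarrow> c (xs @ y # z # ys) = ksign (snd y * snd z) (c (xs @ z # y # ys))"
    and add: "c (zs @ [(f + g, m)]) = c (zs @ [(f, m)]) + c (zs @ [(g, m)])"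
    and scale: "c (zs @ [(b *\<^sub>C f, m)]) = b *\<^sub>C c (zs @ [(f, m)])"
    and der: "graded zs \<Longrightarrow> a \<in> hmg k \<Longrightarrow> f \<in> hmg l \<Longrightarrow>
        c (zs @ [(a * f, k + l + 1)]) = c (zs @ [(a, k + 1)]) * f + ksign (k * l) (c (zs @ [(f, l + 1)]) * a)"
    for xs y z ys zs f g m b a k l
    using c unfolding multiderivation_def by blast+
  have rot: "c (xs @ y # ws) = 0" if "graded (y # ws)" "c (xs @ ws @ [y]) = 0" for xs y ws
    using that
  proof (induction ws arbitrary: xs)
    case (Cons w ws)
    have "c ((xs @ [w]) @ y # ws) = 0" using Cons by (intro Cons.IH) auto
    then show ?case using swap[of y w xs ws] Cons.prems by simp
  qed simp
  have "c (zs @ gens is) = 0"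
    if "graded zs" "set is \<subseteq> {..<r}" "length zs + length is = s" "degs zs + dg is \<le> n" for zs "is"
    using that
  proof (induction zs arbitrary: "is")
    case Nil
    then show ?case using gen by simp
  next
    case (Cons z zs)
    obtain f m where z: "z = (f, m)" by fastforce
    define ws where "ws = zs @ gens is"
    have ws: "graded ws" using Cons.prems graded_gens by (simp add: ws_def)
    have "f \<in> hmg (m - 1)" using Cons.prems(1) z by simp
    then have "c (ws @ [(f, m - 1 + 1)]) = 0"
    proof (induction rule: poly_induct[where Q = "\<lambda>f n. c (ws @ [(f, n + 1)]) = 0"])
      case (zero n)
      then show ?case using scale[of ws 0 0 "n + 1"] by simp
    next
      case one
      then show ?case using der[OF ws hmg_one hmg_one] by simp
    next
      case (gen i)
      \<comment> \<open>The generator has at most the degree of the argument it replaces, so the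
        total degree stays within \<open>n\<close>.\<close>
      have "c (zs @ gens (is @ [i])) = 0"
        using Cons.prems gen z by (intro Cons.IH) auto
      then show ?case by (simp add: ws_def)
    qed (simp_all add: add scale der[OF ws])
    then show ?case
      using rot[of z "zs @ gens is" "[]"] Cons.prems graded_gens by (simp add: ws_def z)
  qed
  from this[of zs "[]"] show ?thesis using zs by simp
qed

end

lemma multiadditive_prelie:
  assumes "multiadditive l" "multiadditive p"
  shows "multiadditive (prelie k l p)"
  unfolding multiadditive_def
proof (intro allI)
  fix xs f g m ys
  show "prelie k l p (xs @ (f + g, m) # ys) = prelie k l p (xs @ (f, m) # ys) + prelie k l p (xs @ (g, m) # ys)"
    using assms
  proof (induction xs arbitrary: k l p)
    case Nil
    have "(\<lambda>x. l ((f + g, m) # x)) = (\<lambda>x. l ((f, m) # x) + l ((g, m) # x))"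
      "(\<lambda>x. p ((f + g, m) # x)) = (\<lambda>x. p ((f, m) # x) + p ((g, m) # x))"
      using Nil unfolding multiadditive_def by (metis append_Nil)+
    then show ?case
      by (simp add: prelie_left_add prelie_right_add[OF Nil(1)] ksign_add algebra_simps)
  next
    case (Cons x xs)
    show ?case
      using Cons.IH[OF multiadditive_Cons[OF Cons.prems(1), of x] Cons.prems(2), of k]
        Cons.IH[OF Cons.prems(1) multiadditive_Cons[OF Cons.prems(2), of x], of "k + snd x"]
      by (simp add: ksign_add algebra_simps)
  qed
qed

lemma cochain_degree_prelie:
  assumes "cochain_degree kl l" "cochain_degree k p"
  shows "cochain_degree (kl + k) (prelie k l p)"
  unfolding cochain_degree_def
proof (intro allI impI)
  fix zs :: "('a \<times> int) list"
  assume "graded zs"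
  then show "prelie k l p zs \<in> hmg (kl + k - 1 + degs zs)"
    using assms
  proof (induction zs arbitrary: kl k l p)
    case Nil
    then have "graded [(p [], k)]" using cochain_degreeD[OF Nil(3), of "[]"] by simp
    from cochain_degreeD[OF Nil(2) this] show ?case by (simp add: algebra_simps)
  next
    case (Cons z zs)
    have z: "graded [z]" and zs: "graded zs" using Cons.prems(1) by auto
    show ?case
      using Cons.IH[OF zs cochain_degree_Cons[OF Cons.prems(2) z] Cons.prems(3)]
        Cons.IH[OF zs Cons.prems(2) cochain_degree_Cons[OF Cons.prems(3) z]]
      by (auto simp: algebra_simps intro!: hmg_add hmg_ksign)
  qed
qed

section \<open>Symmetric choices\<close>

context polynomial
begin

definition passing :: "nat \<Rightarrow> nat list \<Rightarrow> int" where
  "passing z bs = (\<Sum>b\<leftarrow>bs. if b < z then (e z + 1) * (e b + 1) else 0)"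

primrec sort_sign :: "nat list \<Rightarrow> int" where
  "sort_sign [] = 0"
| "sort_sign (i # is) = passing i is + sort_sign is"

lemma passing_cong: "mset as = mset bs \<Longrightarrow> passing z as = passing z bs"
  unfolding passing_def sum_mset_sum_list[symmetric] mset_map by simp

lemma sort_sign_swap:
  "i \<noteq> j \<Longrightarrow> even (sort_sign (xs @ i # j # ys)) = even (sort_sign (xs @ j # i # ys) + (e i + 1) * (e j + 1))"
proof (induction xs)
  case Nil
  then show ?case by (auto simp: passing_def)
next
  case (Cons x xs)
  have "passing x (xs @ i # j # ys) = passing x (xs @ j # i # ys)" by (rule passing_cong) simp
  moreover have "even (sort_sign (xs @ i # j # ys)) = even (sort_sign (xs @ j # i # ys) + (e i + 1) * (e j + 1))"
    by (rule Cons)+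
  ultimately show ?case
    unfolding append_Cons sort_sign.simps even_add by argo
qed

text \<open>The value is chosen on sorted lists and transported with the sorting sign; a list in which an
  index with odd \<open>du\<^sub>i\<close> is repeated must get the value \<open>0\<close>, which is admissible by averaging.\<close>

lemma symmetric_choice:
  assumes swap: "\<And>xs i j ys y. T (xs @ i # j # ys) y \<Longrightarrow> T (xs @ j # i # ys) (ksign ((e i + 1) * (e j + 1)) y)"
    and average: "\<And>is y. T is y \<Longrightarrow> T is (- y) \<Longrightarrow> T is 0"
    and ex: "\<And>is. \<exists>y. T is y"
  shows "\<exists>w :: nat list \<Rightarrow> 'a. wSym w \<and> (\<forall>is. T is (w is))"
proof -
  have swap_iff: "T (xs @ i # j # ys) y \<longleftrightarrow> T (xs @ j # i # ys) (ksign ((e i + 1) * (e j + 1)) y)" for xs i j ys y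
  proof
    assume "T (xs @ j # i # ys) (ksign ((e i + 1) * (e j + 1)) y)"
    from swap[OF this] show "T (xs @ i # j # ys) y"
      by (simp add: mult.commute[of "e j + 1"] ksign_even del: ksign_ksign) (simp add: ksign_def split: if_splits)
  qed (rule swap)
  have ins: "T (xs @ insort z bs) y \<longleftrightarrow> T (xs @ z # bs) (ksign (passing z bs) y)" if "sorted bs" for xs z bs y
    using that
  proof (induction bs arbitrary: xs y)
    case Nil
    then show ?case by (simp add: passing_def)
  next
    case (Cons b bs)
    show ?case
    proof (cases "z \<le> b")
      case True
      have "passing z (b # bs) = 0"
      proof -
        have "map (\<lambda>b. if b < z then (e z + 1) * (e b + 1) else 0) (b # bs) = map (\<lambda>_. 0) (b # bs)"
          using True Cons.prems by auto
        then show ?thesis unfolding passing_def by (simp only: sum_list_0)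
      qed
      then show ?thesis using True by simp
    next
      case False
      then have "T (xs @ insort z (b # bs)) y \<longleftrightarrow> T ((xs @ [b]) @ z # bs) (ksign (passing z bs) y)"
        using Cons.IH[of "xs @ [b]" y] Cons.prems by simp
      also have "\<dots> \<longleftrightarrow> T (xs @ z # b # bs) (ksign (passing z (b # bs)) y)"
        using False swap_iff[of xs b z bs "ksign (passing z bs) y"] by (simp add: passing_def mult.commute)
      finally show ?thesis .
    qed
  qed
  have "T (xs @ sort zs) y \<longleftrightarrow> T (xs @ zs) (ksign (sort_sign zs) y)" for xs zs y
  proof (induction zs arbitrary: xs y)
    case (Cons z zs)
    have "T (xs @ sort (z # zs)) y \<longleftrightarrow> T ((xs @ [z]) @ sort zs) (ksign (passing z zs) y)"
      using ins[of "sort zs" xs z y] passing_cong[of "sort zs" zs z] by simp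
    then show ?case using Cons.IH[of "xs @ [z]" "ksign (passing z zs) y"] by (simp add: add.commute)
  qed simp
  from this[of "[]"] have sort: "T (sort zs) y \<longleftrightarrow> T zs (ksign (sort_sign zs) y)" for zs y by simp
  define odd_rep where "odd_rep is \<longleftrightarrow> (\<exists>i. odd (e i + 1) \<and> 2 \<le> count (mset is) i)" for "is"
  define w where "w is = (if odd_rep is then 0 else ksign (sort_sign is) (SOME y. T (sort is) y))" for "is"
  have "T is (w is)" for "is"
  proof (cases "odd_rep is")
    case False
    have "T (sort is) (SOME y. T (sort is) y)" by (rule someI_ex[OF ex])
    then show ?thesis using False unfolding w_def sort by simp
  next
    case True
    then obtain i where i: "odd (e i + 1)" "2 \<le> count (mset is) i" by (auto simp: odd_rep_def)
    then have "{#i, i#} \<subseteq># mset is"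
      by (auto simp: subseteq_mset_def)
    then obtain M where "mset is = {#i, i#} + M" by (auto simp: mset_subset_eq_exists_conv)
    moreover obtain rest where "mset rest = M" using ex_mset by blast
    ultimately have m: "mset is = mset (i # i # rest)" by simp
    obtain y where y: "T (i # i # rest) y" using ex by blast
    then have "T (i # i # rest) (- y)"
      using swap[of "[]" i i rest y] i(1) by (simp add: ksign_odd)
    with y have "T (i # i # rest) 0" by (rule average)
    then have "T (sort (i # i # rest)) 0" using sort[of "i # i # rest" 0] by simp
    moreover have "sort (i # i # rest) = sort is" using m by (metis sorted_list_of_multiset_mset)
    ultimately have "T (sort is) 0" by simp
    then show ?thesis using sort[of "is" 0] True by (simp add: w_def)
  qed
  moreover have "wSym w"
  proof (rule wSymI)
    fix xs ys :: "nat list" and i j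
    let ?a = "xs @ i # j # ys" and ?b = "xs @ j # i # ys"
    have m: "mset ?a = mset ?b" by simp
    then have "odd_rep ?a = odd_rep ?b" and "sort ?a = sort ?b"
      by (simp_all only: odd_rep_def) (metis sorted_list_of_multiset_mset)
    note * = this
    show "w ?a = ksign ((e i + 1) * (e j + 1)) (w ?b)"
    proof (cases "i = j")
      case True
      show ?thesis
      proof (cases "odd (e i + 1)")
        case odd: True
        then have "odd_rep ?a" unfolding odd_rep_def using True by (intro exI[of _ i]) simp
        then show ?thesis using True by (simp add: w_def)
      next
        case False
        then show ?thesis using True by (simp add: ksign_even)
      qed
    next
      case False
      show ?thesis
        unfolding w_def * by (auto simp: sort_sign_swap[OF False] simp del: sort_sign.simps intro!: ksign_cong)
    qed
  qed
  ultimately show ?thesis by blast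
qed

end

section \<open>Lifting the Poisson bracket\<close>

locale poisson_resolution = polynomial r u e
  for r :: nat and u :: "nat \<Rightarrow> 'a::cdga" and e +
  fixes br :: "'o::cdga \<Rightarrow> 'o \<Rightarrow> 'o" and \<epsilon> :: "'a \<Rightarrow> 'o"
  assumes conc: "concentrated_in_degree_0 TYPE('o)" and poisson: "poisson_structure br"
    and eps_hom: "cdga_hom \<epsilon>" and eps_quasi_iso: "quasi_iso \<epsilon>"
begin

lemma eps_dg_hom: "dg_hom \<epsilon>"
  using eps_hom by (simp add: cdga_hom_def)

lemma eps_simps:
  "\<epsilon> (x + y) = \<epsilon> x + \<epsilon> y" "\<epsilon> (c *\<^sub>C x) = c *\<^sub>C \<epsilon> x" "\<epsilon> (x * y) = \<epsilon> x * \<epsilon> y" "\<epsilon> (\<delta> x) = 0" "\<epsilon> 0 = 0"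
  "\<epsilon> (- x) = - \<epsilon> x" "\<epsilon> (ksign k x) = ksign k (\<epsilon> x)" "\<epsilon> 1 = 1" "\<epsilon> (x - y) = \<epsilon> x - \<epsilon> y"
proof -
  show *: "\<epsilon> (x + y) = \<epsilon> x + \<epsilon> y" "\<epsilon> (c *\<^sub>C x) = c *\<^sub>C \<epsilon> x" "\<epsilon> (x * y) = \<epsilon> x * \<epsilon> y" "\<epsilon> 1 = 1" for x y c
    using eps_hom by (auto simp: cdga_hom_def dg_hom_def)
  interpret additive \<epsilon> by standard (rule *)
  show "\<epsilon> 0 = 0" "\<epsilon> (- x) = - \<epsilon> x" "\<epsilon> (x - y) = \<epsilon> x - \<epsilon> y" by (fact zero minus diff)+
  then show "\<epsilon> (ksign k x) = ksign k (\<epsilon> x)" by (simp add: ksign_def)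
  show "\<epsilon> (\<delta> x) = 0"
    using eps_dg_hom concentrated_in_degree_0D(2)[OF conc] by (auto simp: dg_hom_def)
qed

lemma eps_hmg: "x \<in> hmg n \<Longrightarrow> n \<noteq> 0 \<Longrightarrow> \<epsilon> x = 0"
  using eps_dg_hom conc unfolding dg_hom_def concentrated_in_degree_0_def by blast

lemmas poisson_conj =
  poisson[unfolded poisson_structure_def, THEN conjunct1, rule_format]
  poisson[unfolded poisson_structure_def, THEN conjunct2, THEN conjunct1, rule_format]
  poisson[unfolded poisson_structure_def, THEN conjunct2, THEN conjunct2, THEN conjunct1, rule_format]
  poisson[unfolded poisson_structure_def, THEN conjunct2, THEN conjunct2, THEN conjunct2, THEN conjunct1, rule_format]
  poisson[unfolded poisson_structure_def, THEN conjunct2, THEN conjunct2, THEN conjunct2, THEN conjunct2, THEN conjunct1, rule_format]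
  poisson[unfolded poisson_structure_def, THEN conjunct2, THEN conjunct2, THEN conjunct2, THEN conjunct2, THEN conjunct2, THEN conjunct1, rule_format]

lemma br_antisym: "br f g = - br g f"
  and br_jacobi: "br f (br g h) + br g (br h f) + br h (br f g) = 0"
  using poisson[unfolded poisson_structure_def, THEN conjunct2, THEN conjunct2, THEN conjunct2, THEN conjunct2,
      THEN conjunct2, THEN conjunct2] by blast+

lemma br_simps:
  "br (f + g) h = br f h + br g h" "br (c *\<^sub>C f) h = c *\<^sub>C br f h"
  "br f (g + h) = br f g + br f h" "br f (c *\<^sub>C h) = c *\<^sub>C br f h"
  "br (f * g) h = f * br g h + br f h * g" "br f (g * h) = br f g * h + g * br f h"
  "br f 0 = 0" "br 0 h = 0"
  using poisson_conj(1-6) poisson_conj(1)[of 0 0 h] poisson_conj(3)[of f 0 0] by simp_all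

lemma homology_class_self: "x \<in> homology_class n (x :: 'c::dg_module)"
  unfolding homology_class_def using hmg_zero[of "n + 1"] by force

lemma homology_map: "(\<Union>x\<in>homology_class n x0. homology_class n (\<epsilon> x)) = homology_class n (\<epsilon> x0)"
  by (rule homology_map_class[OF eps_dg_hom])

text \<open>The classes of \<open>x\<close> and of 0 have the same image in homology, so injectivity
  makes \<open>x\<close> a boundary.\<close>

lemma exact:
  assumes "x \<in> hmg n" "\<delta> x = 0" "\<epsilon> x = 0"
  shows "\<exists>y\<in>hmg (n + 1). \<delta> y = x"
proof -
  let ?H = "\<lambda>X. \<Union>x\<in>X. homology_class n (\<epsilon> x)"
  have 1: "inj_on ?H (homology TYPE('a) n)"
    using eps_quasi_iso unfolding quasi_iso_def bij_betw_def by blast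
  have 2: "homology_class n x \<in> homology TYPE('a) n" "homology_class n 0 \<in> homology TYPE('a) n"
    unfolding homology_def using assms by (auto simp: hmg_zero)
  have 3: "?H (homology_class n x) = ?H (homology_class n 0)"
    unfolding homology_map by (simp add: assms eps_simps)
  have "homology_class n x = homology_class n 0"
    by (rule inj_onD[OF 1 3 2])
  then have "x \<in> homology_class n 0" using homology_class_self[of x n] by simp
  then show ?thesis by (auto simp: homology_class_def)
qed

text \<open>Surjectivity in homology of degree 0; in the target, where \<delta> vanishes, a homology
  class is a single element.\<close>

lemma eps_surj: "\<exists>x\<in>hmg 0. \<epsilon> x = y"
proof -
  let ?H = "\<lambda>X. \<Union>x\<in>X. homology_class 0 (\<epsilon> x)"
  have d: "\<delta> z = 0" "z \<in> hmg 0" for z :: 'o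
    using concentrated_in_degree_0D[OF conc] by auto
  have "?H ` homology TYPE('a) 0 = homology TYPE('o) 0"
    using eps_quasi_iso unfolding quasi_iso_def bij_betw_def by blast
  moreover have "homology_class 0 y \<in> homology TYPE('o) 0"
    unfolding homology_def using d by auto
  ultimately have "homology_class 0 y \<in> ?H ` homology TYPE('a) 0" by simp
  then obtain X where X: "homology_class 0 y = ?H X" "X \<in> homology TYPE('a) 0" by (rule imageE)
  from X(2) obtain x where x: "x \<in> hmg 0" "X = homology_class 0 x" by (auto simp: homology_def)
  have "homology_class 0 (\<epsilon> x) = homology_class 0 y" unfolding X(1) x(2) homology_map ..
  with homology_class_self[of "\<epsilon> x" 0] have "\<epsilon> x = y" by (auto simp: homology_class_def d)
  then show ?thesis using x by blast
qed

section \<open>Admissible families and their curvature\<close>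

text \<open>The degree \<open>-2\<close> is that of a multivector of upper degree 2. The binary
  values are pinned down only after applying \<epsilon>, which leaves room for correcting
  them.\<close>

definition admissible :: "(nat list \<Rightarrow> 'a) \<Rightarrow> bool" where
  "admissible w \<longleftrightarrow> wSym w \<and> wHom (-2) w \<and> w [] = 0 \<and> (\<forall>i<r. w [i] = \<delta> (u i)) \<and>
     (\<forall>i<r. \<forall>j<r. \<epsilon> (w [i, j]) = br (\<epsilon> (u i)) (\<epsilon> (u j)))"

text \<open>The left-hand side of the Maurer--Cartan equation: the differential \<open>\<delta>\<close> is the unary part of \<open>ev w\<close>.\<close>

definition curvature :: "(nat list \<Rightarrow> 'a) \<Rightarrow> ('a \<times> int) list \<Rightarrow> 'a" where
  "curvature w = prelie (-1) (cochain (ev w)) (cochain (ev w))"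

lemma right_linear_ev: "wSym w \<Longrightarrow> right_linear (ev w)"
  by (simp add: right_linear_def ev_add ev_scaleC ev_mult_inc)

lemma map_degree_ev: "wSym w \<Longrightarrow> wHom k w \<Longrightarrow> map_degree k (ev w)"
  by (simp add: map_degree_def ev_hmg)

lemma ev_gens: "wSym w \<Longrightarrow> set is \<subseteq> {..<r} \<Longrightarrow> ev w (dprod (gens is)) = w is"
  using ev_generators[of w "is"] by (simp add: dprod_def gens_def comp_def)

lemma admissibleD:
  assumes "admissible w"
  shows "wSym w" "wHom (-2) w" "w [] = 0" "i < r \<Longrightarrow> w [i] = \<delta> (u i)"
    "i < r \<Longrightarrow> j < r \<Longrightarrow> \<epsilon> (w [i, j]) = br (\<epsilon> (u i)) (\<epsilon> (u j))"
    "right_linear (ev w)" "map_degree (-2) (ev w)" "ev w 1 = 0"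
  using assms right_linear_ev map_degree_ev ev_gens[of w "[]"] by (auto simp: admissible_def)

text \<open>Both sides are derivations and agree on generators.\<close>

lemma ev_one_kd:
  assumes "admissible w"
  shows "ev w (\<d> f) = \<delta> f"
proof (induction f rule: hmg_induct)
  case (homogeneous n f)
  then show ?case
  proof (induction rule: poly_induct)
    case (gen i)
    then show ?case
      using ev_gens[OF admissibleD(1)[OF assms], of "[i]"] admissibleD(4)[OF assms] by simp
  next
    case (mult a b m n)
    have "a * \<delta> b = ksign (m * (n - 1)) (\<delta> b * a)"
      using mult by (intro graded_commute dlt_hmg)
    then show ?case
      using mult by (simp add: kd_mult_right right_linearD[OF admissibleD(6)[OF assms]] dlt_mult)
        (rule ksign_cong, auto)
  next
    case one
    have "\<d> (1 :: 'a) = 0" using kd_kaehler(3)[OF hmg_one, of 1] by (simp add: inc_kaehler)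
    then show ?case by (simp add: right_linearD[OF admissibleD(6)[OF assms]])
  qed (simp_all add: kd_kaehler right_linearD[OF admissibleD(6)[OF assms]] dlt_add dlt_scaleC)
qed (simp add: kd_kaehler right_linearD[OF admissibleD(6)[OF assms]] dlt_add)

text \<open>In degree 0 both sides are biderivations along \<epsilon> agreeing on generators, so one
  argument after the other is expanded into generators of degree 0. In all other degrees both sides
  vanish.\<close>

lemma ev_two_kd:
  assumes w: "admissible w"
  shows "\<epsilon> (ev w (\<d> f * \<d> g)) = br (\<epsilon> f) (\<epsilon> g)"
proof -
  note P = right_linearD[OF admissibleD(6)[OF w]]
  have O: "x * y = y * x" for x y :: 'o by (rule concentrated_in_degree_0D(3)[OF conc])
  have 1: "\<epsilon> (ev w (\<d> f * \<d> (u j))) = br (\<epsilon> f) (\<epsilon> (u j))" if f: "f \<in> hmg 0" and j: "j < r" "e j = 0" for f j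
    using f
  proof (induction rule: poly_induct)
    case (gen i)
    then show ?case
      using ev_gens[OF admissibleD(1)[OF w], of "[i, j]"] admissibleD(5)[OF w] j by simp
  next
    case (mult a b m n)
    then have [simp]: "m = 0" "n = 0" by auto
    have c: "inc x * \<d> (u j) = \<d> (u j) * inc x" if "x \<in> hmg 0" for x
      using graded_commute[OF hmg_kaehler_closed(7)[OF that] hmg_kaehler_closed(8)[OF u_hmg[OF j(1)]]] by simp
    have "\<d> (a * b) * \<d> (u j) = \<d> a * \<d> (u j) * inc b + \<d> b * \<d> (u j) * inc a"
      using mult by (simp add: kd_mult_right[of a 0 b 0] distrib_right mult.assoc c)
    then show ?case
      using mult by (simp add: P eps_simps br_simps) (simp add: O add.commute)
  next
    case one
    have "\<d> (1 :: 'a) = 0" using kd_kaehler(3)[OF hmg_one, of 1] by (simp add: inc_kaehler)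
    then show ?case using br_simps(5)[of 1 1 "\<epsilon> (u j)"] by (simp add: P eps_simps)
  qed (simp_all add: kd_kaehler P distrib_right kaehler_rules eps_simps br_simps)
  have 2: "\<epsilon> (ev w (\<d> f * \<d> g)) = br (\<epsilon> f) (\<epsilon> g)" if f: "f \<in> hmg 0" and g: "g \<in> hmg 0" for f g
    using g
  proof (induction rule: poly_induct)
    case (gen i)
    then show ?case using 1[OF f gen(1)] e_nonneg[OF gen(1)] by simp
  next
    case (mult a b m n)
    then have [simp]: "m = 0" "n = 0" by auto
    have "\<d> f * \<d> (a * b) = \<d> f * \<d> a * inc b + \<d> f * \<d> b * inc a"
      using mult by (simp add: kd_mult_right[of a 0 b 0] distrib_left mult.assoc)
    then show ?case
      using mult by (simp add: P eps_simps br_simps) (simp add: O)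
  next
    case one
    have "\<d> (1 :: 'a) = 0" using kd_kaehler(3)[OF hmg_one, of 1] by (simp add: inc_kaehler)
    then show ?case using br_simps(6)[of "\<epsilon> f" 1 1] by (simp add: P eps_simps)
  qed (simp_all add: kd_kaehler P distrib_left kaehler_rules eps_simps br_simps)
  show ?thesis
  proof (induction f rule: hmg_induct)
    case (homogeneous m f)
    show ?case
    proof (induction g rule: hmg_induct)
      case (homogeneous n g)
      note f = \<open>f \<in> hmg m\<close> and g = \<open>g \<in> hmg n\<close>
      show ?case
      proof (cases "m = 0 \<and> n = 0")
        case True
        then show ?thesis using 2 f g by simp
      next
        case ne: False
        show ?thesis
        proof (cases "m < 0 \<or> n < 0")
          case True
          then have "f = 0 \<or> g = 0" using f g hmg_negative by auto
          then show ?thesis by (auto simp: P eps_simps br_simps)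
        next
          case False
          \<comment> \<open>The value has degree \<open>m + n\<close>, which is positive here, so
            \<epsilon> annihilates it.\<close>
          have "ev w (\<d> f * \<d> g) \<in> hmg (- 2 + ((m + 1) + (n + 1)))"
            using admissibleD(7)[OF w] hmg_mult[OF hmg_kaehler_closed(8)[OF f] hmg_kaehler_closed(8)[OF g]]
            unfolding map_degree_def by blast
          then have "\<epsilon> (ev w (\<d> f * \<d> g)) = 0" using ne False by (intro eps_hmg) auto
          moreover have "\<epsilon> f = 0 \<or> \<epsilon> g = 0" using ne f g eps_hmg by blast
          ultimately show ?thesis by (auto simp: br_simps)
        qed
      qed
    qed (simp add: kd_kaehler P distrib_left eps_simps br_simps)
  qed (simp add: kd_kaehler P distrib_right eps_simps br_simps)
qed

context
  fixes w assumes w: "admissible w"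
begin

lemma multiderivation_curvature: "multiderivation (curvature w)"
  unfolding curvature_def using admissibleD(6,7)[OF w] by (intro multiderivation_prelie) auto

lemma cochain_degree_ev: "cochain_degree (-1) (cochain (ev w))"
  using admissibleD(7)[OF w] by (intro cochain_degree_cochain) simp

lemma curvature_hmg: "graded zs \<Longrightarrow> curvature w zs \<in> hmg (degs zs - 3)"
  using cochain_degreeD[OF cochain_degree_prelie[OF cochain_degree_ev cochain_degree_ev], of zs]
  by (simp add: curvature_def)

lemma curvature_short: "graded zs \<Longrightarrow> length zs < 2 \<Longrightarrow> curvature w zs = 0"
proof -
  assume "length zs < 2"
  then have "zs = [] \<or> (\<exists>f m. zs = [(f, m)])" by (cases zs) (auto simp: length_Suc_conv less_Suc_eq numeral_2_eq_2)
  then show ?thesis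
    using admissibleD(6,8)[OF w] by (auto simp: curvature_def right_linearD ev_one_kd[OF w] dlt_dlt)
qed

text \<open>Each term either is a boundary or contains the bracket with \<epsilon> of a
  boundary.\<close>

lemma eps_curvature_two: "graded [y, z] \<Longrightarrow> \<epsilon> (curvature w [y, z]) = 0"
  using admissibleD(6,8)[OF w]
  by (simp add: curvature_def right_linearD ev_one_kd[OF w] eps_simps ev_two_kd[OF w] br_simps ksign_add)

lemma eps_curvature_three:
  assumes "f \<in> hmg 0" "g \<in> hmg 0" "h \<in> hmg 0"
  shows "\<epsilon> (curvature w [(f, 1), (g, 1), (h, 1)]) = 0"
proof -
  \<comment> \<open>With no elements in negative degree, the ternary value with \<delta> inside an
    argument vanishes, and \<epsilon> removes \<delta> applied to a ternary value. Only the iterated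
    binary values remain.\<close>
  have "\<delta> f = 0" "\<delta> g = 0" "\<delta> h = 0"
    using assms[THEN dlt_hmg] hmg_negative[of "-1"] by auto
  then have "\<epsilon> (curvature w [(f, 1), (g, 1), (h, 1)]) =
      - br (\<epsilon> f) (br (\<epsilon> g) (\<epsilon> h)) + br (\<epsilon> g) (br (\<epsilon> f) (\<epsilon> h)) - br (\<epsilon> h) (br (\<epsilon> f) (\<epsilon> g))"
    using admissibleD(6,8)[OF w]
    by (simp add: curvature_def right_linearD ev_one_kd[OF w] eps_simps ev_two_kd[OF w] br_simps ksign_def)
  also have "br (\<epsilon> g) (br (\<epsilon> f) (\<epsilon> h)) = - br (\<epsilon> g) (br (\<epsilon> h) (\<epsilon> f))"
    using br_simps(4)[of "\<epsilon> g" "-1" "br (\<epsilon> h) (\<epsilon> f)"] br_antisym[of "\<epsilon> f" "\<epsilon> h"] by simp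
  also have "- br (\<epsilon> f) (br (\<epsilon> g) (\<epsilon> h)) + - br (\<epsilon> g) (br (\<epsilon> h) (\<epsilon> f)) - br (\<epsilon> h) (br (\<epsilon> f) (\<epsilon> g)) =
      - (br (\<epsilon> f) (br (\<epsilon> g) (\<epsilon> h)) + br (\<epsilon> g) (br (\<epsilon> h) (\<epsilon> f)) + br (\<epsilon> h) (br (\<epsilon> f) (\<epsilon> g)))"
    by (simp add: algebra_simps)
  finally show ?thesis by (simp add: br_jacobi)
qed

end

lemma curvature_plus:
  assumes v: "admissible v" and y: "wSym y"
  shows "curvature (v + y) zs = curvature v zs + prelie (-1) (cochain (ev v)) (cochain (ev y)) zs
    + prelie (-1) (cochain (ev y)) (cochain (ev v)) zs + prelie (-1) (cochain (ev y)) (cochain (ev y)) zs"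
proof -
  have a: "multiadditive (cochain (ev v))" "multiadditive (cochain (ev y))"
    using v y by (auto intro: multiadditive_cochain right_linear_ev dest: admissibleD)
  show ?thesis
    unfolding curvature_def ev_plus prelie_left_add prelie_right_add[OF a(1)] prelie_right_add[OF a(2)]
    by (simp only: add_ac)
qed

text \<open>In the Bianchi identity the side with C outside vanishes: C is evaluated on at most as
  many arguments, of total degree one less. On the other side C is inserted; vanishing on shorter
  lists leaves only the term with all arguments inside, and the outer unary part is
  \<delta>.\<close>

lemma curvature_delta:
  assumes w: "admissible w" and zs: "graded zs"
    and short: "\<And>zs'. \<lbrakk>graded zs'; length zs' < length zs\<rbrakk> \<Longrightarrow> curvature w zs' = 0"
    and low: "\<And>zs'. \<lbrakk>graded zs'; length zs' = length zs; degs zs' = degs zs - 1\<rbrakk> \<Longrightarrow> curvature w zs' = 0"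
  shows "\<delta> (curvature w zs) = 0"
proof -
  let ?p = "cochain (ev w)"
  note P = multiadditive_cochain[OF admissibleD(6)[OF w]] multisymmetric_cochain[OF admissibleD(6)[OF w]]
    cochain_degree_ev[OF w]
  have "prelie (-1) (curvature w) ?p zs = 0"
  proof (rule prelie_zero_left'[OF P(3) _ _ zs])
    show "ev w (dprod []) = 0" using admissibleD(8)[OF w] by simp
    show "multiadditive (curvature w)" unfolding curvature_def by (intro multiadditive_prelie P)
    show "curvature w zs' = 0" if "graded zs'" "length zs' \<le> length zs" "degs zs' = degs zs + - 1" for zs'
      using that short[of zs'] low[of zs'] by (cases "length zs' = length zs") auto
  qed
  moreover have "prelie (-1) (curvature w) ?p zs = prelie (- 1 + - 1) ?p (curvature w) zs"
    unfolding curvature_def by (rule bianchi[OF P _ zs]) simp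
  moreover have "prelie (- 1 + - 1) ?p (curvature w) zs = \<delta> (curvature w zs)"
    using prelie_last[OF P(1) zs short] by (simp add: ev_one_kd[OF w])
  ultimately show ?thesis by simp
qed

section \<open>Induction on the number of arguments and their total degree\<close>

text \<open>The state of the lexicographic induction. It refers to generators only; since C is a
  multiderivation, \<open>flatD\<close> extends it to all graded arguments.\<close>

definition flat :: "(nat list \<Rightarrow> 'a) \<Rightarrow> nat \<Rightarrow> int \<Rightarrow> bool" where
  "flat w s n \<longleftrightarrow> (\<forall>is. set is \<subseteq> {..<r} \<longrightarrow> length is < s \<or> length is = s \<and> dg is \<le> n \<longrightarrow>
     curvature w (gens is) = 0)"

lemma flatD:
  assumes "admissible w" "flat w s n" "graded zs" "length zs < s \<or> length zs = s \<and> degs zs \<le> n"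
  shows "curvature w zs = 0"
proof (rule multiderivation_zero[OF multiderivation_curvature[OF assms(1)] _ assms(3) HOL.refl order_refl])
  fix "is" assume "set is \<subseteq> {..<r}" "length is = length zs" "dg is \<le> degs zs"
  then show "curvature w (gens is) = 0" using assms(2,4) by (auto simp: flat_def)
qed

lemma dg_ge_length: "set is \<subseteq> {..<r} \<Longrightarrow> int (length is) \<le> dg is"
proof (induction "is")
  case (Cons i "is")
  then show ?case using e_nonneg[of i] by simp
qed simp

lemma eps_curvature_gens:
  assumes w: "admissible w" and i: "set is \<subseteq> {..<r}" "dg is = 3"
  shows "\<epsilon> (curvature w (gens is)) = 0"
proof -
  note l = dg_ge_length[OF i(1)]
  consider "length is < 2" | "length is = 2" | "length is = 3" using l i(2) by linarith
  then show ?thesis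
  proof cases
    case 1
    then show ?thesis using curvature_short[OF w graded_gens[OF i(1)]] by (simp add: eps_simps)
  next
    case 2
    then obtain i j where ij: "is = [i, j]" by (auto simp: numeral_2_eq_2 length_Suc_conv)
    then show ?thesis using eps_curvature_two[OF w, of "(u i, e i + 1)" "(u j, e j + 1)"] i(1) u_hmg by simp
  next
    case 3
    then obtain i j k where ijk: "is = [i, j, k]" by (auto simp: numeral_3_eq_3 length_Suc_conv)
    then have "e i = 0" "e j = 0" "e k = 0"
      using i e_nonneg[of i] e_nonneg[of j] e_nonneg[of k] by auto
    then show ?thesis
      using eps_curvature_three[OF w, of "u i" "u j" "u k"] u_hmg[of i] u_hmg[of j] u_hmg[of k] i(1) ijk by simp
  qed
qed

lemma flat_step:
  assumes w: "admissible w" and f: "flat w s n" and s: "2 \<le> s" and n: "2 \<le> n"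
  shows "\<exists>w'. admissible w' \<and> flat w' s (n + 1) \<and> (\<forall>is. length is \<noteq> s \<longrightarrow> w' is = w is)"
proof -
  define S where "S = {is. set is \<subseteq> {..<r} \<and> length is = s \<and> dg is = n + 1}"
  let ?C = "\<lambda>is. curvature w (gens is)"
  \<comment> \<open>\<open>y\<close> is the correction to be added to \<open>w\<close>, supported on
    the tuples treated in this step; \<open>n - 1\<close> is the degree \<open>dg is - 2\<close> of
    a value of \<open>w\<close> there.\<close>
  define T where "T is y \<longleftrightarrow> (if is \<in> S then y \<in> hmg (n - 1) \<and> \<delta> y = - ?C is else y = 0)" for "is" y
  have Cswap: "?C (xs @ i # j # ys) = ksign ((e i + 1) * (e j + 1)) (?C (xs @ j # i # ys))" if "i < r" "j < r" for xs i j ys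
    using multiderivation_swap[OF multiderivation_curvature[OF w], of "(u i, e i + 1)" "(u j, e j + 1)" "gens xs" "gens ys"]
      that u_hmg by simp
  have "\<exists>y. wSym y \<and> (\<forall>is. T is (y is))"
  proof (rule symmetric_choice)
    fix xs ys :: "nat list" and i j y
    assume T: "T (xs @ i # j # ys) y"
    show "T (xs @ j # i # ys) (ksign ((e i + 1) * (e j + 1)) y)"
    proof (cases "xs @ i # j # ys \<in> S")
      case True
      then have "xs @ j # i # ys \<in> S" "i < r" "j < r" by (auto simp: S_def)
      then show ?thesis
        using True T Cswap[of j i xs ys] by (auto simp: T_def ksign_minus mult.commute intro: hmg_ksign)
    next
      case False
      then have "xs @ j # i # ys \<notin> S" by (auto simp: S_def)
      then show ?thesis using False T by (simp add: T_def)
    qed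
  next
    fix "is" y
    assume "T is y" "T is (- y)"
    \<comment> \<open>If \<open>y\<close> and \<open>- y\<close> have the same boundary
      \<open>- ?C is\<close>, then \<open>?C is\<close> equals its negative and is 0, so the choice
      0 works.\<close>
    then show "T is 0"
      using self_minus_eq_0[of "?C is"] by (auto simp: T_def dlt_minus hmg_zero split: if_splits)
  next
    fix "is"
    show "\<exists>y. T is y"
    proof (cases "is \<in> S")
      case True
      then have i: "set is \<subseteq> {..<r}" "length is = s" "dg is = n + 1" by (auto simp: S_def)
      have C: "?C is \<in> hmg (n - 2)"
        using curvature_hmg[OF w graded_gens[OF i(1)]] i(3) by (simp add: algebra_simps)
      have "\<delta> (?C is) = 0"
        using i by (intro curvature_delta[OF w] graded_gens flatD[OF w f]) auto
      \<comment> \<open>\<open>?C is\<close> has degree \<open>n - 2\<close>, so \<epsilon> kills it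
        unless \<open>n = 2\<close>, which is total degree 3.\<close>
      moreover have "\<epsilon> (?C is) = 0"
        using eps_curvature_gens[OF w i(1)] i(3) eps_hmg[OF C] by (cases "n = 2") auto
      ultimately obtain y where "y \<in> hmg (n - 2 + 1)" "\<delta> y = - ?C is"
        using exact[of "- ?C is" "n - 2"] C by (auto simp: hmg_minus dlt_minus eps_simps)
      then show ?thesis using True by (auto simp: T_def)
    qed (auto simp: T_def)
  qed
  then obtain y where y: "wSym y" "\<And>is. T is (y is)" by blast
  have yS: "y is \<in> hmg (n - 1)" "\<delta> (y is) = - ?C is" if "is \<in> S" for "is"
    using y(2)[of "is"] that by (auto simp: T_def)
  have y0: "y is = 0" if "is \<notin> S" for "is" using y(2)[of "is"] that by (simp add: T_def)
  have yH: "wHom (-2) y"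
    unfolding wHom_def
  proof
    fix "is" show "y is \<in> hmg (dg is + - 2)"
      using yS(1)[of "is"] y0[of "is"] by (cases "is \<in> S") (auto simp: S_def hmg_zero)
  qed
  have sym: "wSym (w + y)" using admissibleD(1)[OF w] y(1) by (rule wSym_lin)
  have adm: "admissible (w + y)"
    unfolding admissible_def
  proof (intro conjI allI impI)
    show "wHom (-2) (w + y)"
      using admissibleD(2)[OF w] yH unfolding wHom_def plus_fun_apply by (blast intro: hmg_add)
    show "(w + y) [] = 0" "i < r \<Longrightarrow> (w + y) [i] = \<delta> (u i)" for i
      using admissibleD(3,4)[OF w] y0 s by (auto simp: plus_fun_apply S_def)
    show "\<epsilon> ((w + y) [i, j]) = br (\<epsilon> (u i)) (\<epsilon> (u j))" if "i < r" "j < r" for i j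
    proof -
      \<comment> \<open>A nonzero correction has degree \<open>n - 1\<close>, at least 1, so the
        lift of the Poisson bracket is not disturbed.\<close>
      have "\<epsilon> (y [i, j]) = 0"
        using yS(1)[of "[i, j]"] y0[of "[i, j]"] eps_hmg[of _ "n - 1"] n
        by (cases "[i, j] \<in> S") (auto simp: eps_simps)
      then show ?thesis using admissibleD(5)[OF w that] by (simp add: plus_fun_apply eps_simps)
    qed
  qed (rule sym)
  let ?P = "cochain (ev w)" and ?R = "cochain (ev y)"
  have R0: "ev y (dprod zs) = 0" if "graded zs" "length zs \<noteq> s \<or> degs zs \<le> n" for zs
  proof (rule multiderivation_zero[OF multiderivation_cochain[OF right_linear_ev[OF y(1)]] _ that(1) HOL.refl order_refl])
    fix "is" assume "set is \<subseteq> {..<r}" "length is = length zs" "dg is \<le> degs zs"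
    then show "ev y (dprod (gens is)) = 0"
      using that(2) y0[of "is"] by (auto simp: ev_gens[OF y(1)] S_def)
  qed
  have Rd: "cochain_degree (-1) ?R"
    using map_degree_ev[OF y(1) yH] by (intro cochain_degree_cochain) simp
  note add = multiadditive_cochain[OF admissibleD(6)[OF w]] multiadditive_cochain[OF right_linear_ev[OF y(1)]]
  have "curvature (w + y) (gens is) = 0"
    if i: "set is \<subseteq> {..<r}" "length is < s \<or> length is = s \<and> dg is \<le> n + 1" for "is"
  proof -
    have g: "graded (gens is)" by (rule graded_gens[OF i(1)])
    have "prelie (-1) ?P ?R (gens is) = \<delta> (y is)"
    proof -
      have "ev y (dprod zs) = 0" if "graded zs" "length zs < length (gens is)" for zs
        using that i by (intro R0) auto
      from prelie_last[OF add(1) g this, where k = "-1"] show ?thesis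
        by (simp add: ev_one_kd[OF w] ev_gens[OF y(1) i(1)])
    qed
    \<comment> \<open>Inserting a value lowers the total degree by 1 and, the constant value being
      0, does not lengthen the list. The outer correction is thus evaluated either below length
      \<open>s\<close> or at total degree at most \<open>n\<close>, where it vanishes.\<close>
    moreover have "prelie (-1) ?R ?P (gens is) = 0"
      using i admissibleD(8)[OF w] by (intro prelie_zero_left'[OF cochain_degree_ev[OF w] _ add(2) g] R0) auto
    moreover have "prelie (-1) ?R ?R (gens is) = 0"
      using i R0[of "[]"] s by (intro prelie_zero_left'[OF Rd _ add(2) g] R0) auto
    ultimately have "curvature (w + y) (gens is) = ?C is + \<delta> (y is)"
      unfolding curvature_plus[OF w y(1)] by simp
    also have "\<dots> = 0"
    proof (cases "is \<in> S")
      case False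
      then have "length is < s \<or> length is = s \<and> dg is \<le> n" using i by (auto simp: S_def)
      then show ?thesis using False f i(1) y0 by (auto simp: flat_def)
    qed (simp add: yS)
    finally show ?thesis .
  qed
  then have "flat (w + y) s (n + 1)" by (auto simp: flat_def)
  moreover have "(w + y) is = w is" if "length is \<noteq> s" for "is"
    using y0[of "is"] that by (simp add: plus_fun_apply S_def)
  ultimately show ?thesis using adm by blast
qed

text \<open>C has degree \<open>dg is - 3\<close>, so up to total degree 2 it lies in negative
  degree and vanishes.\<close>

lemma flat_start:
  assumes w: "admissible w" and f: "\<And>is. set is \<subseteq> {..<r} \<Longrightarrow> length is < s \<Longrightarrow> curvature w (gens is) = 0"
  shows "flat w s 2"
  unfolding flat_def
proof (intro allI impI)
  fix "is" assume i: "set is \<subseteq> {..<r}" "length is < s \<or> length is = s \<and> dg is \<le> 2"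
  have "curvature w (gens is) \<in> hmg (dg is - 3)"
    using curvature_hmg[OF w graded_gens[OF i(1)]] by simp
  then show "curvature w (gens is) = 0"
    using i f hmg_negative[of "dg is - 3"] by auto
qed

lemma dg_bound: "set is \<subseteq> {..<r} \<Longrightarrow> dg is \<le> int (length is) * (\<Sum>i<r. e i + 1)"
proof (induction "is")
  case (Cons i "is")
  have "e i + 1 \<le> (\<Sum>i<r. e i + 1)"
    using Cons.prems by (intro member_le_sum) (auto dest: e_nonneg)
  then show ?case using Cons by (simp add: algebra_simps)
qed simp

lemma flat_length:
  assumes w: "admissible w" and f: "\<And>is. set is \<subseteq> {..<r} \<Longrightarrow> length is < s \<Longrightarrow> curvature w (gens is) = 0"
    and s: "2 \<le> s"
  shows "\<exists>w'. admissible w' \<and> (\<forall>is. set is \<subseteq> {..<r} \<longrightarrow> length is < Suc s \<longrightarrow> curvature w' (gens is) = 0) \<and>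
    (\<forall>is. length is \<noteq> s \<longrightarrow> w' is = w is)"
proof -
  have "\<exists>w'. admissible w' \<and> flat w' s (int k + 2) \<and> (\<forall>is. length is \<noteq> s \<longrightarrow> w' is = w is)" for k
  proof (induction k)
    case 0
    then show ?case using w flat_start[OF w f] by auto
  next
    case (Suc k)
    then obtain v where v: "admissible v" "flat v s (int k + 2)" "\<forall>is. length is \<noteq> s \<longrightarrow> v is = w is" by blast
    obtain v' where "admissible v'" "flat v' s (int k + 2 + 1)" "\<forall>is. length is \<noteq> s \<longrightarrow> v' is = v is"
      using flat_step[OF v(1,2) s] by auto
    then show ?case using v(3) by (intro exI[of _ v']) (auto simp: algebra_simps)
  qed
  \<comment> \<open>At length \<open>s\<close> the total degree of generators is bounded by
    \<open>dg_bound\<close>, so this many steps treat every tuple.\<close>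
  from this[of "nat (int s * (\<Sum>i<r. e i + 1))"] obtain w' where w': "admissible w'"
    "flat w' s (int (nat (int s * (\<Sum>i<r. e i + 1))) + 2)" "\<forall>is. length is \<noteq> s \<longrightarrow> w' is = w is" by blast
  have "curvature w' (gens is) = 0" if "set is \<subseteq> {..<r}" "length is < Suc s" for "is"
    using w'(2) that dg_bound[OF that(1)] unfolding flat_def by (cases "length is = s") auto
  then show ?thesis using w'(1,3) by blast
qed

lemma admissible_exists: "\<exists>w. admissible w"
proof -
  define T where "T is y \<longleftrightarrow>
    (if set is \<subseteq> {..<r} \<and> length is = 1 then y = \<delta> (U (hd is))
     else if set is \<subseteq> {..<r} \<and> length is = 2 then y \<in> hmg (dg is - 2) \<and> \<epsilon> y = br (\<epsilon> (u (hd is))) (\<epsilon> (u (last is)))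
     else y = 0)" for "is" y
  \<comment> \<open>\<epsilon> kills generators of positive degree, so outside total degree 0 the
    binary value 0 is a lift of the bracket.\<close>
  have br0: "br (\<epsilon> (u i)) (\<epsilon> (u j)) = 0" if "i < r" "j < r" "e i + e j \<noteq> 0" for i j
  proof -
    have "\<epsilon> (u i) = 0 \<or> \<epsilon> (u j) = 0"
      using that eps_hmg[OF u_hmg[of i]] eps_hmg[OF u_hmg[of j]] by (cases "e i = 0") auto
    then show ?thesis by (auto simp: br_simps)
  qed
  have "\<exists>w. wSym w \<and> (\<forall>is. T is (w is))"
  proof (rule symmetric_choice)
    fix xs ys :: "nat list" and i j y
    assume T: "T (xs @ i # j # ys) y"
    show "T (xs @ j # i # ys) (ksign ((e i + 1) * (e j + 1)) y)"
    proof (cases "set (xs @ i # j # ys) \<subseteq> {..<r} \<and> xs = [] \<and> ys = []")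
      case True
      then have ij: "i < r" "j < r" "y \<in> hmg (e i + e j)" "\<epsilon> y = br (\<epsilon> (u i)) (\<epsilon> (u j))"
        using T by (auto simp: T_def)
      \<comment> \<open>In degree 0 both \<open>du\<close> are odd, and the required symmetry is the
        antisymmetry of the bracket; otherwise both sides are 0.\<close>
      have "ksign ((e i + 1) * (e j + 1)) (br (\<epsilon> (u i)) (\<epsilon> (u j))) = br (\<epsilon> (u j)) (\<epsilon> (u i))"
      proof (cases "e i + e j = 0")
        case True
        then have "e i = 0" "e j = 0" using e_nonneg[OF ij(1)] e_nonneg[OF ij(2)] by auto
        then show ?thesis using br_antisym[of "\<epsilon> (u j)"] by (simp add: ksign_odd)
      next
        case False
        then show ?thesis using br0[OF ij(1,2)] br0[OF ij(2,1)] by (simp add: add.commute)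
      qed
      then show ?thesis
        using True ij by (auto simp: T_def eps_simps algebra_simps intro: hmg_ksign)
    next
      case False
      then have "\<not> (set (xs @ i # j # ys) \<subseteq> {..<r} \<and> length (xs @ i # j # ys) = 2)" by auto
      then have "y = 0" using T by (auto simp: T_def split: if_splits)
      moreover have "\<not> (set (xs @ j # i # ys) \<subseteq> {..<r} \<and> length (xs @ j # i # ys) = 2)" using False by auto
      ultimately show ?thesis by (auto simp: T_def)
    qed
  next
    fix "is" y
    assume "T is y" "T is (- y)"
    then show "T is 0"
      using self_minus_eq_0[of y] self_minus_eq_0[of "\<epsilon> y"]
      by (auto simp: T_def hmg_zero eps_simps split: if_splits)
  next
    fix "is"
    show "\<exists>y. T is y"
    proof (cases "set is \<subseteq> {..<r} \<and> length is = 2")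
      case True
      then obtain i j where ij: "is = [i, j]" "i < r" "j < r" by (auto simp: numeral_2_eq_2 length_Suc_conv)
      show ?thesis
      proof (cases "e i + e j = 0")
        case True
        then show ?thesis using eps_surj[of "br (\<epsilon> (u i)) (\<epsilon> (u j))"] ij by (auto simp: T_def)
      next
        case False
        then show ?thesis using br0[OF ij(2,3)] ij by (auto simp: T_def hmg_zero eps_simps intro!: exI[of _ 0])
      qed
    qed (auto simp: T_def)
  qed
  then obtain w where w: "wSym w" "\<And>is. T is (w is)" by blast
  have "w is \<in> hmg (dg is + - 2)" for "is"
  proof (cases "set is \<subseteq> {..<r} \<and> length is = 1")
    case True
    then obtain i where "is = [i]" by (auto simp: length_Suc_conv)
    then show ?thesis using w(2)[of "is"] True dlt_hmg[OF U_hmg[of i]] by (auto simp: T_def)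
  next
    case False
    then show ?thesis using w(2)[of "is"] by (auto simp: T_def hmg_zero split: if_splits)
  qed
  then have "admissible w"
    unfolding admissible_def wHom_def
    using w(1) w(2)[of "[]"] w(2)[of "[_]"] w(2)[of "[_, _]"] by (auto simp: T_def)
  then show ?thesis by blast
qed

lemma flat_exists: "\<exists>w. admissible w \<and> (\<forall>zs. graded zs \<longrightarrow> curvature w zs = 0)"
proof -
  let ?P = "\<lambda>n w. admissible w \<and> (\<forall>is. set is \<subseteq> {..<r} \<longrightarrow> length is < n + 2 \<longrightarrow> curvature w (gens is) = 0)"
  have "\<exists>W. \<forall>n. ?P n (W n) \<and> (\<forall>is. length is \<noteq> n + 2 \<longrightarrow> W (Suc n) is = W n is)"
  proof (rule dependent_nat_choice)
    show "\<exists>w. ?P 0 w"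
      using admissible_exists curvature_short graded_gens by fastforce
  next
    fix w n assume "?P n w"
    then show "\<exists>w'. ?P (Suc n) w' \<and> (\<forall>is. length is \<noteq> n + 2 \<longrightarrow> w' is = w is)"
      using flat_length[of w "n + 2"] by auto
  qed
  then obtain W where W: "\<And>n. ?P n (W n)" "\<And>n is. length is \<noteq> n + 2 \<Longrightarrow> W (Suc n) is = W n is" by blast
  have stable: "W (n + k) is = W n is" if "length is \<le> n + 1" for n k "is"
    using that by (induction k) (simp_all add: W(2))
  \<comment> \<open>Passing from stage \<open>n\<close> to the next changes only lists of length
    \<open>n + 2\<close>, so a value is final from the stage numbered by its length on.\<close>
  define w where "w is = W (length is) is" for "is"
  have w_eq: "w is = W n is" if "length is \<le> n" for n "is"
    using stable[of "is" "length is" "n - length is"] that by (simp add: w_def)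
  have sym: "wSym w"
  proof (rule wSymI)
    fix xs ys :: "nat list" and i j
    show "w (xs @ i # j # ys) = ksign ((e i + 1) * (e j + 1)) (w (xs @ j # i # ys))"
      unfolding w_def using wSymD[OF admissibleD(1), of "W (length (xs @ i # j # ys))" xs i j ys] W(1) by simp
  qed
  have adm: "admissible w"
    unfolding admissible_def
    using sym admissibleD(2)[of "W _"] admissibleD(3,4,5) W(1) by (auto simp: wHom_def w_def)
  have "curvature w (gens is) = 0" if i: "set is \<subseteq> {..<r}" for "is"
  proof -
    define n where "n = length is"
    have v: "admissible (W n)" and C: "curvature (W n) (gens is) = 0" using W(1)[of n] i by (auto simp: n_def)
    \<comment> \<open>Comparison with a stage already flat at this length: \<open>y\<close> vanishes
      on at most \<open>n\<close> arguments, and every composition in the expansion involving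
      \<open>y\<close> evaluates it on at most that many.\<close>
    define y where "y = w - W n"
    have w: "w = W n + y" by (simp add: y_def)
    have ys: "wSym y" unfolding y_def by (rule wSym_lin(2)[OF sym admissibleD(1)[OF v]])
    have yH: "wHom (-2) y"
      using admissibleD(2)[OF v] admissibleD(2)[OF adm] unfolding y_def wHom_def minus_apply
      by (auto intro!: hmg_add hmg_minus simp only: diff_conv_add_uminus)
    have R0: "ev y (dprod zs) = 0" if "graded zs" "length zs \<le> n" for zs
    proof (rule multiderivation_zero[OF multiderivation_cochain[OF right_linear_ev[OF ys]] _ that(1) HOL.refl order_refl])
      fix js assume "set js \<subseteq> {..<r}" "length js = length zs" "dg js \<le> degs zs"
      then show "ev y (dprod (gens js)) = 0"
        using that(2) w_eq[of js n] by (simp only: ev_gens[OF ys]) (simp add: y_def minus_apply)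
    qed
    have Rd: "cochain_degree (-1) (cochain (ev y))"
      using map_degree_ev[OF ys yH] by (intro cochain_degree_cochain) simp
    note add = multiadditive_cochain[OF admissibleD(6)[OF v]] multiadditive_cochain[OF right_linear_ev[OF ys]]
    have g: "graded (gens is)" by (rule graded_gens[OF i])
    have "prelie (-1) (cochain (ev (W n))) (cochain (ev y)) (gens is) = 0"
      by (intro prelie_zero_right add g R0) (auto simp: n_def)
    moreover have "prelie (-1) (cochain (ev y)) (cochain (ev (W n))) (gens is) = 0"
      using admissibleD(8)[OF v]
      by (intro prelie_zero_left'[OF cochain_degree_ev[OF v] _ add(2) g] R0) (auto simp: n_def)
    moreover have "prelie (-1) (cochain (ev y)) (cochain (ev y)) (gens is) = 0"
      by (intro prelie_zero_right add g R0) (auto simp: n_def)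
    ultimately show ?thesis
      unfolding w curvature_plus[OF v ys] using C by simp
  qed
  then have "curvature w zs = 0" if "graded zs" for zs
    using multiderivation_zero[OF multiderivation_curvature[OF adm] _ that HOL.refl order_refl] by blast
  then show ?thesis using adm by blast
qed

end

section \<open>Comparison with the Schouten--Nijenhuis bracket\<close>

lemma sorted_list_of_set_Suc: "finite A \<Longrightarrow> sorted_list_of_set (Suc ` A) = map Suc (sorted_list_of_set A)"
  by (rule sorted_distinct_set_unique) (auto simp: sorted_map distinct_map sorted_wrt_map)

lemma insort_0_Suc: "insort 0 (map Suc xs) = 0 # map Suc xs"
  by (cases xs) simp_all

lemma sum_Pow_Suc:
  "(\<Sum>J\<in>Pow {..<Suc n}. F J) = (\<Sum>J\<in>Pow {..<n}. F (Suc ` J)) + (\<Sum>J\<in>Pow {..<n}. F (insert 0 (Suc ` J)) :: 'b::ab_group_add)"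
proof -
  have inj: "inj_on (\<lambda>J. Suc ` J) A" "inj_on (\<lambda>J. insert 0 (Suc ` J)) A" for A
    by (auto simp: inj_on_def)
  have "Pow {..<Suc n} = (\<lambda>J. Suc ` J) ` Pow {..<n} \<union> (\<lambda>J. insert 0 (Suc ` J)) ` Pow {..<n}"
    unfolding lessThan_Suc_eq_insert_0 Pow_insert image_Pow_surj[OF HOL.refl, symmetric] by (simp add: image_image)
  moreover have "(\<lambda>J. Suc ` J) ` Pow {..<n} \<inter> (\<lambda>J. insert 0 (Suc ` J)) ` Pow {..<n} = {}"
    by auto
  ultimately show ?thesis
    by (simp add: sum.union_disjoint sum.reindex inj comp_def)
qed

text \<open>The Koszul exponent when \<open>J\<close> are the positions given to the inner cochain:
  each other argument passes the inner cochain, a single letter of degree \<open>k\<close>, and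
  those arguments in \<open>J\<close> that precede it.\<close>

definition sign_exp :: "int \<Rightarrow> int list \<Rightarrow> nat set \<Rightarrow> int" where
  "sign_exp k ms J = (\<Sum>i\<in>{..<length ms} - J. ms ! i * (k + (\<Sum>j | j \<in> J \<and> j < i. ms ! j)))"

lemma sign_exp_Suc:
  assumes "J \<subseteq> {..<length ms}"
  shows "sign_exp k (m # ms) (Suc ` J) = m * k + sign_exp k ms J"
    "sign_exp k (m # ms) (insert 0 (Suc ` J)) = sign_exp (k + m) ms J"
proof -
  have s: "{..<length (m # ms)} - Suc ` J = insert 0 (Suc ` ({..<length ms} - J))"
    "{..<length (m # ms)} - insert 0 (Suc ` J) = Suc ` ({..<length ms} - J)"
    by (auto simp: lessThan_Suc_eq_insert_0)
  have j: "{j. j \<in> Suc ` J \<and> j < Suc i} = Suc ` {j. j \<in> J \<and> j < i}" for i by auto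
  have j': "{j. (j = 0 \<or> j \<in> Suc ` J) \<and> j < Suc i} = insert 0 (Suc ` {j. j \<in> J \<and> j < i})" for i by auto
  have f: "finite {j. j \<in> J \<and> j < i}" for i by simp
  show "sign_exp k (m # ms) (Suc ` J) = m * k + sign_exp k ms J"
    unfolding sign_exp_def s by (simp add: sum.reindex j)
  show "sign_exp k (m # ms) (insert 0 (Suc ` J)) = sign_exp (k + m) ms J"
    unfolding sign_exp_def s by (simp add: sum.reindex j' f add.assoc)
qed

lemma prelie_sum:
  "prelie k l p zs = (\<Sum>J\<in>Pow {..<length zs}. ksign (sign_exp k (map snd zs) J)
     (l (map ((!) zs) (sorted_list_of_set ({..<length zs} - J)) @
        [(p (map ((!) zs) (sorted_list_of_set J)), k + (\<Sum>j\<in>J. snd (zs ! j)))])))"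
proof (induction zs arbitrary: k l p)
  case Nil
  then show ?case by (simp add: sign_exp_def)
next
  case (Cons z zs)
  have s: "{..<Suc (length zs)} - Suc ` J = insert 0 (Suc ` ({..<length zs} - J))"
    "{..<Suc (length zs)} - insert 0 (Suc ` J) = Suc ` ({..<length zs} - J)" for J
    by (auto simp: lessThan_Suc_eq_insert_0)
  have fin: "J \<subseteq> {..<length zs} \<Longrightarrow> finite J" for J by (rule finite_subset) auto
  show ?case
    unfolding prelie.simps Cons.IH length_Cons sum_Pow_Suc ksign_sum
  proof (rule arg_cong2[of _ _ _ _ "(+)"]; rule sum.cong[OF HOL.refl])
    fix J assume "J \<in> Pow {..<length zs}"
    then have J: "J \<subseteq> {..<length zs}" by simp
    show "ksign (snd z * k) (ksign (sign_exp k (map snd zs) J)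
        (l (z # map ((!) zs) (sorted_list_of_set ({..<length zs} - J)) @
          [(p (map ((!) zs) (sorted_list_of_set J)), k + (\<Sum>j\<in>J. snd (zs ! j)))]))) =
      ksign (sign_exp k (map snd (z # zs)) (Suc ` J))
        (l (map ((!) (z # zs)) (sorted_list_of_set ({..<Suc (length zs)} - Suc ` J)) @
          [(p (map ((!) (z # zs)) (sorted_list_of_set (Suc ` J))), k + (\<Sum>j\<in>Suc ` J. snd ((z # zs) ! j)))]))"
      using J by (simp add: sign_exp_Suc s sorted_list_of_set_Suc insort_0_Suc fin comp_def sum.reindex)
    show "ksign (sign_exp (k + snd z) (map snd zs) J)
        (l (map ((!) zs) (sorted_list_of_set ({..<length zs} - J)) @
          [(p (z # map ((!) zs) (sorted_list_of_set J)), k + snd z + (\<Sum>j\<in>J. snd (zs ! j)))])) =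
      ksign (sign_exp k (map snd (z # zs)) (insert 0 (Suc ` J)))
        (l (map ((!) (z # zs)) (sorted_list_of_set ({..<Suc (length zs)} - insert 0 (Suc ` J))) @
          [(p (map ((!) (z # zs)) (sorted_list_of_set (insert 0 (Suc ` J)))),
            k + (\<Sum>j\<in>insert 0 (Suc ` J). snd ((z # zs) ! j)))]))"
      using J by (simp add: sign_exp_Suc s sorted_list_of_set_Suc insort_0_Suc fin comp_def sum.reindex add.assoc)
  qed
qed

definition inversions :: "int list \<Rightarrow> nat list \<Rightarrow> nat list \<Rightarrow> int" where
  "inversions ds as bs = (\<Sum>a\<leftarrow>as. \<Sum>b\<leftarrow>bs. if b < a then ds ! a * ds ! b else 0)"

lemma koszul_Cons: "koszul ds (x # \<sigma>) = inversions ds [x] \<sigma> + koszul ds \<sigma>"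
proof -
  let ?A = "{b. b < length \<sigma> \<and> \<sigma> ! b < x}" and ?B = "{(a, b). a < b \<and> b < length \<sigma> \<and> \<sigma> ! b < \<sigma> ! a}"
  let ?f = "\<lambda>(a, b). ds ! ((x # \<sigma>) ! a) * ds ! ((x # \<sigma>) ! b)"
  have fA: "finite ?A" by simp
  have fB: "finite ?B" by (rule finite_subset[of _ "{..<length \<sigma>} \<times> {..<length \<sigma>}"]) auto
  have "{(a, b). a < b \<and> b < length (x # \<sigma>) \<and> (x # \<sigma>) ! b < (x # \<sigma>) ! a} =
      (\<lambda>b. (0, Suc b)) ` ?A \<union> (\<lambda>(a, b). (Suc a, Suc b)) ` ?B" (is "?C = _")
  proof (intro equalityI subsetI)
    fix c assume c: "c \<in> ?C"
    obtain a b where ab: "c = (a, b)" by fastforce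
    from c ab obtain b' where b': "b = Suc b'" by (cases b) auto
    show "c \<in> (\<lambda>b. (0, Suc b)) ` ?A \<union> (\<lambda>(a, b). (Suc a, Suc b)) ` ?B"
    proof (cases a)
      case 0
      then show ?thesis using c ab b' by auto
    next
      case (Suc a')
      then have "(a', b') \<in> ?B" using c ab b' by auto
      then show ?thesis using ab b' Suc by force
    qed
  qed auto
  then have "koszul ds (x # \<sigma>) = sum ?f ((\<lambda>b. (0, Suc b)) ` ?A) + sum ?f ((\<lambda>(a, b). (Suc a, Suc b)) ` ?B)"
    unfolding koszul_def using fA fB by (simp only:) (rule sum.union_disjoint, auto)
  also have "sum ?f ((\<lambda>(a, b). (Suc a, Suc b)) ` ?B) = koszul ds \<sigma>"
    unfolding koszul_def by (subst sum.reindex) (auto simp: inj_on_def intro!: sum.cong)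
  also have "sum ?f ((\<lambda>b. (0, Suc b)) ` ?A) = (\<Sum>b\<in>?A. ds ! x * ds ! (\<sigma> ! b))"
    by (subst sum.reindex) (auto simp: inj_on_def intro!: sum.cong)
  also have "\<dots> = (\<Sum>b<length \<sigma>. if \<sigma> ! b < x then ds ! x * ds ! (\<sigma> ! b) else 0)"
    by (rule sum.mono_neutral_cong_left) auto
  also have "\<dots> = inversions ds [x] \<sigma>"
    by (simp add: inversions_def sum_list_sum_nth atLeast0LessThan)
  finally show ?thesis .
qed

lemma koszul_Nil: "koszul ds [] = 0"
  by (simp add: koszul_def)

lemma koszul_append: "koszul ds (\<sigma> @ \<tau>) = koszul ds \<sigma> + koszul ds \<tau> + inversions ds \<sigma> \<tau>"
  by (induction \<sigma>) (simp_all add: koszul_Nil koszul_Cons inversions_def)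

lemma koszul_sorted: "sorted \<sigma> \<Longrightarrow> koszul ds \<sigma> = 0"
proof (induction \<sigma>)
  case (Cons x \<sigma>)
  have "map (\<lambda>b. if b < x then ds ! x * ds ! b else 0) \<sigma> = map (\<lambda>_. 0) \<sigma>" using Cons.prems by auto
  then have "inversions ds [x] \<sigma> = 0" unfolding inversions_def by (simp only: list.map sum_list.Cons sum_list.Nil sum_list_0)
  then show ?case using Cons by (simp add: koszul_Cons)
qed (simp add: koszul_Nil)

text \<open>Both halves of the target word are sorted, so only inversions between them count. The
  letters d and Q travel together with total degree 1 - 2 = -1, which is the \<open>k\<close> of
  \<open>prelie\<close>.\<close>

lemma koszul_sign_exp:
  assumes J: "J \<subseteq> {..<length ks}"
  shows "koszul ([- 2, 1, - 2] @ map (\<lambda>k. k + 1) ks)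
      ([0] @ map (\<lambda>i. i + 3) (sorted_list_of_set ({..<length ks} - J)) @ [1, 2] @ map (\<lambda>j. j + 3) (sorted_list_of_set J))
    = sign_exp (-1) (map (\<lambda>k. k + 1) ks) J"
proof -
  let ?ds = "[- 2, 1, - 2] @ map (\<lambda>k. k + 1) ks"
  let ?I = "sorted_list_of_set ({..<length ks} - J)" and ?J = "sorted_list_of_set J"
  have fin: "finite J" using J by (rule finite_subset) simp
  have 1: "koszul ?ds ([0] @ map (\<lambda>i. i + 3) ?I) = 0" "koszul ?ds ([1, 2] @ map (\<lambda>j. j + 3) ?J) = 0"
    by (rule koszul_sorted, auto simp: sorted_map sorted_wrt_map)+
  have "koszul ?ds (([0] @ map (\<lambda>i. i + 3) ?I) @ ([1, 2] @ map (\<lambda>j. j + 3) ?J)) =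
      inversions ?ds ([0] @ map (\<lambda>i. i + 3) ?I) ([1, 2] @ map (\<lambda>j. j + 3) ?J)"
    unfolding koszul_append[of _ "[0] @ map (\<lambda>i. i + 3) ?I"] 1 by simp
  also have "\<dots> = (\<Sum>i\<leftarrow>?I. (?ds ! (i + 3)) * (1 + - 2 + (\<Sum>j\<leftarrow>?J. if j < i then ?ds ! (j + 3) else 0)))"
    by (simp add: inversions_def comp_def sum_list_const_mult[symmetric] algebra_simps if_distrib cong: if_cong)
  also have "\<dots> = (\<Sum>i\<in>{..<length ks} - J. (?ds ! (i + 3)) * (1 + - 2 + (\<Sum>j\<in>J. if j < i then ?ds ! (j + 3) else 0)))"
    using fin by (simp add: sum_list_distinct_conv_sum_set)
  also have "\<dots> = sign_exp (-1) (map (\<lambda>k. k + 1) ks) J"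
    unfolding sign_exp_def length_map
  proof (rule sum.cong[OF HOL.refl])
    fix i assume i: "i \<in> {..<length ks} - J"
    have "(\<Sum>j\<in>J. if j < i then ?ds ! (j + 3) else 0) = (\<Sum>j | j \<in> J \<and> j < i. map (\<lambda>k. k + 1) ks ! j)"
      using fin J by (intro sum.mono_neutral_cong_right) (auto simp: nth_append)
    then show "(?ds ! (i + 3)) * (1 + - 2 + (\<Sum>j\<in>J. if j < i then ?ds ! (j + 3) else 0)) =
        map (\<lambda>k. k + 1) ks ! i * (- 1 + (\<Sum>j | j \<in> J \<and> j < i. map (\<lambda>k. k + 1) ks ! j))"
      using i by (simp add: nth_append)
  qed
  finally show ?thesis by simp
qed

section \<open>The Maurer-Cartan equation from vanishing curvature\<close>

definition unary :: "('a::cdga \<times> int) list \<Rightarrow> 'a" where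
  "unary zs = (if length zs = 1 then \<delta> (fst (hd zs)) else 0)"

text \<open>The inserted constant arrives as the last argument; the signs of the recursion are those
  of carrying its differential to the front.\<close>

lemma prelie_constant:
  assumes "right_linear L" "graded zs" "c \<in> hmg (k - 1)"
  shows "prelie k (cochain L) (\<lambda>x. if x = [] then c else 0) zs = L (\<d> c * dprod zs)"
  using assms
proof (induction zs arbitrary: L)
  case (Cons z zs)
  have z: "graded [z]" using Cons.prems by simp
  have "prelie (k + snd z) (cochain L) (\<lambda>x. 0) zs = 0"
    using Cons.prems by (intro prelie_zero_right multiadditive_cochain) auto
  moreover have "\<d> (fst z) * \<d> c = ksign (snd z * k) (\<d> c * \<d> (fst z))"
    using hmg_kaehler_closed(8)[OF Cons.prems(3)] by (intro graded_commute kd_hmg z) simp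
  moreover have "prelie k (cochain (\<lambda>x. L (\<d> (fst z) * x))) (\<lambda>x. if x = [] then c else 0) zs =
      L (\<d> (fst z) * (\<d> c * dprod zs))"
    using Cons.prems by (intro Cons.IH right_linear_contract) auto
  ultimately show ?case
    using Cons.prems(1) by (simp add: right_linearD ksign_even flip: mult.assoc)
qed simp

text \<open>Inserting \<delta> into one argument at a time reproduces the derivation \<delta> on
  products of differentials; the minus sign is that of the rule
  \<open>\<delta>(df) = - d(\<delta> f)\<close>.\<close>

lemma prelie_unary:
  assumes "right_linear L" "graded zs"
  shows "prelie (-1) (cochain L) unary zs = - L (\<delta> (dprod zs))"
  using assms
proof (induction zs arbitrary: L)
  case Nil
  then show ?case by (simp add: unary_def right_linearD)
next
  case (Cons z zs)
  have z: "fst z \<in> hmg (snd z - 1)" and zs: "graded zs" using Cons.prems by auto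
  have "(\<lambda>x. unary (z # x)) = (\<lambda>x. if x = [] then \<delta> (fst z) else 0)"
    by (auto simp: unary_def)
  then have 1: "prelie (snd z - 1) (cochain L) (\<lambda>x. unary (z # x)) zs = L (\<d> (\<delta> (fst z)) * dprod zs)"
    using prelie_constant[OF Cons.prems(1) zs, of "\<delta> (fst z)" "snd z - 1"] dlt_hmg[OF z] by simp
  have "\<d> (fst z) \<in> hmg (snd z)" using kd_hmg[of z] z by simp
  then have "\<delta> (\<d> (fst z) * dprod zs) = - (\<d> (\<delta> (fst z)) * dprod zs) + ksign (snd z) (\<d> (fst z) * \<delta> (dprod zs))"
    by (simp add: dlt_mult kd_kaehler)
  then show ?case
    using Cons.IH[OF right_linear_contract[OF Cons.prems(1), of "\<d> (fst z)"] zs] Cons.prems(1)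
    by (simp add: 1 right_linearD) (simp add: ksign_def)
qed

context poisson_resolution
begin

lemma maurer_cartan:
  assumes w: "admissible w" and flat: "\<And>zs. graded zs \<Longrightarrow> curvature w zs = 0"
    and fs: "list_all2 (\<lambda>f k. f \<in> hmg k) fs ks" and s: "length fs = s" "2 \<le> s"
  shows "mv_dlt 2 (ev w) (prod_list (map \<d> fs)) +
    (1 / 2) *\<^sub>C (\<Sum>(p, q) | 2 \<le> p \<and> 2 \<le> q \<and> p + q = s + 1. schouten p q 2 2 (ev w) (ev w) fs ks) = 0"
proof -
  let ?P = "ev w"
  define zs where "zs = zip fs (map (\<lambda>k. k + 1) ks)"
  have len: "length ks = s" "length zs = s" using list_all2_lengthD[OF fs] s by (auto simp: zs_def)
  have snd: "map snd zs = map (\<lambda>k. k + 1) ks" and fst: "map fst zs = fs" using len s by (simp_all add: zs_def)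
  have g: "graded zs"
    using fs s len unfolding graded_def zs_def by (auto simp: set_zip list_all2_conv_all_nth)
  have dz: "dprod (map ((!) zs) xs) = prod_list (map (\<lambda>i. \<d> (fs ! i)) xs)" if "set xs \<subseteq> {..<s}" for xs
  proof -
    have "fst (zs ! i) = fs ! i" if "i < s" for i using that len s by (simp add: zs_def)
    then have "map (\<lambda>z. \<d> (fst z)) (map ((!) zs) xs) = map (\<lambda>i. \<d> (fs ! i)) xs"
      using that by auto
    then show ?thesis unfolding dprod_def by (simp only:)
  qed
  have dzs: "dprod zs = prod_list (map \<d> fs)" unfolding dprod_def fst[symmetric] by (simp add: comp_def)
  note P = admissibleD(6)[OF w]
  \<comment> \<open>The inner factor is split into its unary part and the part of arity at least 2.
    The unary part yields the term with \<delta> on forms, up to sign.\<close>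
  define p2 where "p2 x = (if 2 \<le> length x then ?P (dprod x) else 0)" for x
  define summand where "summand J = ksign (sign_exp (-1) (map (\<lambda>k. k + 1) ks) J)
      (?P (prod_list (map (\<lambda>i. \<d> (fs ! i)) (sorted_list_of_set ({..<s} - J))) *
         \<d> (?P (prod_list (map (\<lambda>j. \<d> (fs ! j)) (sorted_list_of_set J))))))" for J
  have split: "cochain ?P = (\<lambda>x. unary x + p2 x)"
  proof
    fix x :: "('a \<times> int) list"
    consider "x = []" | z where "x = [z]" | "2 \<le> length x"
      by (cases x; cases "tl x") auto
    then show "?P (dprod x) = unary x + p2 x"
      by cases (auto simp: unary_def p2_def ev_one_kd[OF w] admissibleD(8)[OF w])
  qed
  have circ: "circ t 2 2 ?P ?P fs ks = (\<Sum>J | J \<subseteq> {..<s} \<and> card J = t. summand J)" for t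
    unfolding circ_def Let_def s(1) summand_def
    using koszul_sign_exp[of _ ks] len by (intro sum.cong) auto
  have "prelie (-1) (cochain ?P) p2 zs = (\<Sum>J\<in>Pow {..<s}. if 2 \<le> card J then summand J else 0)"
    unfolding prelie_sum len snd
  proof (rule sum.cong[OF HOL.refl])
    fix J assume "J \<in> Pow {..<s}"
    then have J: "J \<subseteq> {..<s}" "finite J" by (auto intro: finite_subset)
    have "p2 (map ((!) zs) (sorted_list_of_set J)) =
        (if 2 \<le> card J then ?P (prod_list (map (\<lambda>j. \<d> (fs ! j)) (sorted_list_of_set J))) else 0)"
      using dz[of "sorted_list_of_set J"] J by (simp add: p2_def)
    moreover have "dprod (map ((!) zs) (sorted_list_of_set ({..<s} - J))) =
        prod_list (map (\<lambda>i. \<d> (fs ! i)) (sorted_list_of_set ({..<s} - J)))"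
      by (intro dz) auto
    ultimately show "ksign (sign_exp (-1) (map (\<lambda>k. k + 1) ks) J)
        (?P (dprod (map ((!) zs) (sorted_list_of_set ({..<s} - J)) @
          [(p2 (map ((!) zs) (sorted_list_of_set J)), - 1 + (\<Sum>j\<in>J. snd (zs ! j)))]))) =
      (if 2 \<le> card J then summand J else 0)"
      by (simp add: summand_def right_linearD[OF P])
  qed
  also have "\<dots> = (\<Sum>J | J \<subseteq> {..<s} \<and> 2 \<le> card J. summand J)"
    by (rule sum.mono_neutral_cong_right) auto
  \<comment> \<open>If the inner factor takes all arguments, the outer one has a single argument and
    is \<delta>, giving the other half of \<open>mv_dlt\<close>. Every other \<open>J\<close> leaves
    the outer factor at least two arguments, hence the range \<open>{2..<s}\<close>.\<close>
  also have "{J. J \<subseteq> {..<s} \<and> 2 \<le> card J} = insert {..<s} {J. J \<subseteq> {..<s} \<and> card J \<in> {2..<s}}"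
  proof (intro equalityI subsetI)
    fix J assume "J \<in> {J. J \<subseteq> {..<s} \<and> 2 \<le> card J}"
    then have J: "J \<subseteq> {..<s}" "2 \<le> card J" by auto
    have "card J \<le> s" using card_mono[OF _ J(1)] by simp
    moreover have "J = {..<s}" if "card J = s" using card_subset_eq[OF _ J(1)] that by simp
    ultimately show "J \<in> insert {..<s} {J. J \<subseteq> {..<s} \<and> card J \<in> {2..<s}}"
      using J by (cases "card J = s") auto
  qed (use s(2) in auto)
  also have "sum summand \<dots> = summand {..<s} + sum summand {J. J \<subseteq> {..<s} \<and> card J \<in> {2..<s}}"
    by (rule sum.insert) auto
  also have "summand {..<s} = \<delta> (?P (prod_list (map \<d> fs)))"
  proof -
    have "map (\<lambda>j. \<d> (fs ! j)) [0..<s] = map \<d> fs" using s(1) by (auto intro: nth_equalityI)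
    then show ?thesis
      unfolding summand_def by (simp add: sign_exp_def len lessThan_atLeast0 ev_one_kd[OF w])
  qed
  also have "sum summand {J. J \<subseteq> {..<s} \<and> card J \<in> {2..<s}} = (\<Sum>q\<in>{2..<s}. circ q 2 2 ?P ?P fs ks)"
  proof -
    let ?S = "{J. J \<subseteq> {..<s} \<and> card J \<in> {2..<s}}"
    have "(\<Sum>q\<in>{2..<s}. sum summand {J \<in> ?S. card J = q}) = sum summand ?S"
      by (rule sum.group) auto
    moreover have "{J \<in> ?S. card J = q} = {J. J \<subseteq> {..<s} \<and> card J = q}" if "q \<in> {2..<s}" for q
      using that by auto
    ultimately show ?thesis unfolding circ by simp
  qed
  finally have p2: "prelie (-1) (cochain ?P) p2 zs =
      \<delta> (?P (prod_list (map \<d> fs))) + (\<Sum>q\<in>{2..<s}. circ q 2 2 ?P ?P fs ks)" .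
  have "0 = prelie (-1) (cochain ?P) (\<lambda>x. unary x + p2 x) zs"
    using flat[OF g] unfolding curvature_def split by (rule HOL.sym)
  also have "\<dots> = - ?P (\<delta> (prod_list (map \<d> fs))) + prelie (-1) (cochain ?P) p2 zs"
    unfolding prelie_right_add[OF multiadditive_cochain[OF P]] prelie_unary[OF P g] dzs ..
  finally have main: "mv_dlt 2 ?P (prod_list (map \<d> fs)) + (\<Sum>q\<in>{2..<s}. circ q 2 2 ?P ?P fs ks) = 0"
    unfolding p2 mv_dlt_def by (simp add: ksign_even algebra_simps)
  \<comment> \<open>For upper degrees 2 and 2 the sign in the bracket is plus, so a pair
    \<open>(p, q)\<close> contributes the compositions with inner arity \<open>q\<close> and with
    inner arity \<open>p\<close>. Both run through \<open>{2..<s}\<close>, and the factor 1/2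
    removes the doubling.\<close>
  let ?A = "{(p, q). 2 \<le> p \<and> 2 \<le> q \<and> p + q = s + 1}" and ?c = "\<lambda>q. circ q 2 2 ?P ?P fs ks"
  have A1: "?A = (\<lambda>q. (s + 1 - q, q)) ` {2..<s}" and A2: "?A = (\<lambda>p. (p, s + 1 - p)) ` {2..<s}"
    by (auto simp: image_def)
  have "(\<Sum>(p, q)\<in>?A. schouten p q 2 2 ?P ?P fs ks) = (\<Sum>x\<in>?A. ?c (snd x)) + (\<Sum>x\<in>?A. ?c (fst x))"
    unfolding sum.distrib[symmetric] by (rule sum.cong) (auto simp: schouten_def ksign_odd)
  also have "(\<Sum>x\<in>?A. ?c (snd x)) = (\<Sum>q\<in>{2..<s}. ?c q)"
    unfolding A1 by (subst sum.reindex) (auto simp: inj_on_def)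
  also have "(\<Sum>x\<in>?A. ?c (fst x)) = (\<Sum>q\<in>{2..<s}. ?c q)"
    unfolding A2 by (subst sum.reindex) (auto simp: inj_on_def)
  finally have "(1 / 2) *\<^sub>C (\<Sum>(p, q)\<in>?A. schouten p q 2 2 ?P ?P fs ks) = (\<Sum>q\<in>{2..<s}. ?c q)"
    by (simp add: scaleC_add_right flip: scaleC_add_left)
  then show ?thesis using main by simp
qed

text \<open>Moving the scalar from the right of the form to the left of the value crosses degrees
  \<open>n\<close> and \<open>n - 2\<close>; the two signs agree, so right-linearity becomes the
  left-linearity required.\<close>

lemma ev_multivector:
  assumes w: "admissible w"
  shows "ev w \<in> multivectors s 2"
proof -
  note P = right_linearD[OF admissibleD(6)[OF w]] and d = admissibleD(7)[OF w]
  have "ev w (inc f * x) = ksign (- 2 * k) (f * ev w x)" if f: "f \<in> hmg k" for k f x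
  proof (induction x rule: hmg_induct)
    case (homogeneous n x)
    have "ev w x \<in> hmg (n - 2)" using d homogeneous unfolding map_degree_def by fastforce
    then have "f * ev w x = ksign (k * (n - 2)) (ev w x * f)" using f by (intro graded_commute)
    moreover have "inc f * x = ksign (k * n) (x * inc f)"
      by (intro graded_commute hmg_kaehler_closed f homogeneous)
    ultimately show ?case by (simp add: P) (rule ksign_cong, auto)
  qed (simp add: P distrib_left ksign_add)
  then show ?thesis
    using d unfolding multivectors_def map_degree_def by (auto simp: P(1) algebra_simps)
qed

end

theorem mainTheorem1:
  fixes br :: "'o::cdga \<Rightarrow> 'o \<Rightarrow> 'o"
    and \<epsilon> :: "'a::cdga \<Rightarrow> 'o"
    and r :: nat
    and u :: "nat \<Rightarrow> 'a"
    and e :: "nat \<Rightarrow> int"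
  assumes "concentrated_in_degree_0 TYPE('o)"
    and "poisson_structure br"
    and "polynomial_cdga r u e"
    and "\<forall>i<r. 0 \<le> e i"
    and "cdga_hom \<epsilon>"
    and "quasi_iso \<epsilon>"
  shows "\<exists>\<pi> :: nat \<Rightarrow> 'a kaehler \<Rightarrow> 'a.
           homotopy_poisson \<pi> \<and> (\<forall>f g. \<epsilon> (\<pi> 2 (\<d> f * \<d> g)) = br (\<epsilon> f) (\<epsilon> g))"
proof -
  interpret poisson_resolution r u e br \<epsilon>
    using assms by unfold_locales auto
  obtain w where w: "admissible w" "\<And>zs. graded zs \<Longrightarrow> curvature w zs = 0"
    using flat_exists by blast
  \<comment> \<open>One functional serves for every arity, since only its values on \<Omega>
    \<open>s\<close> count for the component with index \<open>s\<close>.\<close>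
  have "homotopy_poisson (\<lambda>_. ev w)"
    unfolding homotopy_poisson_def using ev_multivector[OF w(1)] maurer_cartan[OF w] by blast
  then show ?thesis
    using ev_two_kd[OF w(1)] by (intro exI[of _ "\<lambda>_. ev w"]) simp
qed

end
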